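(* Let $d\geq 1$ and let $F\subseteq\mathbb Z^d$ be finite. Suppose that either $|F|=2q$ for an odd prime $q$, or $|F|=9$. If $F$ tiles $\mathbb Z^d$ by translations, then it admits a fully periodic tiling complement. Equivalently, there exist an integer $M\geq 1$ and a set $B\subseteq\mathbb Z^d$ such that \[ F\oplus B=\mathbb Z^d,\qquad B+M\mathbb Z^d=B. \]
   Context: For $F,A\subseteq\mathbb Z^d$ with $F$ finite, $F\oplus A=\mathbb Z^d$ means that every $x\in\mathbb Z^d$ has a unique representation $x=f+a$ with $f\in F$, $a\in A$; then $A$ is called a tiling complement of $F$. $F$ tiles $\mathbb Z^d$ by translations if it has some tiling complement. A tiling complement $A$ is fully periodic if $A+\Gamma=A$ for some finite-index subgroup $\Gamma\leq\mathbb Z^d$. *)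

theory Defs
  imports
    "HOL-Analysis.Finite_Cartesian_Product"
    "HOL-Algebra.Coset"
    "HOL-Library.Set_Algebras"
    "HOL-Computational_Algebra.Primes"
begin

text \<open>The lattice of dimension d is the type \<open>int ^ 'd\<close> with d the cardinality of the
  index type. Sums of sets are the Minkowski sums of \<^theory>\<open>HOL-Library.Set_Algebras\<close>.\<close>

definition tiling_complement :: "('a::ab_group_add) set \<Rightarrow> 'a set \<Rightarrow> bool" where
  "tiling_complement F A \<longleftrightarrow> (\<forall>x. \<exists>!p. p \<in> F \<times> A \<and> x = fst p + snd p)"

definition tiles :: "('a::ab_group_add) set \<Rightarrow> bool" where
  "tiles F \<longleftrightarrow> (\<exists>A. tiling_complement F A)"

definition add_group :: "('a::ab_group_add) monoid" where
  "add_group = \<lparr>carrier = UNIV, monoid.mult = (+), one = 0\<rparr>"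

definition finite_index_subgroup :: "('a::ab_group_add) set \<Rightarrow> bool" where
  "finite_index_subgroup \<Gamma> \<longleftrightarrow> subgroup \<Gamma> add_group \<and> finite (rcosets\<^bsub>add_group\<^esub> \<Gamma>)"

definition fully_periodic :: "('a::ab_group_add) set \<Rightarrow> bool" where
  "fully_periodic A \<longleftrightarrow> (\<exists>\<Gamma>. finite_index_subgroup \<Gamma> \<and> A + \<Gamma> = A)"

lemma group_add_group: "group (add_group :: ('a::ab_group_add) monoid)"
proof (rule groupI)
  fix x :: 'a
  assume "x \<in> carrier add_group"
  show "\<exists>y\<in>carrier add_group. y \<otimes>\<^bsub>add_group\<^esub> x = \<one>\<^bsub>add_group\<^esub>"
    by (rule bexI[of _ "- x"]) (auto simp: add_group_def)
qed (auto simp: add_group_def add.assoc)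

end

theory Submission
  imports Defs "HOL-Complex_Analysis.Great_Picard" "HOL-Number_Theory.Cong"
begin

text \<open>
  By the Frobenius congruence, a tiling by \<open>F\<close> is also a tiling by \<open>r F\<close> for every \<open>r\<close> coprime to
  the cardinality of \<open>F\<close>. Hence a difference of tilings is a bounded function killed by the sums
  over all these dilates, and the span of its translates contains a function with so many
  translations acting by scalars that \<open>F\<close> splits into classes on which the power sums of the
  eigenvalues vanish. When these roots of unity form full cosets, \<open>F\<close> splits into blocks. If a
  character of finite order on the group generated by \<open>F\<close> separates the blocks, a fully periodic
  complement can be written down, as the common level set of the character and the eigenvalues.

  For \<open>2q\<close> elements, failing this, \<open>F\<close> satisfies enough relations that the number of ways to
  write a point with an element of \<open>A\<close> and one of the dilate \<open>q M F\<close> is a periodic function; it equals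
  \<open>q\<close> times a periodic double cover that contains \<open>A\<close>, and \<open>A\<close> can be replaced by a periodic half of it.

  For nine elements, a tiling without full periods produces two tilings that agree on a half-space
  and differ at the origin. If no character separates the blocks, their difference is periodic along
  the bounding hyperplane, and it is killed by the sums over the levels of \<open>F\<close> parallel to the
  hyperplane. Some level \<open>T\<close> has three elements. Comparing two eigenfunctions in the span of the
  difference yields a character of order three that is trivial exactly on \<open>T\<close> within \<open>F\<close>, up to
  translation, and whose fibres on \<open>F\<close> are blocks after all.
\<close>

section \<open>Dilations of a tile\<close>

text \<open>Periods come from boundedness. If \<open>w\<close> is not a period of a bounded function
  \<open>y\<close>, the span of the translates of \<open>y(x - w) - y(x)\<close> contains a nonzero
  eigenfunction; once relations inside \<open>F\<close> show that \<open>w\<close> fixes it, some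
  function in the span of \<open>y\<close> grows linearly, which is absurd. The blocks are found
  only after \<open>w\<close> has been chosen, so \<open>w\<close> carries in advance a factor that
  serves every possible splitting of \<open>F\<close>. The sizes enter through the exponents: the
  power sums vanish for \<open>r\<close> coprime to \<open>N = 2q\<close> or \<open>N = 3\<close>.
  For \<open>N = 3\<close> every exponent not divisible by 3 occurs, and the eigenvalues fall into
  full cosets of cube roots. For \<open>N = 2q\<close> the exponent \<open>q\<close> is missing, so
  antipodal pairs are possible besides cosets of \<open>q\<close>-th roots. Blocks alone give no
  tiling: a point must first be assigned to one block consistently, which is the task of the
  character. The lattice is treated as a \<open>ring_1\<close> with componentwise product, so that
  \<open>of_nat n * x\<close> is the \<open>n\<close>-fold multiple of \<open>x\<close>.\<close>

definition translate_sum :: "'i set \<Rightarrow> ('i \<Rightarrow> 'a) \<Rightarrow> ('a \<Rightarrow> 'b) \<Rightarrow> 'a::ab_group_add \<Rightarrow> 'b::comm_monoid_add"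
  where "translate_sum I g u x = (\<Sum>i\<in>I. u (x - g i))"

text \<open>Binomial theorem for two commuting operators, the translation by \<open>g j\<close> and
  the sum over \<open>I\<close>. Indexing by \<open>I\<close> counts coinciding translations with
  multiplicity and lets one index set carry all dilates.\<close>

lemma translate_sum_pow_insert:
  fixes g :: "'i \<Rightarrow> 'a::ring_1" and u :: "'a \<Rightarrow> int"
  assumes "finite I" "j \<notin> I"
  shows "(translate_sum (insert j I) g ^^ n) u x =
    (\<Sum>k\<le>n. int (n choose k) * (translate_sum I g ^^ (n - k)) u (x - of_nat k * g j))"
proof (induction n arbitrary: x)
  case 0
  show ?case by simp
next
  case (Suc n)
  let ?G = "\<lambda>m. (translate_sum I g ^^ m) u"
  let ?v = "g j"
  have "(translate_sum (insert j I) g ^^ Suc n) u x =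
     (translate_sum (insert j I) g ^^ n) u (x - ?v) + (\<Sum>i\<in>I. (translate_sum (insert j I) g ^^ n) u (x - g i))"
    using assms by (simp add: translate_sum_def)
  also have "(translate_sum (insert j I) g ^^ n) u (x - ?v) =
      (\<Sum>k\<le>n. int (n choose k) * ?G (n - k) (x - of_nat (Suc k) * ?v))"
    by (simp add: Suc.IH algebra_simps)
  also have "\<dots> = (\<Sum>k\<le>Suc n. (if k = 0 then 0 else int (n choose (k - 1)) * ?G (Suc n - k) (x - of_nat k * ?v)))"
    by (subst sum.atMost_Suc_shift) simp
  also have "(\<Sum>i\<in>I. (translate_sum (insert j I) g ^^ n) u (x - g i)) =
      (\<Sum>k\<le>n. int (n choose k) * (\<Sum>i\<in>I. ?G (n - k) (x - g i - of_nat k * ?v)))"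
    by (simp add: Suc.IH sum_distrib_left sum.swap[of _ I])
  also have "\<dots> = (\<Sum>k\<le>n. int (n choose k) * ?G (Suc n - k) (x - of_nat k * ?v))"
    by (intro sum.cong refl arg_cong2[of _ _ _ _ "(*)"])
      (auto simp: Suc_diff_le translate_sum_def algebra_simps)
  also have "\<dots> = (\<Sum>k\<le>Suc n. int (n choose k) * ?G (Suc n - k) (x - of_nat k * ?v))"
    by simp
  also have "(\<Sum>k\<le>Suc n. (if k = 0 then 0 else int (n choose (k - 1)) * ?G (Suc n - k) (x - of_nat k * ?v))) + \<dots> =
     (\<Sum>k\<le>Suc n. int (Suc n choose k) * ?G (Suc n - k) (x - of_nat k * ?v))"
    unfolding sum.distrib[symmetric]
  proof (intro sum.cong refl)
    fix k
    show "(if k = 0 then 0 else int (n choose (k - 1)) * ?G (Suc n - k) (x - of_nat k * ?v)) +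
        int (n choose k) * ?G (Suc n - k) (x - of_nat k * ?v) =
        int (Suc n choose k) * ?G (Suc n - k) (x - of_nat k * ?v)"
      by (cases k) (auto simp: algebra_simps)
  qed
  finally show ?case .
qed

text \<open>The middle binomial coefficients are divisible by \<open>p\<close>, so the
  \<open>p\<close>-th power of a sum of translations is congruent to the sum of their
  \<open>p\<close>-th powers, which are the translations by \<open>p g i\<close>.\<close>

lemma translate_sum_frobenius:
  fixes g :: "'i \<Rightarrow> 'a::ring_1" and u :: "'a \<Rightarrow> int"
  assumes "finite I" and p: "prime p"
  shows "[(translate_sum I g ^^ p) u x = translate_sum I (\<lambda>i. of_nat p * g i) u x] (mod int p)"
  using assms(1)
proof (induction I arbitrary: x rule: finite_induct)
  case empty
  then obtain m where "p = Suc m" using p not0_implies_Suc by fastforce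
  then show ?case by (simp add: translate_sum_def)
next
  case (insert j I)
  let ?t = "\<lambda>k. int (p choose k) * (translate_sum I g ^^ (p - k)) u (x - of_nat k * g j)"
  have p0: "p > 0" using p prime_gt_0_nat by blast
  have "(translate_sum (insert j I) g ^^ p) u x = sum ?t {..p}"
    using translate_sum_pow_insert[OF insert.hyps] .
  also have "{..p} = insert 0 (insert p {1..<p})" using p0 by auto
  also have "sum ?t \<dots> = ?t 0 + (?t p + sum ?t {1..<p})"
    using p0 by simp
  also have "[\<dots> = ?t 0 + (?t p + 0)] (mod int p)"
  proof (intro cong_add cong_refl)
    have "int p dvd ?t k" if "k \<in> {1..<p}" for k
    proof -
      have "p dvd (p choose k)" using p that by (intro dvd_choose_prime) auto
      then show ?thesis by simp
    qed
    then show "[sum ?t {1..<p} = 0] (mod int p)"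
      unfolding cong_0_iff by (rule dvd_sum)
  qed
  also have "?t 0 + (?t p + 0) = (translate_sum I g ^^ p) u x + u (x - of_nat p * g j)" by simp
  also have "[\<dots> = translate_sum I (\<lambda>i. of_nat p * g i) u x + u (x - of_nat p * g j)] (mod int p)"
    by (intro cong_add insert.IH cong_refl)
  also have "translate_sum I (\<lambda>i. of_nat p * g i) u x + u (x - of_nat p * g j) =
     translate_sum (insert j I) (\<lambda>i. of_nat p * g i) u x"
    using insert.hyps by (simp add: translate_sum_def)
  finally show ?case .
qed

lemma translate_sum_pow_const:
  fixes u :: "'a::ring_1 \<Rightarrow> int"
  assumes "finite I" "\<And>x. translate_sum I g u x = c"
  shows "(translate_sum I g ^^ Suc n) u x = int (card I) ^ n * c"
proof (induction n arbitrary: x)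
  case 0
  then show ?case using assms by simp
next
  case (Suc n)
  have "(translate_sum I g ^^ Suc (Suc n)) u x = (\<Sum>i\<in>I. (translate_sum I g ^^ Suc n) u (x - g i))"
    by (simp add: translate_sum_def)
  then show ?case by (simp only: Suc.IH) simp
qed

lemma translate_sum_pow_dvd:
  fixes u :: "'a::ring_1 \<Rightarrow> int"
  assumes "finite I" "\<And>x. d dvd translate_sum I g u x"
  shows "d dvd (translate_sum I g ^^ Suc n) u x"
proof (induction n arbitrary: x)
  case (Suc n)
  have "(translate_sum I g ^^ Suc (Suc n)) u x = (\<Sum>i\<in>I. (translate_sum I g ^^ Suc n) u (x - g i))"
    by (simp add: translate_sum_def)
  then show ?case by (simp only:) (intro dvd_sum Suc.IH)
qed (use assms in auto)

text \<open>The count \<open>?N\<close> for the dilate is congruent modulo \<open>p\<close> to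
  \<open>card I ^ (p - 1)\<close>, which \<open>p\<close> does not divide, so it is at least 1.
  Summed over the translates by \<open>g i\<close> it totals \<open>card I\<close>, so no value can
  exceed 1.\<close>

lemma tiling_dilate_prime:
  fixes g :: "'i \<Rightarrow> 'a::ring_1" and u :: "'a \<Rightarrow> int"
  assumes fin: "finite I" and p: "prime p" "coprime p (card I)" and u: "\<And>x. u x \<ge> 0"
    and tile: "\<And>x. translate_sum I g u x = 1"
  shows "translate_sum I (\<lambda>i. of_nat p * g i) u x = 1"
proof -
  let ?N = "translate_sum I (\<lambda>i. of_nat p * g i) u"
  obtain m where m: "p = Suc m" using p(1) not0_implies_Suc by fastforce
  have nz: "?N x \<ge> 1" for x
  proof (rule ccontr)
    assume "\<not> ?N x \<ge> 1"
    moreover have "?N x \<ge> 0" unfolding translate_sum_def by (intro sum_nonneg u)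
    ultimately have "?N x = 0" by simp
    moreover have "[(translate_sum I g ^^ p) u x = ?N x] (mod int p)"
      by (rule translate_sum_frobenius[OF fin p(1)])
    moreover have "(translate_sum I g ^^ p) u x = int (card I) ^ m"
      using translate_sum_pow_const[OF fin tile] m by simp
    ultimately have "int p dvd int (card I) ^ m" by (simp add: cong_0_iff)
    then have "p dvd card I ^ m" by (metis of_nat_dvd_iff of_nat_power)
    then have "p dvd card I" using p(1) prime_dvd_power by blast
    then show False using p
      by (metis coprime_absorb_left not_prime_unit)
  qed
  have "(\<Sum>i\<in>I. ?N (y - g i)) = int (card I)" for y
  proof -
    have "(\<Sum>i\<in>I. ?N (y - g i)) = (\<Sum>j\<in>I. translate_sum I g u (y - of_nat p * g j))"
      unfolding translate_sum_def by (subst sum.swap) (simp add: algebra_simps)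
    then show ?thesis by (simp add: tile)
  qed
  then have s: "(\<Sum>i\<in>I. ?N (y - g i) - 1) = 0" for y
    by (simp add: sum_subtractf)
  have "I \<noteq> {}" using tile[of 0] by (auto simp: translate_sum_def)
  then obtain i where i: "i \<in> I" by blast
  have "\<forall>j\<in>I. ?N ((x + g i) - g j) - 1 = 0"
    using s[of "x + g i"] by (subst (asm) sum_nonneg_eq_0_iff[OF fin]) (use nz in \<open>auto simp flip: int_one_le_iff_zero_less\<close>)
  then show ?thesis using i by force
qed

lemma tiling_dilate:
  fixes g :: "'i \<Rightarrow> 'a::ring_1" and u :: "'a \<Rightarrow> int"
  assumes fin: "finite I" and r: "coprime r (card I)" "r > 0" and u: "\<And>x. u x \<ge> 0"
    and tile: "\<And>x. translate_sum I g u x = 1"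
  shows "translate_sum I (\<lambda>i. of_nat r * g i) u x = 1"
  using r
proof (induction r arbitrary: x rule: less_induct)
  case (less r)
  show ?case
  proof (cases "r = 1")
    case True
    then show ?thesis using tile by (simp add: translate_sum_def)
  next
    case False
    then obtain p where p: "prime p" "p dvd r" using prime_factor_nat by blast
    then obtain s where s: "r = p * s" by auto
    have "s > 0" "s < r" using s less.prems p(1) prime_gt_1_nat[of p] by auto
    moreover have "coprime s (card I)" "coprime p (card I)" using less.prems s by auto
    ultimately have "\<And>x. translate_sum I (\<lambda>i. of_nat s * g i) u x = 1" using less.IH by blast
    from tiling_dilate_prime[OF fin p(1) \<open>coprime p (card I)\<close> u this]
    show ?thesis by (simp add: s mult.assoc)
  qed
qed

text \<open>Serves the prime \<open>q\<close> dividing \<open>card F = 2 * q\<close>, where a dilate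
  need not tile: divisibility of the counts survives iterated sums, and Frobenius carries it to the
  dilate.\<close>

lemma translate_sum_dvd_dilate:
  fixes g :: "'i \<Rightarrow> 'a::ring_1" and u :: "'a \<Rightarrow> int"
  assumes fin: "finite I" and p: "prime p" and d: "\<And>x. int p dvd translate_sum I g u x"
  shows "int p dvd translate_sum I (\<lambda>i. of_nat p * g i) u x"
proof -
  obtain m where "p = Suc m" using p not0_implies_Suc by fastforce
  then have "int p dvd (translate_sum I g ^^ p) u x"
    using translate_sum_pow_dvd[OF fin d] by simp
  then show ?thesis
    using translate_sum_frobenius[OF fin p, of g u x] by (simp add: cong_dvd_iff)
qed

section \<open>Translation eigenvectors\<close>

text \<open>The translation-invariant linear span. Boundedness, vanishing sums, eigenvalues and
  support in a half-space all pass to it by rule induction.\<close>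

inductive_set shift_span :: "('a::ab_group_add \<Rightarrow> complex) \<Rightarrow> ('a \<Rightarrow> complex) set" for \<phi> where
  base: "\<phi> \<in> shift_span \<phi>"
| add: "\<psi> \<in> shift_span \<phi> \<Longrightarrow> \<psi>' \<in> shift_span \<phi> \<Longrightarrow> (\<lambda>x. \<psi> x + \<psi>' x) \<in> shift_span \<phi>"
| scale: "\<psi> \<in> shift_span \<phi> \<Longrightarrow> (\<lambda>x. c * \<psi> x) \<in> shift_span \<phi>"
| shift: "\<psi> \<in> shift_span \<phi> \<Longrightarrow> (\<lambda>x. \<psi> (x - v)) \<in> shift_span \<phi>"

lemma shift_span_sum:
  assumes "finite I" "\<And>i. i \<in> I \<Longrightarrow> u i \<in> shift_span \<phi>"
  shows "(\<lambda>x. \<Sum>i\<in>I. u i x) \<in> shift_span \<phi>"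
  using assms
proof (induction I rule: finite_induct)
  case empty
  show ?case using shift_span.scale[OF shift_span.base, of 0] by simp
next
  case (insert i I)
  then show ?case using shift_span.add[of "u i" \<phi> "\<lambda>x. \<Sum>i\<in>I. u i x"] by simp
qed

lemma shift_span_diff:
  assumes "\<psi> \<in> shift_span \<phi>" "\<psi>' \<in> shift_span \<phi>"
  shows "(\<lambda>x. \<psi> x - \<psi>' x) \<in> shift_span \<phi>"
  using shift_span.add[OF assms(1) shift_span.scale[OF assms(2), of "-1"]] by simp

lemma shift_span_trans:
  assumes "\<psi> \<in> shift_span \<phi>" "\<phi> \<in> shift_span \<xi>"
  shows "\<psi> \<in> shift_span \<xi>"
  using assms(1)
  by (induction rule: shift_span.induct) (auto intro: assms(2) shift_span.intros)

text \<open>Convolution commutes with every operation that builds the span, so the span of an image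
  is the image of the span. This keeps a bounded preimage at hand while eigenvectors are
  extracted.\<close>

lemma shift_span_image:
  assumes "\<psi> \<in> shift_span (\<lambda>x. \<Sum>s\<in>S. \<phi> (x - g s))"
  obtains \<xi> where "\<xi> \<in> shift_span \<phi>" "\<psi> = (\<lambda>x. \<Sum>s\<in>S. \<xi> (x - g s))"
proof -
  have "\<exists>\<xi> \<in> shift_span \<phi>. \<psi> = (\<lambda>x. \<Sum>s\<in>S. \<xi> (x - g s))"
    using assms
  proof (induction rule: shift_span.induct)
    case base
    then show ?case using shift_span.base by blast
  next
    case (add \<psi> \<psi>')
    then obtain \<xi> \<xi>' where "\<xi> \<in> shift_span \<phi>" "\<psi> = (\<lambda>x. \<Sum>s\<in>S. \<xi> (x - g s))"
      "\<xi>' \<in> shift_span \<phi>" "\<psi>' = (\<lambda>x. \<Sum>s\<in>S. \<xi>' (x - g s))" by auto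
    then show ?case
      by (intro bexI[of _ "\<lambda>x. \<xi> x + \<xi>' x"])
        (auto simp: sum.distrib algebra_simps intro: shift_span.add)
  next
    case (scale \<psi> k)
    then obtain \<xi> where "\<xi> \<in> shift_span \<phi>" "\<psi> = (\<lambda>x. \<Sum>s\<in>S. \<xi> (x - g s))" by auto
    then show ?case
      by (intro bexI[of _ "\<lambda>x. k * \<xi> x"])
        (auto simp: sum_distrib_left algebra_simps intro: shift_span.scale)
  next
    case (shift \<psi> v)
    then obtain \<xi> where "\<xi> \<in> shift_span \<phi>" "\<psi> = (\<lambda>x. \<Sum>s\<in>S. \<xi> (x - g s))" by auto
    then show ?case
      by (intro bexI[of _ "\<lambda>x. \<xi> (x - v)"])
        (auto simp: algebra_simps intro: shift_span.shift)
  qed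
  then show ?thesis using that by blast
qed

lemma shift_span_diff_image:
  assumes "\<psi> \<in> shift_span (\<lambda>x. \<phi> (x - v) - \<phi> x)"
  obtains \<xi> where "\<xi> \<in> shift_span \<phi>" "\<psi> = (\<lambda>x. \<xi> (x - v) - \<xi> x)"
proof -
  have "\<exists>\<xi> \<in> shift_span \<phi>. \<psi> = (\<lambda>x. \<xi> (x - v) - \<xi> x)"
    using assms
  proof (induction rule: shift_span.induct)
    case base
    then show ?case using shift_span.base by blast
  next
    case (add \<psi> \<psi>')
    then obtain \<xi> \<xi>' where "\<xi> \<in> shift_span \<phi>" "\<psi> = (\<lambda>x. \<xi> (x - v) - \<xi> x)"
      "\<xi>' \<in> shift_span \<phi>" "\<psi>' = (\<lambda>x. \<xi>' (x - v) - \<xi>' x)" by auto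
    then show ?case
      by (intro bexI[of _ "\<lambda>x. \<xi> x + \<xi>' x"]) (auto intro: shift_span.add)
  next
    case (scale \<psi> k)
    then obtain \<xi> where "\<xi> \<in> shift_span \<phi>" "\<psi> = (\<lambda>x. \<xi> (x - v) - \<xi> x)" by auto
    then show ?case
      by (intro bexI[of _ "\<lambda>x. k * \<xi> x"]) (auto simp: algebra_simps intro: shift_span.scale)
  next
    case (shift \<psi> w)
    then obtain \<xi> where "\<xi> \<in> shift_span \<phi>" "\<psi> = (\<lambda>x. \<xi> (x - v) - \<xi> x)" by auto
    then show ?case
      by (intro bexI[of _ "\<lambda>x. \<xi> (x - w)"]) (auto simp: algebra_simps intro: shift_span.shift)
  qed
  then show ?thesis using that by blast
qed

lemma shift_span_bounded:
  assumes "\<psi> \<in> shift_span \<phi>" "bounded (range \<phi>)"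
  shows "bounded (range \<psi>)"
  using assms(1)
proof (induction rule: shift_span.induct)
  case (add \<psi> \<psi>')
  then obtain a b where "\<And>x. norm (\<psi> x) \<le> a" "\<And>x. norm (\<psi>' x) \<le> b"
    unfolding bounded_iff by blast
  then have "norm (\<psi> x + \<psi>' x) \<le> a + b" for x
    by (meson add_mono norm_triangle_le)
  then show ?case unfolding bounded_iff by blast
next
  case (scale \<psi> c)
  then obtain a where "\<And>x. norm (\<psi> x) \<le> a" unfolding bounded_iff by blast
  then have "norm (c * \<psi> x) \<le> norm c * a" for x
    by (simp add: norm_mult mult_left_mono)
  then show ?case unfolding bounded_iff by blast
next
  case (shift \<psi> v)
  then show ?case by (auto simp: bounded_iff)
qed (use assms in auto)

lemma shift_span_annihilated:
  assumes "\<psi> \<in> shift_span \<phi>" "\<And>x. (\<Sum>s\<in>S. \<phi> (x - g s)) = 0"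
  shows "(\<Sum>s\<in>S. \<psi> (x - g s)) = 0"
  using assms(1)
proof (induction arbitrary: x rule: shift_span.induct)
  case (shift \<psi> v)
  have "(\<Sum>s\<in>S. \<psi> (x - g s - v)) = (\<Sum>s\<in>S. \<psi> ((x - v) - g s))"
    by (simp add: algebra_simps)
  then show ?case using shift.IH by simp
qed (use assms in \<open>auto simp: sum.distrib simp flip: sum_distrib_left\<close>)

lemma shift_span_eigen:
  assumes "\<psi> \<in> shift_span \<phi>" "\<And>x. \<phi> (x - v) = c * \<phi> x"
  shows "\<psi> (x - v) = c * \<psi> x"
  using assms(1)
proof (induction arbitrary: x rule: shift_span.induct)
  case (shift \<psi> w)
  then show ?case using shift.IH[of "x - w"] by (simp add: algebra_simps)
qed (use assms in \<open>auto simp: algebra_simps\<close>)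

definition eigs :: "('a::ab_group_add \<Rightarrow> complex) \<Rightarrow> 'a set" where
  "eigs \<psi> = {v. \<exists>c. \<forall>x. \<psi> (x - v) = c * \<psi> x}"

text \<open>The scalar is unique only for a nonzero \<open>\<psi>\<close>, which the context below
  therefore assumes.\<close>

definition eig :: "('a::ab_group_add \<Rightarrow> complex) \<Rightarrow> 'a \<Rightarrow> complex" where
  "eig \<psi> v = (THE c. \<forall>x. \<psi> (x - v) = c * \<psi> x)"

context
  fixes \<psi> :: "'a::ring_1 \<Rightarrow> complex"
  assumes nonzero: "\<psi> \<noteq> (\<lambda>_. 0)"
begin

lemma eigI:
  assumes "\<And>x. \<psi> (x - v) = c * \<psi> x"
  shows "v \<in> eigs \<psi>" "eig \<psi> v = c"
proof -
  show "v \<in> eigs \<psi>" using assms unfolding eigs_def by blast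
  obtain y where "\<psi> y \<noteq> 0" using nonzero by blast
  show "eig \<psi> v = c" unfolding eig_def
  proof (rule the_equality)
    fix d assume "\<forall>x. \<psi> (x - v) = d * \<psi> x"
    then show "d = c" using assms[of y] \<open>\<psi> y \<noteq> 0\<close> by (metis mult_right_cancel)
  qed (use assms in blast)
qed

lemma eigD:
  assumes "v \<in> eigs \<psi>"
  shows "\<psi> (x - v) = eig \<psi> v * \<psi> x"
proof -
  obtain c where c: "\<And>x. \<psi> (x - v) = c * \<psi> x" using assms unfolding eigs_def by blast
  then show ?thesis using eigI(2)[OF c] by simp
qed

lemma eig_0 [simp]: "0 \<in> eigs \<psi>" "eig \<psi> 0 = 1"
  using eigI[of 0 1] by simp_all

lemma eig_add:
  assumes "v \<in> eigs \<psi>" "w \<in> eigs \<psi>"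
  shows "v + w \<in> eigs \<psi>" "eig \<psi> (v + w) = eig \<psi> v * eig \<psi> w"
proof -
  have *: "\<psi> (x - (v + w)) = eig \<psi> v * eig \<psi> w * \<psi> x" for x
    using eigD[OF assms(1), of "x - w"] eigD[OF assms(2), of x] by (simp add: algebra_simps)
  show "v + w \<in> eigs \<psi>" "eig \<psi> (v + w) = eig \<psi> v * eig \<psi> w"
    using eigI[OF *] by auto
qed

lemma eig_nonzero:
  assumes "v \<in> eigs \<psi>"
  shows "eig \<psi> v \<noteq> 0"
proof
  assume 0: "eig \<psi> v = 0"
  have "\<psi> x = 0" for x using eigD[OF assms, of "x + v"] 0 by simp
  then show False using nonzero by auto
qed

lemma eig_minus:
  assumes "v \<in> eigs \<psi>"
  shows "- v \<in> eigs \<psi>" "eig \<psi> (- v) = inverse (eig \<psi> v)"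
proof -
  have *: "\<psi> (x - - v) = inverse (eig \<psi> v) * \<psi> x" for x
    using eigD[OF assms, of "x + v"] eig_nonzero[OF assms] by (simp add: field_simps)
  show "- v \<in> eigs \<psi>" "eig \<psi> (- v) = inverse (eig \<psi> v)" using eigI[OF *] by auto
qed

lemma eig_diff:
  assumes "v \<in> eigs \<psi>" "w \<in> eigs \<psi>"
  shows "v - w \<in> eigs \<psi>" "eig \<psi> (v - w) = eig \<psi> v / eig \<psi> w"
  using eig_add[OF assms(1) eig_minus(1)[OF assms(2)]] eig_minus[OF assms(2)]
  by (auto simp: field_simps)

lemma eig_of_nat_mult:
  assumes "v \<in> eigs \<psi>"
  shows "of_nat r * v \<in> eigs \<psi>" "eig \<psi> (of_nat r * v) = eig \<psi> v ^ r"
proof (induction r)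
  case (Suc r)
  case 1 show ?case using eig_add(1)[OF assms Suc(1)] by (simp add: algebra_simps)
  case 2 show ?case using eig_add(2)[OF assms Suc(1)] Suc(2) by (simp add: algebra_simps)
qed auto

lemma eig_shift_span:
  assumes "\<psi>' \<in> shift_span \<psi>" "v \<in> eigs \<psi>"
  shows "\<psi>' (x - v) = eig \<psi> v * \<psi>' x"
  by (rule shift_span_eigen[OF assms(1)]) (rule eigD[OF assms(2)])

lemma norm_eig:
  assumes "v \<in> eigs \<psi>" "eig \<psi> v ^ n = 1" "n > 0"
  shows "norm (eig \<psi> v) = 1"
proof (rule power_eq_imp_eq_base)
  show "norm (eig \<psi> v) ^ n = 1 ^ n" using assms(2) by (simp flip: norm_power)
qed (use assms in auto)

end

lemma shift_span_eig:
  fixes \<psi> \<psi>' :: "'a::ring_1 \<Rightarrow> complex"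
  assumes "\<psi>' \<in> shift_span \<psi>" "\<psi>' \<noteq> (\<lambda>_. 0)" "v \<in> eigs \<psi>"
  shows "v \<in> eigs \<psi>'" "eig \<psi>' v = eig \<psi> v"
proof -
  have "\<psi> \<noteq> (\<lambda>_. 0)"
  proof
    assume 0: "\<psi> = (\<lambda>_. 0)"
    have "\<psi>' x = 0" for x
      using shift_span_annihilated[OF assms(1), where S="{()}" and g="\<lambda>_. 0"] 0 by simp
    then show False using assms(2) by auto
  qed
  then have *: "\<psi>' (x - v) = eig \<psi> v * \<psi>' x" for x
    using assms(1,3) by (rule eig_shift_span[of \<psi> \<psi>' v x])
  show "v \<in> eigs \<psi>'" "eig \<psi>' v = eig \<psi> v" using eigI[OF assms(2) *] by auto
qed

section \<open>Vanishing sums of eigenvalues\<close>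

lemma sum_roots_unity_inverse_power:
  assumes "0 < j" "j < N"
  shows "(\<Sum>z | z ^ N = 1. inverse z ^ j :: complex) = 0"
proof -
  define w where "w = cis (2 * pi * real 1 / real N)"
  have N: "N > 0" using assms by simp
  have w: "w ^ N = 1" using N unfolding w_def by (simp add: Complex.DeMoivre)
  have "w ^ j \<noteq> 1"
  proof -
    have "w ^ j = cis (2 * pi * real j / real N)"
      unfolding w_def by (simp add: Complex.DeMoivre mult_ac)
    moreover have "cis (2 * pi * real j / real N) \<noteq> cis (2 * pi * real 0 / real N)"
      using inj_onD[OF bij_betw_imp_inj_on[OF Complex.bij_betw_roots_unity[OF N]], of j 0] assms by auto
    ultimately show ?thesis by simp
  qed
  have w0: "w \<noteq> 0" using w N by (metis power_0_left zero_neq_one less_irrefl)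
  have "bij_betw (\<lambda>z. w * z) {z. z ^ N = 1} {z. z ^ N = 1}"
    using w w0 by (intro bij_betwI[of _ _ _ "\<lambda>z. z / w"]) (auto simp: power_mult_distrib power_divide)
  then have "(\<Sum>z | z ^ N = 1. inverse z ^ j) = (\<Sum>z | z ^ N = 1. inverse (w * z) ^ j)"
    by (rule sum.reindex_bij_betw[symmetric])
  also have "\<dots> = inverse (w ^ j) * (\<Sum>z | z ^ N = 1. inverse z ^ j)"
    by (simp add: sum_distrib_left power_mult_distrib power_inverse)
  finally show ?thesis using \<open>w ^ j \<noteq> 1\<close>
    by (metis inverse_eq_1_iff mult_cancel_right2)
qed

text \<open>\<open>N\<close> times the spectral projection onto the eigenvalue \<open>z\<close> of
  the translation by \<open>v\<close>, for functions with period \<open>N v\<close> and an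
  \<open>N\<close>-th root of unity \<open>z\<close>.\<close>

definition root_proj :: "nat \<Rightarrow> 'a \<Rightarrow> complex \<Rightarrow> ('a::ring_1 \<Rightarrow> complex) \<Rightarrow> 'a \<Rightarrow> complex" where
  "root_proj N v z \<psi> x = (\<Sum>j<N. inverse z ^ j * \<psi> (x - of_nat j * v))"

lemma root_proj_in_span: "root_proj N v z \<psi> \<in> shift_span \<psi>"
proof -
  have "(\<lambda>x. \<Sum>j<N. inverse z ^ j * \<psi> (x - of_nat j * v)) \<in> shift_span \<psi>"
    by (intro shift_span_sum shift_span.scale shift_span.shift shift_span.base) auto
  then show ?thesis by (simp add: root_proj_def[abs_def])
qed

lemma root_proj_eigen:
  assumes "N > 0" "z ^ N = 1" "\<And>x. \<psi> (x - of_nat N * v) = \<psi> x"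
  shows "root_proj N v z \<psi> (x - v) = z * root_proj N v z \<psi> x"
proof -
  have z: "z \<noteq> 0" using assms(1,2) by (metis power_0_left zero_neq_one less_irrefl)
  define t where "t j = inverse z ^ j * \<psi> (x - of_nat j * v)" for j
  have "inverse z ^ N = 1" using assms(2) by (simp add: power_inverse)
  then have t: "t N = t 0" using assms(3) by (simp add: t_def)
  have "root_proj N v z \<psi> (x - v) = (\<Sum>j<N. z * t (Suc j))"
    unfolding root_proj_def t_def using z by (intro sum.cong) (auto simp: algebra_simps)
  also have "\<dots> = z * (\<Sum>j<N. t (Suc j))" by (simp add: sum_distrib_left)
  also have "(\<Sum>j<N. t (Suc j)) = (\<Sum>j<N. t j)"
    using sum.lessThan_Suc_shift[of t N] sum.lessThan_Suc[of t N] t by (metis add.commute add_left_cancel)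
  finally show ?thesis by (simp add: root_proj_def t_def)
qed

lemma sum_root_proj:
  assumes "N > 0"
  shows "(\<Sum>z | z ^ N = 1. root_proj N v z \<psi> x) = of_nat N * \<psi> x"
proof -
  have "(\<Sum>z | z ^ N = 1. root_proj N v z \<psi> x) =
      (\<Sum>j<N. (\<Sum>z | z ^ N = 1. inverse z ^ j) * \<psi> (x - of_nat j * v))"
    unfolding root_proj_def by (subst sum.swap) (simp add: sum_distrib_right)
  also have "\<dots> = (\<Sum>j<N. if j = 0 then of_nat N * \<psi> x else 0)"
    using sum_roots_unity_inverse_power card_roots_unity_eq[OF assms] by (intro sum.cong) auto
  finally show ?thesis using assms by simp
qed

text \<open>Multiplying by an eigenfunction with eigenvalue \<open>b\<close> multiplies the spectrum
  by \<open>b\<close>, so the component at \<open>z\<close> comes from the one at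
  \<open>z / b\<close>.\<close>

lemma root_proj_mult:
  assumes "\<And>x. h (x - v) = b * h x" "b \<noteq> 0"
  shows "root_proj N v z (\<lambda>x. \<psi> x * h x) x = root_proj N v (z / b) \<psi> x * h x"
proof -
  have "h (x - of_nat j * v) = b ^ j * h x" for j
  proof (induction j)
    case (Suc j)
    then show ?case using assms(1)[of "x - of_nat j * v"] by (simp add: algebra_simps)
  qed simp
  then show ?thesis using assms(2) unfolding root_proj_def sum_distrib_right
    by (intro sum.cong) (auto simp: power_divide field_simps)
qed

lemma root_proj_nonzero:
  assumes "\<psi> \<noteq> (\<lambda>_. 0)" "N > 0"
  obtains z where "z ^ N = 1" "root_proj N v z \<psi> \<noteq> (\<lambda>_. 0)"
proof -
  obtain y where "\<psi> y \<noteq> 0" using assms(1) by blast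
  then have "(\<Sum>z | z ^ N = 1. root_proj N v z \<psi> y) \<noteq> 0" using sum_root_proj[OF assms(2), of v \<psi> y] assms(2) by simp
  then obtain z where "z ^ N = 1" "root_proj N v z \<psi> y \<noteq> 0"
    by (metis (mono_tags, lifting) mem_Collect_eq sum.neutral)
  then show ?thesis using that by metis
qed

lemma eigenvector_of_periodic:
  fixes \<psi> :: "'a::ring_1 \<Rightarrow> complex"
  assumes "\<psi> \<noteq> (\<lambda>_. 0)" "N > 0" "\<And>x. \<psi> (x - of_nat N * v) = \<psi> x"
  obtains z \<psi>' where "\<psi>' \<in> shift_span \<psi>" "\<psi>' \<noteq> (\<lambda>_. 0)" "z ^ N = 1" "\<And>x. \<psi>' (x - v) = z * \<psi>' x"
proof -
  obtain z where z: "z ^ N = 1" "root_proj N v z \<psi> \<noteq> (\<lambda>_. 0)"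
    by (rule root_proj_nonzero[OF assms(1,2)])
  show ?thesis
    by (rule that[OF root_proj_in_span z(2,1)]) (rule root_proj_eigen[where N = N], use assms z in auto)
qed

section \<open>Vandermonde elimination and terminal vectors\<close>

definition related :: "nat \<Rightarrow> ('a::ab_group_add \<Rightarrow> complex) \<Rightarrow> 'a \<Rightarrow> 'a \<Rightarrow> bool" where
  "related N \<psi> f g \<longleftrightarrow> f - g \<in> eigs \<psi> \<and> eig \<psi> (f - g) ^ N = 1"

lemma related_refl: "\<psi> \<noteq> (\<lambda>_. 0) \<Longrightarrow> related N \<psi> f (f :: 'a::ring_1)"
  by (simp add: related_def)

lemma related_sym: "\<psi> \<noteq> (\<lambda>_. 0) \<Longrightarrow> related N \<psi> f g \<Longrightarrow> related N \<psi> g (f :: 'a::ring_1)"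
  using eig_minus[of \<psi> "f - g"] by (simp add: related_def power_inverse)

lemma related_trans:
  "\<psi> \<noteq> (\<lambda>_. 0) \<Longrightarrow> related N \<psi> f g \<Longrightarrow> related N \<psi> g h \<Longrightarrow> related N \<psi> f (h :: 'a::ring_1)"
  using eig_add[of \<psi> "f - g" "g - h"] by (simp add: related_def power_mult_distrib)

text \<open>The product over \<open>g\<close> in \<open>R\<close> of the operators
  \<open>T^(N f) - T^(N g)\<close>. It depends on \<open>f\<close> because it acts on the
  \<open>f\<close>-th term of a sum over \<open>F\<close>. Multiples of \<open>N\<close> appear
  because changing a dilation factor by \<open>N\<close> keeps it coprime to
  \<open>N\<close>.\<close>

primrec eliminant :: "nat \<Rightarrow> 'a \<Rightarrow> 'a list \<Rightarrow> ('a \<Rightarrow> complex) \<Rightarrow> 'a::ring_1 \<Rightarrow> complex" where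
  "eliminant N f [] \<psi> = \<psi>"
| "eliminant N f (g # R) \<psi> =
    (\<lambda>x. eliminant N f R \<psi> (x - of_nat N * f) - eliminant N f R \<psi> (x - of_nat N * g))"

lemma eliminant_in_span: "eliminant N f R \<psi> \<in> shift_span \<psi>"
  by (induction R) (auto intro: shift_span.base shift_span.shift shift_span_diff)

text \<open>Shifting the \<open>f\<close>-th term by \<open>N f\<close> replaces \<open>k\<close> by
  \<open>k + 1\<close>, and shifting all terms by the same \<open>N g\<close> only moves
  \<open>x\<close>. So both halves of an elimination step are instances of the given
  relations.\<close>

lemma sum_eliminant:
  assumes "\<And>k x. (\<Sum>f\<in>F. \<psi> (x - of_nat (r + N * k) * f)) = 0"
  shows "(\<Sum>f\<in>F. eliminant N f R \<psi> (x - of_nat (r + N * k) * f)) = 0"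
proof (induction R arbitrary: k x)
  case (Cons g R)
  have "(\<Sum>f\<in>F. eliminant N f R \<psi> (x - of_nat (r + N * k) * f - of_nat N * f)) = 0"
    using Cons.IH[of x "Suc k"] by (simp add: algebra_simps)
  moreover have "(\<Sum>f\<in>F. eliminant N f R \<psi> (x - of_nat (r + N * k) * f - of_nat N * g)) = 0"
    using Cons.IH[of "x - of_nat N * g" k] by (simp add: algebra_simps)
  ultimately show ?case by (simp add: sum_subtractf)
qed (use assms in auto)

lemma eliminant_eq_0: "f \<in> set R \<Longrightarrow> eliminant N f R \<psi> = (\<lambda>_. 0)"
  by (induction R) auto

lemma eliminant_cong:
  fixes \<psi> :: "'a::ring_1 \<Rightarrow> complex"
  assumes "\<And>x. \<psi> (x - of_nat N * (f - g)) = \<psi> x"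
  shows "eliminant N f R \<psi> = eliminant N g R \<psi>"
proof (induction R)
  case (Cons h R)
  let ?E = "eliminant N g R \<psi>"
  have "?E (x - of_nat N * (f - g)) = 1 * ?E x" for x
    by (rule shift_span_eigen[OF eliminant_in_span]) (use assms in auto)
  from this[of "x - of_nat N * g" for x]
  have "?E (x - of_nat N * f) = ?E (x - of_nat N * g)" for x by (simp add: algebra_simps)
  then show ?case using Cons.IH by simp
qed auto

lemma eliminant_nonzero:
  fixes \<psi> :: "'a::ring_1 \<Rightarrow> complex"
  assumes "\<psi> \<noteq> (\<lambda>_. 0)"
    and "\<And>h \<psi>'. h \<in> set R \<Longrightarrow> \<psi>' \<in> shift_span \<psi> \<Longrightarrow> \<psi>' \<noteq> (\<lambda>_. 0) \<Longrightarrow>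
      \<exists>x. \<psi>' (x - of_nat N * (f - h)) \<noteq> \<psi>' x"
  shows "eliminant N f R \<psi> \<noteq> (\<lambda>_. 0)"
  using assms(2)
proof (induction R)
  case (Cons h R)
  let ?E = "eliminant N f R \<psi>"
  have E: "?E \<noteq> (\<lambda>_. 0)" using Cons by simp
  then obtain x where x: "?E (x - of_nat N * (f - h)) \<noteq> ?E x"
    using Cons.prems[OF list.set_intros(1) eliminant_in_span E] by blast
  have "eliminant N f (h # R) \<psi> (x + of_nat N * h) \<noteq> 0"
    using x by (simp add: algebra_simps)
  then show ?case by metis
qed (use assms in auto)

text \<open>A nonzero vector with as many annihilators \<open>T\<^sup>f - z T\<^sup>g\<close> as possible: the remaining
  differences \<open>T\<^bsup>Nf\<^esup> - T\<^bsup>Ng\<^esup>\<close> are then injective on its span, so that Vandermonde elimination splits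
  the vanishing sum over \<open>F\<close> into vanishing sums over the classes.\<close>

lemma terminal_vector:
  fixes \<phi> :: "'a::ring_1 \<Rightarrow> complex"
  assumes fin: "finite F" and N: "N > 0" and nz: "\<phi> \<noteq> (\<lambda>_. 0)"
    and H: "\<And>r x. r > 0 \<Longrightarrow> coprime r N \<Longrightarrow> (\<Sum>f\<in>F. \<phi> (x - of_nat r * f)) = 0"
  obtains \<psi> where "\<psi> \<in> shift_span \<phi>" "\<psi> \<noteq> (\<lambda>_. 0)"
    "\<And>g r. g \<in> F \<Longrightarrow> r > 0 \<Longrightarrow> coprime r N \<Longrightarrow>
      (\<Sum>f | f \<in> F \<and> related N \<psi> f g. eig \<psi> (f - g) ^ r) = 0"
proof -
  define Z where "Z \<psi> = {(f, g, z). f \<in> F \<and> g \<in> F \<and> z ^ N = 1 \<and> (\<forall>x. \<psi> (x - (f - g)) = z * \<psi> x)}"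
    for \<psi> :: "'a \<Rightarrow> complex"
  let ?all = "F \<times> F \<times> {z::complex. z ^ N = 1}"
  have all: "finite ?all" 
    using finite_roots_unity[of N] N by (intro finite_cartesian_product fin) auto
  have Zall: "Z \<psi> \<subseteq> ?all" for \<psi> unfolding Z_def by auto
  have "\<exists>\<psi>. (\<psi> \<in> shift_span \<phi> \<and> \<psi> \<noteq> (\<lambda>_. 0)) \<and>
    (\<forall>\<psi>'. \<psi>' \<in> shift_span \<phi> \<and> \<psi>' \<noteq> (\<lambda>_. 0) \<longrightarrow> card (Z \<psi>') \<le> card (Z \<psi>))"
  proof (rule ex_has_greatest_nat)
    show "\<phi> \<in> shift_span \<phi> \<and> \<phi> \<noteq> (\<lambda>_. 0)" using shift_span.base nz by blast
    show "\<forall>\<psi>. \<psi> \<in> shift_span \<phi> \<and> \<psi> \<noteq> (\<lambda>_. 0) \<longrightarrow> card (Z \<psi>) < Suc (card ?all)"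
      using Zall card_mono[OF all] by (simp add: less_Suc_eq_le)
  qed
  then obtain \<psi> where \<psi>: "\<psi> \<in> shift_span \<phi>" "\<psi> \<noteq> (\<lambda>_. 0)"
    and max: "\<And>\<psi>'. \<psi>' \<in> shift_span \<phi> \<Longrightarrow> \<psi>' \<noteq> (\<lambda>_. 0) \<Longrightarrow> card (Z \<psi>') \<le> card (Z \<psi>)"
    by blast
  \<comment> \<open>Annihilators persist in the span, so by maximality none can be gained
    there.\<close>
  have Zeq: "Z \<psi>' = Z \<psi>" if "\<psi>' \<in> shift_span \<psi>" "\<psi>' \<noteq> (\<lambda>_. 0)" for \<psi>'
  proof -
    have "Z \<psi> \<subseteq> Z \<psi>'" unfolding Z_def using shift_span_eigen[OF that(1)] by blast
    moreover have "card (Z \<psi>') \<le> card (Z \<psi>)" using max that shift_span_trans[OF that(1) \<psi>(1)] by blast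
    moreover have "finite (Z \<psi>')" using Zall all finite_subset by blast
    ultimately show ?thesis using card_seteq by metis
  qed
  \<comment> \<open>If \<open>N (f - g)\<close> is a period of one nonzero element of the span, a
    projection makes \<open>f - g\<close> act by a root of unity; as \<open>Z\<close> cannot grow,
    it already did so on \<open>\<psi>\<close>. Hence the differences for unrelated pairs are
    injective on the span.\<close>
  have rel: "related N \<psi> f g"
    if fg: "f \<in> F" "g \<in> F" and \<psi>': "\<psi>' \<in> shift_span \<psi>" "\<psi>' \<noteq> (\<lambda>_. 0)"
      and per: "\<And>x. \<psi>' (x - of_nat N * (f - g)) = \<psi>' x" for f g \<psi>'
  proof -
    obtain z \<psi>'' where *: "\<psi>'' \<in> shift_span \<psi>'" "\<psi>'' \<noteq> (\<lambda>_. 0)" "z ^ N = 1"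
      "\<And>x. \<psi>'' (x - (f - g)) = z * \<psi>'' x"
      using eigenvector_of_periodic[OF \<psi>'(2) N per] by blast
    then have "(f, g, z) \<in> Z \<psi>''" using fg by (auto simp: Z_def)
    then have "(f, g, z) \<in> Z \<psi>" using Zeq *(1,2) shift_span_trans \<psi>'(1) by blast
    then have "\<And>x. \<psi> (x - (f - g)) = z * \<psi> x" by (auto simp: Z_def)
    from eigI[OF \<psi>(2) this] show ?thesis using *(3) by (simp add: related_def)
  qed
  have "(\<Sum>f | f \<in> F \<and> related N \<psi> f g. eig \<psi> (f - g) ^ r) = 0"
    if g: "g \<in> F" and r: "r > 0" "coprime r N" for g r
  proof -
    let ?K = "{f. f \<in> F \<and> related N \<psi> f g}"
    \<comment> \<open>Eliminating everything outside the class of \<open>g\<close> leaves the class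
      sum of eigenvalues times the nonzero function \<open>?E\<close>.\<close>
    obtain R where R: "set R = F - ?K" using fin finite_list[of "F - ?K"] by auto
    let ?E = "eliminant N g R \<psi>"
    have E: "?E \<in> shift_span \<psi>" by (rule eliminant_in_span)
    have E0: "?E \<noteq> (\<lambda>_. 0)"
    proof (rule eliminant_nonzero[OF \<psi>(2)])
      fix h \<psi>' assume h: "h \<in> set R" and \<psi>': "\<psi>' \<in> shift_span \<psi>" "\<psi>' \<noteq> (\<lambda>_. 0)"
      show "\<exists>x. \<psi>' (x - of_nat N * (g - h)) \<noteq> \<psi>' x"
      proof (rule ccontr)
        assume "\<not> ?thesis"
        then have "related N \<psi> g h" using rel[OF g _ \<psi>'] h R by auto
        then show False using related_sym[OF \<psi>(2)] h R by auto
      qed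
    qed
    have K: "eliminant N f R \<psi> (x - of_nat r * f) = eig \<psi> (f - g) ^ r * ?E (x - of_nat r * g)"
      if "f \<in> ?K" for f x
    proof -
      have f: "f - g \<in> eigs \<psi>" "eig \<psi> (f - g) ^ N = 1" using that by (auto simp: related_def)
      have "\<psi> (x - of_nat N * (f - g)) = \<psi> x" for x
        using eigD[OF \<psi>(2) eig_of_nat_mult(1)[OF \<psi>(2) f(1)]] eig_of_nat_mult(2)[OF \<psi>(2) f(1)] f(2)
        by simp
      then have "eliminant N f R \<psi> = ?E" by (rule eliminant_cong)
      moreover have "?E ((x - of_nat r * g) - of_nat r * (f - g)) = eig \<psi> (f - g) ^ r * ?E (x - of_nat r * g)"
        using eig_shift_span[OF \<psi>(2) E eig_of_nat_mult(1)[OF \<psi>(2) f(1)]]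
          eig_of_nat_mult(2)[OF \<psi>(2) f(1)] by simp
      ultimately show ?thesis by (simp add: algebra_simps)
    qed
    have H': "(\<Sum>f\<in>F. \<psi> (x - of_nat (r + N * k) * f)) = 0" for k x
    proof (rule shift_span_annihilated[OF \<psi>(1)])
      fix x
      have "coprime (r + N * k) N" using r(2)
        by (metis coprime_commute coprime_iff_gcd_eq_1 gcd_add_mult mult.commute add.commute)
      then show "(\<Sum>f\<in>F. \<phi> (x - of_nat (r + N * k) * f)) = 0" using H[of "r + N * k" x] r by blast
    qed
    have "(\<Sum>f\<in>?K. eig \<psi> (f - g) ^ r) * ?E (x - of_nat r * g) = 0" for x
    proof -
      have "0 = (\<Sum>f\<in>F. eliminant N f R \<psi> (x - of_nat r * f))"
        using sum_eliminant[where k=0 and F=F and r=r and N=N and \<psi>=\<psi> and R=R and x=x, OF H'] by simp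
      also have "\<dots> = (\<Sum>f\<in>?K. eliminant N f R \<psi> (x - of_nat r * f))"
        using R fin by (intro sum.mono_neutral_right) (auto simp: eliminant_eq_0)
      also have "\<dots> = (\<Sum>f\<in>?K. eig \<psi> (f - g) ^ r * ?E (x - of_nat r * g))"
        using K by (intro sum.cong) auto
      finally show ?thesis by (simp add: sum_distrib_right)
    qed
    moreover obtain y where "?E y \<noteq> 0" using E0 by blast
    ultimately show ?thesis
      by (metis (no_types, lifting) add_diff_cancel_right' mult_eq_0_iff)
  qed
  then show ?thesis using that \<psi> by blast
qed

section \<open>Subgroups of the lattice\<close>

definition add_subgroup :: "'a::ab_group_add set \<Rightarrow> bool" where
  "add_subgroup G \<longleftrightarrow> 0 \<in> G \<and> (\<forall>x\<in>G. \<forall>y\<in>G. x - y \<in> G)"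

lemma add_subgroupD:
  assumes "add_subgroup G"
  shows "0 \<in> G" "x \<in> G \<Longrightarrow> y \<in> G \<Longrightarrow> x - y \<in> G" "x \<in> G \<Longrightarrow> - x \<in> G"
    "x \<in> G \<Longrightarrow> y \<in> G \<Longrightarrow> x + y \<in> G"
proof -
  show 0: "0 \<in> G" and d: "x \<in> G \<Longrightarrow> y \<in> G \<Longrightarrow> x - y \<in> G" for x y
    using assms by (auto simp: add_subgroup_def)
  show m: "- x \<in> G" if "x \<in> G" for x using d[OF 0 that] by simp
  show "x + y \<in> G" if "x \<in> G" "y \<in> G" using d[OF that(1) m[OF that(2)]] by simp
qed

lemma add_subgroup_of_nat_mult:
  assumes "add_subgroup G" "x \<in> G"
  shows "of_nat n * x \<in> (G :: 'a::ring_1 set)"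
  by (induction n) (auto simp: algebra_simps intro: add_subgroupD[OF assms(1)] assms(2))

lemma add_subgroup_of_int_mult:
  assumes "add_subgroup G" "x \<in> G"
  shows "of_int n * x \<in> (G :: 'a::ring_1 set)"
  using add_subgroup_of_nat_mult[OF assms] add_subgroupD(3)[OF assms(1)]
  by (cases n rule: int_cases2) auto

lemma add_subgroup_sum:
  assumes "add_subgroup G" "\<And>i. i \<in> I \<Longrightarrow> u i \<in> G"
  shows "sum u I \<in> G"
  using assms(2) by (induction I rule: infinite_finite_induct) (auto intro: add_subgroupD[OF assms(1)])

inductive_set grp :: "'a::ab_group_add set \<Rightarrow> 'a set" for S where
  zero: "0 \<in> grp S"
| add: "x \<in> grp S \<Longrightarrow> s \<in> S \<Longrightarrow> x + s \<in> grp S"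
| diff: "x \<in> grp S \<Longrightarrow> s \<in> S \<Longrightarrow> x - s \<in> grp S"

lemma grp_base: "s \<in> S \<Longrightarrow> s \<in> grp S"
  using grp.add[OF grp.zero] by fastforce

lemma grp_least:
  assumes "add_subgroup G" "S \<subseteq> G"
  shows "grp S \<subseteq> G"
proof
  fix x assume "x \<in> grp S"
  then show "x \<in> G"
    by induction (use assms(2) add_subgroupD[OF assms(1)] in auto)
qed

lemma add_subgroup_grp: "add_subgroup (grp S)"
proof -
  have "x - y \<in> grp S" if "y \<in> grp S" "x \<in> grp S" for x y
    using that
  proof induction
    case (add y s)
    then show ?case using grp.diff[of "x - y" S s] by (simp add: algebra_simps)
  next
    case (diff y s)
    then show ?case using grp.add[of "x - y" S s] by (simp add: algebra_simps)
  qed auto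
  then show ?thesis by (auto simp: add_subgroup_def grp.zero)
qed

lemma of_int_index: "(of_int n :: 'a::ring_1 ^ 'n) $ i = of_int n"
  by (cases n rule: int_cases2) (auto simp: of_nat_index)

text \<open>A coordinate subspace \<open>{x. \<forall>i. i \<notin> J \<longrightarrow> x $ i = 0}\<close> with \<open>J\<close> maximal among those that
  meet \<open>G\<close> trivially is a complement of \<open>G\<close> up to finite index, and \<open>\<gamma>\<close> is essentially the
  projection onto \<open>G\<close>.\<close>

lemma subgroup_retract:
  fixes G :: "(int ^ 'd::finite) set"
  assumes G: "add_subgroup G"
  obtains \<gamma> M where "M > (0::nat)" "\<And>z. \<gamma> z \<in> G" "\<And>z g. g \<in> G \<Longrightarrow> \<gamma> (z + g) = \<gamma> z + g"
    "\<And>w. \<exists>g\<in>G. \<forall>z n. \<gamma> (z + of_nat (M * n) * w) = \<gamma> z + of_nat n * g"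
proof -
  define C where "C J = {x :: int ^ 'd. \<forall>i. i \<notin> J \<longrightarrow> x $ i = 0}" for J
  have "\<exists>J. G \<inter> C J \<subseteq> {0} \<and> (\<forall>J'. G \<inter> C J' \<subseteq> {0} \<longrightarrow> card J' \<le> card J)"
  proof (rule ex_has_greatest_nat)
    show "G \<inter> C {} \<subseteq> {0}" by (auto simp: C_def vec_eq_iff)
    show "\<forall>J. G \<inter> C J \<subseteq> {0} \<longrightarrow> card J < Suc (card (UNIV :: 'd set))"
      by (simp add: card_mono less_Suc_eq_le)
  qed
  then obtain J where J: "G \<inter> C J \<subseteq> {0}" and Jmax: "\<And>J'. G \<inter> C J' \<subseteq> {0} \<Longrightarrow> card J' \<le> card J"
    by blast
  have "\<exists>x\<in>G. x \<in> C (insert i J) \<and> x $ i \<noteq> 0" if "i \<notin> J" for i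
  proof -
    have "\<not> G \<inter> C (insert i J) \<subseteq> {0}" using Jmax[of "insert i J"] that by auto
    then obtain x where x: "x \<in> G" "x \<in> C (insert i J)" "x \<noteq> 0" by auto
    then have "x $ i \<noteq> 0" using J by (auto simp: C_def)
    then show ?thesis using x by blast
  qed
  then obtain b where b: "\<And>i. i \<notin> J \<Longrightarrow> b i \<in> G \<and> b i \<in> C (insert i J) \<and> b i $ i \<noteq> 0" by metis
  \<comment> \<open>A common multiple of the pivots, so that the coordinates of \<open>M w\<close>
    off \<open>J\<close> can be cleared by an element of \<open>G\<close>.\<close>
  define M where "M = (\<Prod>i\<in>-J. nat \<bar>b i $ i\<bar>)"
  have M: "M > 0" unfolding M_def using b by (intro prod_pos) auto
  have dvdM: "b i $ i dvd int M" if "i \<notin> J" for i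
  proof -
    have "nat \<bar>b i $ i\<bar> dvd M" unfolding M_def using that by (intro dvd_prodI) auto
    then show ?thesis by (metis abs_dvd_iff dvd_trans int_dvd_int_iff int_nat_eq abs_ge_zero)
  qed
  \<comment> \<open>\<open>D\<close> is the direct sum of \<open>G\<close> and \<open>C J\<close>,
    and \<open>cmp\<close> is its projection onto \<open>G\<close>.\<close>
  define D where "D = {x. \<exists>g\<in>G. x - g \<in> C J}"
  define cmp where "cmp x = (THE g. g \<in> G \<and> x - g \<in> C J)" for x
  have CJ: "add_subgroup (C J)" by (auto simp: add_subgroup_def C_def)
  have uniq: "g = g'" if "g \<in> G" "x - g \<in> C J" "g' \<in> G" "x - g' \<in> C J" for x g g'
  proof -
    have "(x - g') - (x - g) \<in> C J" using that add_subgroupD(2)[OF CJ] by blast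
    moreover have "(x - g') - (x - g) = g - g'" by simp
    ultimately have "g - g' \<in> G \<inter> C J" using that add_subgroupD(2)[OF G] by auto
    then show ?thesis using J by auto
  qed
  have cmpI: "cmp x = g" if "g \<in> G" "x - g \<in> C J" for x g
    unfolding cmp_def using that uniq by (intro the_equality) blast+
  have cmpD: "cmp x \<in> G" "x - cmp x \<in> C J" if "x \<in> D" for x
  proof -
    obtain g where "g \<in> G" "x - g \<in> C J" using \<open>x \<in> D\<close> by (auto simp: D_def)
    then show "cmp x \<in> G" "x - cmp x \<in> C J" using cmpI by auto
  qed
  have cmp_add: "x + y \<in> D \<and> cmp (x + y) = cmp x + cmp y" if "x \<in> D" "y \<in> D" for x y
  proof -
    have "(x - cmp x) + (y - cmp y) \<in> C J"
      using cmpD that add_subgroupD(4)[OF CJ] by blast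
    then have *: "(x + y) - (cmp x + cmp y) \<in> C J" by (simp add: algebra_simps)
    moreover have "cmp x + cmp y \<in> G" using cmpD that add_subgroupD(4)[OF G] by blast
    ultimately show ?thesis using cmpI unfolding D_def by blast
  qed
  have GD: "g \<in> D" "cmp g = g" if "g \<in> G" for g
  proof -
    have "g - g \<in> C J" using add_subgroupD(1)[OF CJ] by simp
    then show "g \<in> D" "cmp g = g" using that cmpI unfolding D_def by blast+
  qed
  have D: "add_subgroup D"
  proof -
    have "x - y \<in> D" if "x \<in> D" "y \<in> D" for x y
    proof -
      have "(x - cmp x) - (y - cmp y) \<in> C J"
        using cmpD that add_subgroupD(2)[OF CJ] by blast
      then have *: "(x - y) - (cmp x - cmp y) \<in> C J" by (simp add: algebra_simps)
      moreover have "cmp x - cmp y \<in> G" using cmpD that add_subgroupD(2)[OF G] by blast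
      ultimately show ?thesis unfolding D_def by blast
    qed
    then show ?thesis using GD add_subgroupD(1)[OF G] by (auto simp: add_subgroup_def)
  qed
  have MD: "of_nat M * w \<in> D" for w
  proof -
    define g where "g = (\<Sum>i\<in>-J. of_int (int M * w $ i div b i $ i) * b i)"
    have "g \<in> G" unfolding g_def using b by (intro add_subgroup_sum[OF G] add_subgroup_of_int_mult[OF G]) auto
    moreover have "g $ j = int M * w $ j" if "j \<notin> J" for j
    proof -
      have "g $ j = (\<Sum>i\<in>-J. (int M * w $ i div b i $ i) * b i $ j)"
        by (simp add: g_def of_int_index)
      also have "\<dots> = (\<Sum>i\<in>-J. if i = j then (int M * w $ i div b i $ i) * b i $ j else 0)"
        using b that by (intro sum.cong) (auto simp: C_def)
      also have "\<dots> = (int M * w $ j div b j $ j) * b j $ j" using that by simp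
      finally show ?thesis using dvdM[OF that] by simp
    qed
    ultimately show ?thesis unfolding D_def C_def by (intro CollectI bexI[of _ g]) (auto simp: of_nat_index)
  qed
  \<comment> \<open>The chosen representative depends only on the coset of \<open>D\<close>, so
    subtracting it extends the projection from \<open>D\<close> to the whole lattice.\<close>
  define \<rho> where "\<rho> z = (SOME y. z - y \<in> D)" for z
  have \<rho>: "z - \<rho> z \<in> D" for z
    unfolding \<rho>_def by (rule someI[of _ z]) (use add_subgroupD(1)[OF D] in simp)
  have \<rho>_add: "\<rho> (z + d) = \<rho> z" if "d \<in> D" for z d
  proof -
    have "z + d - y \<in> D \<longleftrightarrow> z - y \<in> D" for y
      using add_subgroupD(4)[OF D, of "z - y" d] add_subgroupD(2)[OF D, of "z + d - y" d] that
      by (auto simp: algebra_simps)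
    then show ?thesis by (simp add: \<rho>_def)
  qed
  define \<gamma> where "\<gamma> z = cmp (z - \<rho> z)" for z
  have \<gamma>_add: "\<gamma> (z + d) = \<gamma> z + cmp d" if "d \<in> D" for z d
  proof -
    have "\<gamma> (z + d) = cmp ((z - \<rho> z) + d)" unfolding \<gamma>_def \<rho>_add[OF that] by (simp add: algebra_simps)
    then show ?thesis using cmp_add[OF \<rho> that] by (simp add: \<gamma>_def)
  qed
  show ?thesis
  proof (rule that[OF M])
    show "\<gamma> z \<in> G" for z unfolding \<gamma>_def using cmpD(1)[OF \<rho>] .
    show "\<gamma> (z + g) = \<gamma> z + g" if "g \<in> G" for z g using \<gamma>_add GD[OF that] by simp
    show "\<exists>g\<in>G. \<forall>z n. \<gamma> (z + of_nat (M * n) * w) = \<gamma> z + of_nat n * g" for w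
    proof (intro bexI allI)
      show "cmp (of_nat M * w) \<in> G" using cmpD(1)[OF MD] .
      show "\<gamma> (z + of_nat (M * n) * w) = \<gamma> z + of_nat n * cmp (of_nat M * w)" for z n
      proof (induction n)
        case (Suc n)
        have "\<gamma> (z + of_nat (M * Suc n) * w) = \<gamma> ((z + of_nat (M * n) * w) + of_nat M * w)"
          by (simp add: algebra_simps)
        also have "\<dots> = \<gamma> (z + of_nat (M * n) * w) + cmp (of_nat M * w)" by (rule \<gamma>_add[OF MD])
        finally show ?case unfolding Suc by (simp add: distrib_right add_ac)
      qed simp
    qed
  qed
qed

section \<open>Periodic complements from a subgroup and from blocks\<close>

definition periodic_tile :: "(int ^ 'd::finite) set \<Rightarrow> bool" where
  "periodic_tile F \<longleftrightarrow> (\<exists>M B. M > (0::nat) \<and> (\<forall>x. \<exists>!f. f \<in> F \<and> x - f \<in> B) \<and>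
    (\<forall>x w. x \<in> B \<longrightarrow> x + of_nat M * w \<in> B))"

text \<open>Pull the complement back along the retraction \<open>\<gamma>\<close> onto
  \<open>L\<close>: it commutes with translations by elements of \<open>F\<close>, and a shift by
  \<open>M N w\<close> moves its value by \<open>N\<close> times an element of
  \<open>L\<close>.\<close>

lemma periodic_tile_of_subgroup:
  fixes F :: "(int ^ 'd::finite) set"
  assumes L: "add_subgroup L" and F: "F \<subseteq> L" and N: "N > 0"
    and tile: "\<And>x. x \<in> L \<Longrightarrow> \<exists>!f. f \<in> F \<and> x - f \<in> A"
    and per: "\<And>x g. x \<in> L \<Longrightarrow> g \<in> L \<Longrightarrow> x \<in> A \<Longrightarrow> x + of_nat N * g \<in> A"
  shows "periodic_tile F"
proof -
  obtain \<gamma> M where M: "M > (0::nat)" and \<gamma>: "\<And>z. \<gamma> z \<in> L" "\<And>z g. g \<in> L \<Longrightarrow> \<gamma> (z + g) = \<gamma> z + g"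
    and \<gamma>M: "\<And>w. \<exists>g\<in>L. \<forall>z n. \<gamma> (z + of_nat (M * n) * w) = \<gamma> z + of_nat n * g"
    by (rule subgroup_retract[OF L]) blast
  have \<gamma>_diff: "\<gamma> (z - f) = \<gamma> z - f" if "f \<in> F" for z f
    using \<gamma>(2)[of "- f" z] that F add_subgroupD(3)[OF L] by auto
  show ?thesis unfolding periodic_tile_def
  proof (intro exI[of _ "M * N"] exI[of _ "{z. \<gamma> z \<in> A}"] conjI allI impI)
    show "M * N > 0" using M N by simp
    show "\<exists>!f. f \<in> F \<and> x - f \<in> {z. \<gamma> z \<in> A}" for x
      using tile[OF \<gamma>(1)[of x]] by (auto simp: \<gamma>_diff cong: conj_cong)
    show "x + of_nat (M * N) * w \<in> {z. \<gamma> z \<in> A}" if "x \<in> {z. \<gamma> z \<in> A}" for x w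
      using \<gamma>M[of w] per[OF \<gamma>(1)[of x]] that by auto
  qed
qed

text \<open>Relative to any base point in \<open>T\<close> the eigenvalues are exactly the
  \<open>p\<close>-th roots of unity, each taken once (\<open>block_bij\<close>). Differences avoid
  singling out a base point.\<close>

definition block :: "nat \<Rightarrow> ('a::ab_group_add \<Rightarrow> complex) \<Rightarrow> 'a set \<Rightarrow> bool" where
  "block p \<psi> T \<longleftrightarrow> card T = p \<and> (\<forall>f\<in>T. \<forall>g\<in>T. f - g \<in> eigs \<psi> \<and> eig \<psi> (f - g) ^ p = 1 \<and>
    (f \<noteq> g \<longrightarrow> eig \<psi> (f - g) \<noteq> 1))"

lemma blockD:
  assumes "block p \<psi> T" "f \<in> T" "g \<in> T"
  shows "f - g \<in> eigs \<psi>" "eig \<psi> (f - g) ^ p = 1" "f \<noteq> g \<Longrightarrow> eig \<psi> (f - g) \<noteq> 1"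
  using assms by (auto simp: block_def)

lemma block_bij:
  fixes \<psi> :: "'a::ring_1 \<Rightarrow> complex"
  assumes "\<psi> \<noteq> (\<lambda>_. 0)" "block p \<psi> T" "t \<in> T" "p > 0"
  shows "bij_betw (\<lambda>f. eig \<psi> (f - t)) T {z. z ^ p = 1}"
proof -
  have inj: "inj_on (\<lambda>f. eig \<psi> (f - t)) T"
  proof (rule inj_onI, rule ccontr)
    fix f g assume *: "f \<in> T" "g \<in> T" "eig \<psi> (f - t) = eig \<psi> (g - t)" "f \<noteq> g"
    have "eig \<psi> (f - g) = eig \<psi> (f - t) / eig \<psi> (g - t)"
      using eig_diff(2)[OF assms(1) blockD(1)[OF assms(2) *(1) assms(3)] blockD(1)[OF assms(2) *(2) assms(3)]]
      by simp
    also have "\<dots> = 1" using * eig_nonzero[OF assms(1) blockD(1)[OF assms(2) *(2) assms(3)]] by simp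
    finally show False using blockD(3)[OF assms(2) *(1,2,4)] by simp
  qed
  have sub: "(\<lambda>f. eig \<psi> (f - t)) ` T \<subseteq> {z. z ^ p = 1}" using blockD(2)[OF assms(2) _ assms(3)] by auto
  have "(\<lambda>f. eig \<psi> (f - t)) ` T = {z. z ^ p = 1}"
  proof (rule card_seteq[OF _ sub])
    show "finite {z :: complex. z ^ p = 1}" using finite_roots_unity[of p] assms(4) by simp
    show "card {z :: complex. z ^ p = 1} \<le> card ((\<lambda>f. eig \<psi> (f - t)) ` T)"
      using card_image[OF inj] assms(2) card_roots_unity_eq[OF assms(4)] by (simp add: block_def)
  qed
  then show ?thesis using inj by (simp add: bij_betw_def)
qed

text \<open>The character selects one fibre for a point, and the eigenvalue then selects one element
  of this block. The character lives on \<open>L\<close>, but the eigenvalue is available only on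
  the group \<open>G\<close> of differences inside fibres, so each is extended to the lattice by its
  own retraction.\<close>

lemma periodic_tile_of_blocks:
  fixes F :: "(int ^ 'd::finite) set" and e :: "int ^ 'd \<Rightarrow> complex"
  assumes fin: "finite F" and L: "add_subgroup L" and F: "F \<subseteq> L" and \<psi>: "\<psi> \<noteq> (\<lambda>_. 0)"
    and e: "\<And>x y. x \<in> L \<Longrightarrow> y \<in> L \<Longrightarrow> e (x + y) = e x * e y"
    and ek: "\<And>x. x \<in> L \<Longrightarrow> e x ^ k = 1" "k > 0"
    and sur: "\<And>x. x \<in> L \<Longrightarrow> \<exists>f\<in>F. e x = e f"
    and bl: "\<And>f. f \<in> F \<Longrightarrow> block p \<psi> {g \<in> F. e g = e f}"
  shows "periodic_tile F"
proof -
  have e0: "e x \<noteq> 0" if "x \<in> L" for x using ek that by (metis power_0_left zero_neq_one less_irrefl)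
  have e_zero: "e 0 = 1" using e[of 0 0] e0[of 0] add_subgroupD(1)[OF L] by simp
  have e_diff: "e (x - y) = e x / e y" if "x \<in> L" "y \<in> L" for x y
    using e[of "x - y" y] that e0[OF that(2)] add_subgroupD(2)[OF L] by (simp add: field_simps)
  have e_mult: "e (of_nat n * x) = e x ^ n" if "x \<in> L" for n x
  proof (induction n)
    case (Suc n)
    then show ?case
      using e[OF that add_subgroup_of_nat_mult[OF L that], of n] by (simp add: distrib_right)
  qed (simp add: e_zero)
  obtain f0 where f0: "f0 \<in> F" using sur[OF add_subgroupD(1)[OF L]] by blast
  have p: "p > 0" using bl[OF f0] f0 fin by (auto simp: block_def card_gt_0_iff)
  define G where "G = grp {f - g | f g. f \<in> F \<and> g \<in> F \<and> e f = e g}"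
  have "add_subgroup {v \<in> L \<inter> eigs \<psi>. e v = 1 \<and> eig \<psi> v ^ p = 1}"
    using add_subgroupD[OF L] eig_0[OF \<psi>] eig_diff[OF \<psi>] e_diff e_zero
    by (auto simp: add_subgroup_def power_divide)
  then have Gsub: "G \<subseteq> {v \<in> L \<inter> eigs \<psi>. e v = 1 \<and> eig \<psi> v ^ p = 1}" unfolding G_def
  proof (rule grp_least, safe)
    fix f g assume fg: "f \<in> F" "g \<in> F" "e f = e g"
    have fL: "f \<in> L" "g \<in> L" using fg F by auto
    show "f - g \<in> L" using fL add_subgroupD(2)[OF L] by blast
    show "e (f - g) = 1" using e_diff[OF fL] e0[OF fL(2)] fg(3) by simp
    show "f - g \<in> eigs \<psi>" "eig \<psi> (f - g) ^ p = 1" using blockD[OF bl[OF fg(2)]] fg by auto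
  qed
  have G: "add_subgroup G" unfolding G_def by (rule add_subgroup_grp)
  obtain \<gamma> M where M: "M > (0::nat)" and \<gamma>: "\<And>z. \<gamma> z \<in> L" "\<And>z g. g \<in> L \<Longrightarrow> \<gamma> (z + g) = \<gamma> z + g"
    and \<gamma>M: "\<And>w. \<exists>g\<in>L. \<forall>z n. \<gamma> (z + of_nat (M * n) * w) = \<gamma> z + of_nat n * g"
    by (rule subgroup_retract[OF L]) blast
  obtain \<beta> M' where M': "M' > (0::nat)" and \<beta>: "\<And>z. \<beta> z \<in> G" "\<And>z g. g \<in> G \<Longrightarrow> \<beta> (z + g) = \<beta> z + g"
    and \<beta>M: "\<And>w. \<exists>g\<in>G. \<forall>z n. \<beta> (z + of_nat (M' * n) * w) = \<beta> z + of_nat n * g"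
    by (rule subgroup_retract[OF G]) blast
  let ?B = "{z. e (\<gamma> z) = 1 \<and> eig \<psi> (\<beta> z) = 1}"
  show ?thesis unfolding periodic_tile_def
  \<comment> \<open>\<open>M\<close> and \<open>M'\<close> make the two retractions move by elements
    of \<open>L\<close> and \<open>G\<close>; the factors \<open>k\<close> and \<open>p\<close> make
    the character and the eigenvalue trivial on these moves.\<close>
  proof (intro exI[of _ "M * M' * k * p"] exI[of _ ?B] conjI allI impI)
    show "M * M' * k * p > 0" using M M' ek(2) p by simp
    show "\<exists>!f. f \<in> F \<and> z - f \<in> ?B" for z
    proof -
      obtain t where t: "t \<in> F" "e (\<gamma> z) = e t" using sur[OF \<gamma>(1)] by blast
      let ?T = "{g \<in> F. e g = e t}"
      have 1: "e (\<gamma> (z - f)) = 1 \<longleftrightarrow> f \<in> ?T" if "f \<in> F" for f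
      proof -
        have "\<gamma> (z - f) = \<gamma> z - f" using \<gamma>(2)[of "- f" z] that F add_subgroupD(3)[OF L] by auto
        then have "e (\<gamma> (z - f)) = e t / e f" using e_diff[OF \<gamma>(1)] that F t by auto
        then show ?thesis using e0 that F t(1) by auto
      qed
      have \<beta>t: "\<beta> (z - t) \<in> eigs \<psi>" "eig \<psi> (\<beta> (z - t)) ^ p = 1" using \<beta>(1) Gsub by auto
      have 2: "eig \<psi> (\<beta> (z - f)) = 1 \<longleftrightarrow> eig \<psi> (f - t) = eig \<psi> (\<beta> (z - t))" if "f \<in> ?T" for f
      proof -
        have "f - t \<in> G" unfolding G_def using that t by (intro grp_base) auto
        then have g: "f - t \<in> G" "- (f - t) \<in> G" using add_subgroupD(3)[OF G] by blast+
        have "\<beta> (z - f) = \<beta> (z - t) - (f - t)" using \<beta>(2)[OF g(2), of "z - t"] by simp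
        then have "eig \<psi> (\<beta> (z - f)) = eig \<psi> (\<beta> (z - t)) / eig \<psi> (f - t)"
          using eig_diff(2)[OF \<psi> \<beta>t(1)] g(1) Gsub by auto
        moreover have "eig \<psi> (f - t) \<noteq> 0" using eig_nonzero[OF \<psi>] g(1) Gsub by auto
        ultimately show ?thesis by auto
      qed
      have "\<exists>!f. f \<in> ?T \<and> eig \<psi> (f - t) = eig \<psi> (\<beta> (z - t))"
        using block_bij[OF \<psi> bl[OF t(1)] _ p, of t] t(1) \<beta>t(2)
        unfolding bij_betw_def inj_on_def by (auto simp: set_eq_iff image_iff) metis+
      moreover have "f \<in> F \<and> z - f \<in> ?B \<longleftrightarrow> f \<in> ?T \<and> eig \<psi> (f - t) = eig \<psi> (\<beta> (z - t))" for f
        using 1 2 by auto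
      ultimately show ?thesis by simp
    qed
    show "z + of_nat (M * M' * k * p) * w \<in> ?B" if z: "z \<in> ?B" for z w
    proof -
      obtain g where g: "g \<in> L" "\<And>z n. \<gamma> (z + of_nat (M * n) * w) = \<gamma> z + of_nat n * g"
        using \<gamma>M by blast
      obtain h where h: "h \<in> G" "\<And>z n. \<beta> (z + of_nat (M' * n) * w) = \<beta> z + of_nat n * h"
        using \<beta>M by blast
      have "e (\<gamma> (z + of_nat (M * (k * (M' * p))) * w)) = e (\<gamma> z) * e g ^ (k * (M' * p))"
        unfolding g(2) e[OF \<gamma>(1) add_subgroup_of_nat_mult[OF L g(1)]] e_mult[OF g(1)] ..
      then have 1: "e (\<gamma> (z + of_nat (M * (k * (M' * p))) * w)) = 1"
        using z ek(1)[OF g(1)] by (simp add: power_mult)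
      have hh: "h \<in> eigs \<psi>" "eig \<psi> h ^ p = 1" "\<beta> z \<in> eigs \<psi>" using h(1) \<beta>(1) Gsub by auto
      have "eig \<psi> (\<beta> (z + of_nat (M' * (p * (M * k))) * w)) = eig \<psi> (\<beta> z) * eig \<psi> h ^ (p * (M * k))"
        unfolding h(2) eig_add(2)[OF \<psi> hh(3) eig_of_nat_mult(1)[OF \<psi> hh(1)]]
          eig_of_nat_mult(2)[OF \<psi> hh(1)] ..
      then have 2: "eig \<psi> (\<beta> (z + of_nat (M' * (p * (M * k))) * w)) = 1"
        using z hh(2) by (simp add: power_mult)
      have "M * (k * (M' * p)) = M * M' * k * p" "M' * (p * (M * k)) = M * M' * k * p" by simp_all
      then show ?thesis using 1 2 by (simp only:) simp
    qed
  qed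
qed

section \<open>Averages of bounded functions\<close>

text \<open>Take Cesaro means of the twisted translates \<open>z^(-j) u(x - j v)\<close>; the
  lattice is countable, so a subsequence converges pointwise. The limit is an eigenfunction along
  \<open>v\<close>, and it inherits linear identities valid along the orbit of \<open>v\<close> as
  well as earlier eigenvalue equations. It may be zero, unless an identity with nonzero
  \<open>\<kappa>\<close> prevents this.\<close>

lemma averaging:
  fixes u :: "'a::{ring_1,countable} \<Rightarrow> complex"
  assumes bdd: "bounded (range u)" and z: "norm z = 1"
  obtains u' where "bounded (range u')" "\<And>x. u' (x - v) = z * u' x"
    "\<And>S :: 'a set. \<And>c g x \<kappa>. (\<And>j. (\<Sum>s\<in>S. c s * u (x - of_nat j * v - g s)) = z ^ j * \<kappa>) \<Longrightarrow>
      (\<Sum>s\<in>S. c s * u' (x - g s)) = \<kappa>"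
    "\<And>w c x. (\<And>y. u (y - w) = c * u y) \<Longrightarrow> u' (x - w) = c * u' x"
proof -
  obtain B where B: "\<And>x. norm (u x) \<le> B" using bdd by (auto simp: bounded_iff)
  have z0: "z \<noteq> 0" using z by auto
  define A where "A n x = (\<Sum>j\<le>n. inverse z ^ j * u (x - of_nat j * v)) / of_nat (Suc n)" for n x
  have An: "norm (A n x) \<le> B" for n x
  proof -
    have "norm (\<Sum>j\<le>n. inverse z ^ j * u (x - of_nat j * v)) \<le> (\<Sum>j\<le>n. B)"
      by (intro sum_norm_le) (simp add: norm_mult norm_power norm_inverse z B)
    also have "\<dots> = B * real (Suc n)" by simp
    finally show ?thesis by (simp add: A_def norm_divide divide_simps mult.commute del: of_nat_Suc)
  qed
  obtain k where k: "strict_mono (k :: nat \<Rightarrow> nat)" "\<And>x. x \<in> UNIV \<Longrightarrow> \<exists>l. (\<lambda>n. A (k n) x) \<longlonglongrightarrow> l"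
    using function_convergent_subsequence[of UNIV A B] An by auto
  define u' where "u' x = lim (\<lambda>n. A (k n) x)" for x
  have u': "(\<lambda>n. A (k n) x) \<longlonglongrightarrow> u' x" for x
    using k(2)[of x] by (auto simp: u'_def limI)
  show ?thesis
  proof (rule that)
    have "norm (u' x) \<le> B" for x
      by (rule LIMSEQ_le_const2[OF tendsto_norm[OF u'[of x]]]) (use An in auto)
    then show "bounded (range u')" by (auto simp: bounded_iff)
    show "u' (x - v) = z * u' x" for x
    proof -
      \<comment> \<open>Telescoping leaves two boundary terms over \<open>Suc n\<close>; since
        \<open>u\<close> is bounded, the defect tends to zero.\<close>
      have eq: "A n (x - v) - z * A n x =
        (inverse z ^ n * u (x - of_nat (Suc n) * v) - z * u x) / of_nat (Suc n)" for n
      proof -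
        define t where "t j = inverse z ^ j * u (x - of_nat j * v)" for j
        have "(\<Sum>j\<le>n. inverse z ^ j * u (x - v - of_nat j * v)) = (\<Sum>j\<le>n. z * t (Suc j))"
          unfolding t_def using z0 by (intro sum.cong) (auto simp: algebra_simps)
        then have A: "A n (x - v) - z * A n x = z * ((\<Sum>j\<le>n. t (Suc j)) - (\<Sum>j\<le>n. t j)) / of_nat (Suc n)"
          unfolding A_def t_def by (simp add: sum_distrib_left diff_divide_distrib algebra_simps)
        have "t 0 + (\<Sum>j\<le>n. t (Suc j)) = (\<Sum>j\<le>n. t j) + t (Suc n)"
          using sum.atMost_Suc_shift[of t n] sum.atMost_Suc[of t n] by metis
        then have *: "(\<Sum>j\<le>n. t (Suc j)) - (\<Sum>j\<le>n. t j) = t (Suc n) - t 0"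
          by (simp add: algebra_simps)
        have "z * t (Suc n) = inverse z ^ n * u (x - of_nat (Suc n) * v)" "z * t 0 = z * u x"
          using z0 by (simp_all add: t_def)
        then show ?thesis unfolding A * right_diff_distrib by simp
      qed
      have "(\<lambda>n. A n (x - v) - z * A n x) \<longlonglongrightarrow> 0"
      proof (rule Lim_null_comparison)
        show "\<forall>\<^sub>F n in sequentially. norm (A n (x - v) - z * A n x) \<le> 2 * B * inverse (real (Suc n))"
        proof (intro always_eventually allI)
          fix n
          have "norm (inverse z ^ n * u (x - of_nat (Suc n) * v) - z * u x) \<le> B + B"
            by (rule order_trans[OF norm_triangle_ineq4 add_mono])
              (auto simp: norm_mult norm_power norm_inverse z B)
          then show "norm (A n (x - v) - z * A n x) \<le> 2 * B * inverse (real (Suc n))"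
            unfolding eq norm_divide norm_of_nat by (simp add: divide_simps del: of_nat_Suc)
        qed
        show "(\<lambda>n. 2 * B * inverse (real (Suc n))) \<longlonglongrightarrow> 0"
          using tendsto_mult[OF tendsto_const[of "2 * B"] LIMSEQ_inverse_real_of_nat] by simp
      qed
      then have "(\<lambda>n. A (k n) (x - v) - z * A (k n) x) \<longlonglongrightarrow> 0"
        using LIMSEQ_subseq_LIMSEQ[OF _ k(1)] by (auto simp: o_def)
      moreover have "(\<lambda>n. A (k n) (x - v) - z * A (k n) x) \<longlonglongrightarrow> u' (x - v) - z * u' x"
        by (intro tendsto_intros u')
      ultimately show ?thesis using LIMSEQ_unique by fastforce
    qed
    show "(\<Sum>s\<in>S. c s * u' (x - g s)) = \<kappa>"
      if "\<And>j. (\<Sum>s\<in>S. c s * u (x - of_nat j * v - g s)) = z ^ j * \<kappa>" for S :: "'a set" and c g x \<kappa>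
    proof -
      have "(\<Sum>s\<in>S. c s * A n (x - g s)) = \<kappa>" for n
      proof -
        have "(\<Sum>s\<in>S. c s * A n (x - g s)) =
          (\<Sum>j\<le>n. inverse z ^ j * (\<Sum>s\<in>S. c s * u (x - of_nat j * v - g s))) / of_nat (Suc n)"
          unfolding A_def sum_distrib_left sum_divide_distrib
          by (subst sum.swap) (intro sum.cong, auto simp: algebra_simps)
        also have "\<dots> = (\<Sum>j\<le>n. \<kappa>) / of_nat (Suc n)"
          unfolding that using z0 by (simp flip: mult.assoc power_mult_distrib)
        finally show ?thesis by (simp del: of_nat_Suc)
      qed
      then have "(\<lambda>n. \<kappa>) \<longlonglongrightarrow> (\<Sum>s\<in>S. c s * u' (x - g s))"
        using tendsto_sum[of S "\<lambda>s n. c s * A (k n) (x - g s)" "\<lambda>s. c s * u' (x - g s)" sequentially]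
          tendsto_mult[OF tendsto_const u'] by simp
      then show ?thesis using LIMSEQ_unique tendsto_const by blast
    qed
    show "u' (x - w) = c * u' x" if "\<And>x. u (x - w) = c * u x" for w c x
    proof -
      have "A n (x - w) = c * A n x" for n
        unfolding A_def using that[of "x - of_nat j * v" for j]
        by (simp add: sum_distrib_left algebra_simps)
      then show ?thesis using u'[of "x - w"] tendsto_mult[OF tendsto_const u'[of x], of c] LIMSEQ_unique
        by fastforce
    qed
  qed
qed

text \<open>Average over the listed vectors one after another. The convolution \<open>\<psi>\<close>
  already has the prescribed eigenvalues and is not changed, so its preimage can be chosen with the
  same eigenvalues.\<close>

lemma averaging_list:
  fixes u :: "'a::{ring_1,countable} \<Rightarrow> complex" and S :: "'a set"
  assumes bdd: "bounded (range u)" and \<psi>: "\<psi> = (\<lambda>x. \<Sum>s\<in>S. u (x - g s))"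
    and vs: "\<And>v z. (v, z) \<in> set vs \<Longrightarrow> norm z = 1 \<and> (\<forall>x. \<psi> (x - v) = z * \<psi> x)"
  obtains u' where "\<psi> = (\<lambda>x. \<Sum>s\<in>S. u' (x - g s))"
    "\<And>v z x. (v, z) \<in> set vs \<Longrightarrow> u' (x - v) = z * u' x"
proof -
  have "\<exists>u'. bounded (range u') \<and> \<psi> = (\<lambda>x. \<Sum>s\<in>S. u' (x - g s)) \<and>
     (\<forall>(v, z)\<in>set vs. \<forall>x. u' (x - v) = z * u' x)"
    using vs
  proof (induction vs)
    case Nil
    then show ?case using bdd \<psi> by auto
  next
    case (Cons p vs)
    obtain v z where p: "p = (v, z)" by force
    have "\<exists>u'. bounded (range u') \<and> \<psi> = (\<lambda>x. \<Sum>s\<in>S. u' (x - g s)) \<and>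
      (\<forall>(v, z)\<in>set vs. \<forall>x. u' (x - v) = z * u' x)"
      by (rule Cons.IH) (rule Cons.prems, simp)
    then obtain u1 where u1: "bounded (range u1)" "\<psi> = (\<lambda>x. \<Sum>s\<in>S. u1 (x - g s))"
      "\<forall>(v, z)\<in>set vs. \<forall>x. u1 (x - v) = z * u1 x" by blast
    have z: "norm z = 1" "\<And>x. \<psi> (x - v) = z * \<psi> x" using Cons.prems[of v z] p by auto
    have zj: "\<psi> (x - of_nat j * v) = z ^ j * \<psi> x" for j x
    proof (induction j)
      case (Suc j)
      then show ?case using z(2)[of "x - of_nat j * v"] by (simp add: algebra_simps)
    qed simp
    obtain u2 where u2: "bounded (range u2)" "\<And>x. u2 (x - v) = z * u2 x"
      "\<And>S :: 'a set. \<And>c g x \<kappa>. (\<And>j. (\<Sum>s\<in>S. c s * u1 (x - of_nat j * v - g s)) = z ^ j * \<kappa>) \<Longrightarrow>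
        (\<Sum>s\<in>S. c s * u2 (x - g s)) = \<kappa>"
      "\<And>w c x. (\<And>y. u1 (y - w) = c * u1 y) \<Longrightarrow> u2 (x - w) = c * u2 x"
      by (rule averaging[OF u1(1) z(1), of v]) blast
    have \<psi>u2: "(\<Sum>s\<in>S. u2 (x - g s)) = \<psi> x" for x
      using u2(3)[where S=S and c="\<lambda>_. 1" and x=x and g=g and \<kappa>="\<psi> x"] zj[of x] u1(2) by simp
    have "u2 (x - v') = z' * u2 x" if "(v', z') \<in> set (p # vs)" for v' z' x
    proof (cases "(v', z') = p")
      case True
      then show ?thesis using u2(2) p by simp
    next
      case False
      then have "\<And>x. u1 (x - v') = z' * u1 x" using that u1(3) by auto
      then show ?thesis by (rule u2(4))
    qed
    then show ?case using u2(1) \<psi>u2 by (intro exI[of _ u2]) auto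
  qed
  then show ?thesis using that by blast
qed

text \<open>Here \<open>\<psi>\<close> is a difference \<open>h(x - w) - h(x)\<close> with bounded
  \<open>h\<close>. If \<open>\<psi>\<close> is invariant under \<open>w\<close>, then
  \<open>h\<close> grows by the fixed amount \<open>\<psi> x\<close> at each step.\<close>

lemma periodic_difference_eq_0:
  fixes y :: "'a::ring_1 \<Rightarrow> complex"
  assumes bdd: "bounded (range y)" and \<psi>: "\<psi> \<in> shift_span (\<lambda>x. y (x - w) - y x)"
    and per: "\<And>x. \<psi> (x - w) = \<psi> x"
  shows "\<psi> = (\<lambda>_. 0)"
proof -
  obtain h where h: "h \<in> shift_span y" "\<psi> = (\<lambda>x. h (x - w) - h x)"
    by (rule shift_span_diff_image[OF \<psi>])
  obtain B where B: "\<And>x. norm (h x) \<le> B"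
    using shift_span_bounded[OF h(1) bdd] by (auto simp: bounded_iff)
  have per': "\<psi> (x - of_nat n * w) = \<psi> x" for n x
  proof (induction n)
    case (Suc n)
    then show ?case using per[of "x - of_nat n * w"] by (simp add: algebra_simps)
  qed simp
  have lin: "h (x - of_nat n * w) = h x + of_nat n * \<psi> x" for n x
  proof (induction n)
    case (Suc n)
    have "h (x - of_nat (Suc n) * w) = h (x - of_nat n * w) + \<psi> (x - of_nat n * w)"
      by (simp add: h(2) algebra_simps)
    then show ?case using Suc per' by (simp add: algebra_simps)
  qed simp
  have "\<psi> x = 0" for x
  proof (rule ccontr)
    assume "\<psi> x \<noteq> 0"
    then obtain n where n: "of_nat n * norm (\<psi> x) > 2 * B"
      using reals_Archimedean3[of "norm (\<psi> x)"] by auto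
    have "of_nat n * norm (\<psi> x) = norm (h (x - of_nat n * w) - h x)"
      by (simp add: lin norm_mult)
    also have "\<dots> \<le> B + B" by (rule order_trans[OF norm_triangle_ineq4 add_mono]) (auto simp: B)
    finally show False using n by simp
  qed
  then show ?thesis by auto
qed

section \<open>Vanishing power sums of roots of unity\<close>

lemma sum_roots_unity_power:
  assumes "N > 0" "\<not> N dvd j"
  shows "(\<Sum>z | z ^ N = 1. z ^ j :: complex) = 0"
proof -
  have fin: "bij_betw inverse {z :: complex. z ^ N = 1} {z. z ^ N = 1}"
    by (rule bij_betwI[of _ _ _ inverse]) (auto simp: power_inverse)
  have "(\<Sum>z | z ^ N = 1. z ^ j :: complex) = (\<Sum>z | z ^ N = 1. z ^ (j mod N))"
  proof (intro sum.cong refl)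
    fix z :: complex assume "z \<in> {z. z ^ N = 1}"
    then have "z ^ (N * (j div N) + j mod N) = z ^ (j mod N)" by (simp only: power_add power_mult) simp
    then show "z ^ j = z ^ (j mod N)" by simp
  qed
  also have "\<dots> = (\<Sum>z | z ^ N = 1. inverse z ^ (j mod N))"
    by (rule sum.reindex_bij_betw[OF fin, symmetric])
  also have "\<dots> = 0"
    using assms by (intro sum_roots_unity_inverse_power) (auto simp: dvd_eq_mod_eq_0)
  finally show ?thesis .
qed

lemma sum_powers_root_unity:
  fixes w :: complex
  assumes "w ^ p = 1"
  shows "(\<Sum>r<p. w ^ r) = (if w = 1 then of_nat p else 0)"
  using assms by (auto simp: geometric_sum)

text \<open>Fourier inversion on the \<open>p\<close>-th roots of unity: only the zeroth power sum
  survives, so every root is taken equally often.\<close>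

lemma card_fibre_of_power_sums:
  fixes x :: "'i \<Rightarrow> complex"
  assumes fin: "finite K" and p: "p > 0" and x: "\<And>f. f \<in> K \<Longrightarrow> x f ^ p = 1"
    and s: "\<And>r. 0 < r \<Longrightarrow> r < p \<Longrightarrow> (\<Sum>f\<in>K. x f ^ r) = 0" and z: "z ^ p = 1"
  shows "p * card {f \<in> K. x f = z} = card K"
proof -
  have z0: "z \<noteq> 0" using z p by (metis power_0_left zero_neq_one less_irrefl)
  have "(\<Sum>r<p. inverse z ^ r * (\<Sum>f\<in>K. x f ^ r)) = (\<Sum>r<p. if r = 0 then of_nat (card K) else 0)"
    using s by (intro sum.cong) auto
  also have "\<dots> = of_nat (card K)" using p by simp
  finally have "of_nat (card K) = (\<Sum>f\<in>K. \<Sum>r<p. (x f / z) ^ r)"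
    by (simp add: sum_distrib_left sum.swap[of _ K] divide_inverse power_mult_distrib mult.commute)
  also have "\<dots> = (\<Sum>f\<in>K. if x f = z then of_nat p else 0)"
    using sum_powers_root_unity[of "x f / z" p for f] x z z0
    by (intro sum.cong) (auto simp: power_divide)
  also have "\<dots> = of_nat (p * card {f \<in> K. x f = z})"
    using fin by (simp add: sum.If_cases Int_def mult.commute)
  finally show ?thesis using of_nat_eq_iff by metis
qed

lemma choose_fibres:
  assumes "finite Z" "\<And>z. z \<in> Z \<Longrightarrow> \<exists>f\<in>K. x f = z"
  obtains S where "S \<subseteq> K" "card S = card Z" "inj_on x S" "x ` S = Z"
proof -
  obtain h where h: "\<And>z. z \<in> Z \<Longrightarrow> h z \<in> K \<and> x (h z) = z" using assms(2) by metis
  have "inj_on h Z" using h by (metis inj_onI)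
  then have "card (h ` Z) = card Z" by (rule card_image)
  moreover have "inj_on x (h ` Z)" using h by (auto simp: inj_on_def)
  moreover have "x ` h ` Z = Z" using h by force
  ultimately show ?thesis using that[of "h ` Z"] h by blast
qed

lemma extract_full_orbit:
  fixes x :: "'i \<Rightarrow> complex"
  assumes fin: "finite K" and p: "p > 0" and x: "\<And>f. f \<in> K \<Longrightarrow> x f ^ p = 1"
    and s: "\<And>r. 0 < r \<Longrightarrow> r < p \<Longrightarrow> (\<Sum>f\<in>K. x f ^ r) = 0" and ne: "K \<noteq> {}"
  obtains S where "S \<subseteq> K" "card S = p" "inj_on x S"
proof -
  have "\<exists>f\<in>K. x f = z" if "z ^ p = 1" for z
  proof -
    have "p * card {f \<in> K. x f = z} = card K" by (rule card_fibre_of_power_sums[OF fin p x s that])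
    then have "{f \<in> K. x f = z} \<noteq> {}" using ne fin by (metis card.empty card_0_eq mult_0_right)
    then show ?thesis by blast
  qed
  moreover have fin: "finite {z :: complex. z ^ p = 1}" using finite_roots_unity[of p] p by simp
  ultimately obtain S where "S \<subseteq> K" "card S = card {z :: complex. z ^ p = 1}" "inj_on x S"
    using choose_fibres[OF fin, of K x] by (metis (mono_tags, lifting) mem_Collect_eq)
  then show ?thesis using that card_roots_unity_eq[OF p] by simp
qed

text \<open>Fourier inversion with the odd exponents below \<open>2q\<close>. They detect the odd
  part \<open>n(z) - n(-z)\<close> of the multiplicity function, and \<open>q\<close> is the only
  one among them that is not coprime to \<open>2q\<close>.\<close>

lemma odd_power_sum_identity:
  fixes x :: "'i \<Rightarrow> complex"
  assumes fin: "finite K" and q: "prime q" "odd q" and x: "\<And>f. f \<in> K \<Longrightarrow> x f ^ (2 * q) = 1"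
    and s: "\<And>r. r > 0 \<Longrightarrow> coprime r (2 * q) \<Longrightarrow> (\<Sum>f\<in>K. x f ^ r) = 0"
    and z: "z ^ q = c" "c * c = 1"
  shows "of_nat q * (of_nat (card {f \<in> K. x f = z}) - of_nat (card {f \<in> K. x f = - z})) =
    c * (\<Sum>f\<in>K. x f ^ q)"
proof -
  have q0: "q > 0" using q(1) prime_gt_0_nat by blast
  have c0: "c \<noteq> 0" using z(2) by auto
  then have z0: "z \<noteq> 0" using z(1) q0 by (metis power_0_left less_irrefl)
  have "inverse c = c" using z(2) c0 by (simp add: field_simps)
  obtain m where m: "q = 2 * m + 1" using q(2) oddE by blast
  have "(\<Sum>i<q. inverse z ^ (2 * i + 1) * (\<Sum>f\<in>K. x f ^ (2 * i + 1))) =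
      (\<Sum>i<q. if i = m then c * (\<Sum>f\<in>K. x f ^ q) else 0)"
  proof (intro sum.cong refl)
    fix i assume i: "i \<in> {..<q}"
    show "inverse z ^ (2 * i + 1) * (\<Sum>f\<in>K. x f ^ (2 * i + 1)) =
      (if i = m then c * (\<Sum>f\<in>K. x f ^ q) else 0)"
    proof (cases "i = m")
      case True
      then have "2 * i + 1 = q" using m by simp
      moreover have "inverse z ^ q = c" using z(1) \<open>inverse c = c\<close> by (simp add: power_inverse)
      ultimately show ?thesis using True by (simp only:) simp
    next
      case False
      \<comment> \<open>The only odd multiple of \<open>q\<close> below \<open>2q\<close> is
        \<open>q\<close> itself, which belongs to the excluded index \<open>m\<close>.\<close>
      have "\<not> q dvd 2 * i + 1"
      proof
        assume "q dvd 2 * i + 1"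
        then obtain k where k: "2 * i + 1 = q * k" by blast
        have "2 * i + 1 < q * 2" using i by auto
        then have "q * k < q * 2" unfolding k .
        then have "k < 2" by (simp only: mult_less_cancel1)
        moreover have "k \<noteq> 0" using k by (intro notI) simp
        ultimately have "k = 1" by simp
        then show False using k m False by simp
      qed
      then have "coprime (2 * i + 1) (2 * q)"
        using q(1) by (simp add: coprime_commute prime_imp_coprime_nat)
      then show ?thesis using s[of "2 * i + 1"] False by simp
    qed
  qed
  also have "\<dots> = c * (\<Sum>f\<in>K. x f ^ q)" using m by simp
  finally have "c * (\<Sum>f\<in>K. x f ^ q) = (\<Sum>f\<in>K. \<Sum>i<q. (x f / z) * ((x f / z)\<^sup>2) ^ i)"
    by (simp add: sum_distrib_left sum.swap[of _ K] divide_inverse power_mult_distrib mult_ac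
        flip: power_mult)
  also have "\<dots> = (\<Sum>f\<in>K. (if x f = z then of_nat q else 0) - (if x f = - z then of_nat q else 0))"
  proof (intro sum.cong refl)
    fix f assume f: "f \<in> K"
    let ?w = "x f / z"
    have "z ^ (2 * q) = 1" using z by (simp add: power_mult power2_eq_square mult.commute[of 2])
    then have "(?w\<^sup>2) ^ q = 1" using x[OF f] by (simp add: power_divide flip: power_mult)
    then have *: "(\<Sum>i<q. (?w\<^sup>2) ^ i) = (if ?w\<^sup>2 = 1 then of_nat q else 0)"
      by (rule sum_powers_root_unity)
    have "?w\<^sup>2 = 1 \<longleftrightarrow> x f = z \<or> x f = - z"
      unfolding power2_eq_1_iff using z0 by (auto simp: divide_eq_eq)
    then show "(\<Sum>i<q. ?w * (?w\<^sup>2) ^ i) =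
        (if x f = z then of_nat q else 0) - (if x f = - z then of_nat q else 0)"
      unfolding sum_distrib_left[symmetric] * using z0 by auto
  qed
  also have "\<dots> = of_nat q * (of_nat (card {f \<in> K. x f = z}) - of_nat (card {f \<in> K. x f = - z}))"
    using fin by (simp add: sum_subtractf sum.If_cases Int_def algebra_simps)
  finally show ?thesis ..
qed

text \<open>By the identity, \<open>n(z) - n(-z)\<close> depends only on \<open>z^q\<close> and is
  not zero. So for one sign \<open>c\<close> it is positive on the whole coset
  \<open>z^q = c\<close>, and all these values occur.\<close>

lemma extract_half_orbit:
  fixes x :: "'i \<Rightarrow> complex"
  assumes fin: "finite K" and q: "prime q" "odd q" and x: "\<And>f. f \<in> K \<Longrightarrow> x f ^ (2 * q) = 1"
    and s: "\<And>r. r > 0 \<Longrightarrow> coprime r (2 * q) \<Longrightarrow> (\<Sum>f\<in>K. x f ^ r) = 0"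
    and nz: "(\<Sum>f\<in>K. x f ^ q) \<noteq> 0"
  obtains S c where "S \<subseteq> K" "card S = q" "inj_on x S" "\<And>f. f \<in> S \<Longrightarrow> x f ^ q = c" "c \<noteq> 0"
proof -
  have q0: "q > 0" using q(1) prime_gt_0_nat by blast
  let ?n = "\<lambda>z. card {f \<in> K. x f = z}" and ?\<delta> = "\<Sum>f\<in>K. x f ^ q"
  have id: "of_nat q * (of_nat (?n z) - of_nat (?n (- z))) = z ^ q * ?\<delta>" if "z ^ q * z ^ q = 1" for z
    by (rule odd_power_sum_identity[OF fin q x s refl that])
  have "?n 1 \<noteq> ?n (- 1)"
  proof
    assume "?n 1 = ?n (- 1)"
    then show False using id[of 1] nz by simp
  qed
  then obtain c :: complex where c: "c = 1 \<or> c = -1" "?n c > ?n (- c)"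
    by (cases "?n 1 > ?n (-1)") force+
  have cq: "c ^ q = c" "c * c = 1" using c(1) q(2) by auto
  have hit: "\<exists>f\<in>K. x f = z" if z: "z ^ q = c" for z
  proof -
    have "of_nat q * (of_nat (?n z) - of_nat (?n (- z))) =
        (of_nat q * (of_nat (?n c) - of_nat (?n (- c))) :: complex)"
      using id[of z] id[of c] z cq by simp
    then have "(of_int (int (?n z) - int (?n (- z))) :: complex) = of_int (int (?n c) - int (?n (- c)))"
      using q0 by simp
    then have "int (?n z) - int (?n (- z)) = int (?n c) - int (?n (- c))"
      using of_int_eq_iff by blast
    then have "?n z > 0" using c(2) by linarith
    then show ?thesis by (auto simp: card_gt_0_iff)
  qed
  have "c \<noteq> 0" using cq by auto
  moreover have "finite {z. z ^ q = c}" and card: "card {z. z ^ q = c} = q"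
    using card_nth_roots[of c q] finite_nth_roots[of q c] q0 \<open>c \<noteq> 0\<close> by auto
  ultimately obtain S where S: "S \<subseteq> K" "card S = card {z. z ^ q = c}" "inj_on x S" "x ` S = {z. z ^ q = c}"
    using choose_fibres[of "{z. z ^ q = c}" K x] hit by (metis (mono_tags, lifting) mem_Collect_eq)
  then have "x f ^ q = c" if "f \<in> S" for f using that by blast
  then show ?thesis using that[of S c] S card \<open>c \<noteq> 0\<close> by simp
qed

text \<open>An odd number of signs has an odd sum.\<close>

lemma sum_signs_nonzero:
  fixes y :: "'i \<Rightarrow> complex"
  assumes "finite K" "odd (card K)" "\<And>f. f \<in> K \<Longrightarrow> y f * y f = 1"
  shows "sum y K \<noteq> 0"
proof
  assume 0: "sum y K = 0"
  have y: "y f = 1 \<or> y f = - 1" if "f \<in> K" for f using assms(3)[OF that] square_eq_1_iff by blast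
  have "sum y K = (\<Sum>f\<in>K. of_int (if y f = 1 then 1 else - 1))"
    using y by (intro sum.cong) auto
  also have "\<dots> = of_int (\<Sum>f\<in>K. if y f = 1 then 1 else - 1)" by simp
  finally have "(\<Sum>f\<in>K. if y f = 1 then 1 else - 1 :: int) = 0" using 0 by (metis of_int_eq_0_iff)
  moreover have "even (\<Sum>f\<in>K. if y f = 1 then 1 else - 1 :: int) = even (card K)"
    using assms(1) by (induction K rule: finite_induct) auto
  ultimately show False using assms(2) by simp
qed

section \<open>Blocks\<close>

lemma block_power_sum:
  fixes \<psi> :: "'a::ring_1 \<Rightarrow> complex"
  assumes "\<psi> \<noteq> (\<lambda>_. 0)" "block p \<psi> S" "t \<in> S" "p > 0" "\<not> p dvd r"
  shows "(\<Sum>f\<in>S. eig \<psi> (f - t) ^ r) = 0"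
proof -
  have "(\<Sum>f\<in>S. eig \<psi> (f - t) ^ r) = (\<Sum>z | z ^ p = 1. z ^ r)"
    by (rule sum.reindex_bij_betw[OF block_bij[OF assms(1-4)], of "\<lambda>z. z ^ r"])
  then show ?thesis using sum_roots_unity_power[OF assms(4,5)] by simp
qed

lemma block_of_class:
  fixes \<psi> :: "'a::ring_1 \<Rightarrow> complex"
  assumes \<psi>: "\<psi> \<noteq> (\<lambda>_. 0)" and S: "\<And>f. f \<in> S \<Longrightarrow> f - g \<in> eigs \<psi>" "card S = p"
    "inj_on (\<lambda>f. eig \<psi> (f - g)) S" "\<And>f. f \<in> S \<Longrightarrow> eig \<psi> (f - g) ^ p = c" "c \<noteq> 0"
  shows "block p \<psi> S"
  unfolding block_def
proof (intro conjI ballI impI)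
  fix f h assume fh: "f \<in> S" "h \<in> S"
  have d: "f - h \<in> eigs \<psi>" "eig \<psi> (f - h) = eig \<psi> (f - g) / eig \<psi> (h - g)"
    using eig_diff[OF \<psi> S(1)[OF fh(1)] S(1)[OF fh(2)]] by simp_all
  show "f - h \<in> eigs \<psi>" by fact
  show "eig \<psi> (f - h) ^ p = 1" using d(2) S(4,5) fh by (simp add: power_divide)
  show "eig \<psi> (f - h) \<noteq> 1" if "f \<noteq> h"
    using inj_onD[OF S(3) _ fh] that eig_nonzero[OF \<psi> S(1)[OF fh(2)]] d(2) by auto
qed (rule S(2))

text \<open>The conclusion of \<open>terminal_vector\<close> relative to a set \<open>G\<close>,
  with classes taken inside \<open>G\<close>, so that it can be carried along while blocks are
  removed.\<close>

definition classes_vanish :: "nat \<Rightarrow> ('a::ring_1 \<Rightarrow> complex) \<Rightarrow> 'a set \<Rightarrow> bool" where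
  "classes_vanish N \<psi> G \<longleftrightarrow> (\<forall>g\<in>G. \<forall>r>0. coprime r N \<longrightarrow>
    (\<Sum>f | f \<in> G \<and> related N \<psi> f g. eig \<psi> (f - g) ^ r) = 0)"

text \<open>A block that meets a class lies inside it, because its eigenvalues are
  \<open>p\<close>-th roots of unity and \<open>p\<close> divides \<open>N\<close>. Its own power
  sums vanish, as \<open>p\<close> does not divide \<open>r\<close>, so removing it changes no class
  sum.\<close>

lemma classes_vanish_Diff_block:
  fixes \<psi> :: "'a::ring_1 \<Rightarrow> complex"
  assumes \<psi>: "\<psi> \<noteq> (\<lambda>_. 0)" and fin: "finite G" and cv: "classes_vanish N \<psi> G"
    and S: "S \<subseteq> G" "block p \<psi> S" and p: "p > 1" "p dvd N"
  shows "classes_vanish N \<psi> (G - S)"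
  unfolding classes_vanish_def
proof (intro ballI allI impI)
  fix g and r :: nat assume g: "g \<in> G - S" and r: "r > 0" "coprime r N"
  let ?h = "\<lambda>f. eig \<psi> (f - g) ^ r"
  have ndvd: "\<not> p dvd r" using r(2) p by (metis coprime_common_divisor_nat nat_neq_iff nat_dvd_1_iff_1)
  have "sum ?h {f. f \<in> S \<and> related N \<psi> f g} = 0"
  proof (cases "\<exists>s\<in>S. related N \<psi> s g")
    case True
    then obtain s where s: "s \<in> S" "related N \<psi> s g" by blast
    then have sg: "s - g \<in> eigs \<psi>" "eig \<psi> (s - g) ^ N = 1" by (auto simp: related_def)
    have *: "f - g \<in> eigs \<psi> \<and> eig \<psi> (f - g) = eig \<psi> (s - g) * eig \<psi> (f - s)" if "f \<in> S" for f
      using eig_add[OF \<psi> sg(1) blockD(1)[OF S(2) that s(1)]] by (simp add: mult.commute)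
    have "related N \<psi> f g" if "f \<in> S" for f
    proof -
      have "eig \<psi> (f - s) ^ N = 1" using blockD(2)[OF S(2) that s(1)] p(2) by (auto simp: power_mult)
      then show ?thesis using *[OF that] sg(2) by (simp add: related_def power_mult_distrib)
    qed
    then have "{f. f \<in> S \<and> related N \<psi> f g} = S" by auto
    then have "sum ?h {f. f \<in> S \<and> related N \<psi> f g} = eig \<psi> (s - g) ^ r * (\<Sum>f\<in>S. eig \<psi> (f - s) ^ r)"
      using * by (simp add: sum_distrib_left power_mult_distrib)
    then show ?thesis using block_power_sum[OF \<psi> S(2) s(1) _ ndvd] p(1) by simp
  next
    case False
    then show ?thesis by (intro sum.neutral) auto
  qed
  moreover have "sum ?h {f. f \<in> G \<and> related N \<psi> f g} =
    sum ?h {f. f \<in> G - S \<and> related N \<psi> f g} + sum ?h {f. f \<in> S \<and> related N \<psi> f g}"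
  proof -
    have "{f. f \<in> G \<and> related N \<psi> f g} =
        {f. f \<in> G - S \<and> related N \<psi> f g} \<union> {f. f \<in> S \<and> related N \<psi> f g}" using S(1) by auto
    then show ?thesis using fin finite_subset[OF S(1) fin] by (simp add: sum.union_disjoint disjoint_iff)
  qed
  ultimately show "sum ?h {f. f \<in> G - S \<and> related N \<psi> f g} = 0"
    using cv g r by (simp add: classes_vanish_def)
qed

lemma sum_over_classes:
  fixes \<psi> :: "'a::ring_1 \<Rightarrow> complex" and h :: "'a \<Rightarrow> 'b::comm_monoid_add"
  assumes \<psi>: "\<psi> \<noteq> (\<lambda>_. 0)" and fin: "finite F"
    and 0: "\<And>g. g \<in> F \<Longrightarrow> (\<Sum>f | f \<in> F \<and> related N \<psi> f g. h f) = 0"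
  shows "sum h F = 0"
proof -
  define cl where "cl g = {f. f \<in> F \<and> related N \<psi> f g}" for g
  have cl: "f \<in> F \<and> cl f = cl g \<longleftrightarrow> f \<in> F \<and> related N \<psi> f g" if "g \<in> F" for f g
    using related_refl[OF \<psi>] related_sym[OF \<psi>] related_trans[OF \<psi>] that unfolding cl_def by blast
  have "sum h F = (\<Sum>C\<in>cl ` F. \<Sum>f | f \<in> F \<and> cl f = C. h f)"
    by (rule sum.image_gen[OF fin])
  also have "\<dots> = 0" using 0 cl by (intro sum.neutral) auto
  finally show ?thesis .
qed

lemma odd_class_exists:
  fixes \<psi> :: "'a::ring_1 \<Rightarrow> complex"
  assumes \<psi>: "\<psi> \<noteq> (\<lambda>_. 0)" and fin: "finite F" and odd: "odd (card F)"
  obtains g where "g \<in> F" "odd (card {f. f \<in> F \<and> related N \<psi> f g})"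
proof (rule ccontr)
  assume "\<not> thesis"
  then have ev: "\<And>g. g \<in> F \<Longrightarrow> even (card {f. f \<in> F \<and> related N \<psi> f g})" using that by blast
  define cl where "cl g = {f. f \<in> F \<and> related N \<psi> f g}" for g
  have "2 dvd card (\<Union> (cl ` F))"
  proof (rule dvd_partition)
    show "finite (\<Union> (cl ` F))" using fin by (auto simp: cl_def)
    show "\<forall>c\<in>cl ` F. 2 dvd card c" using ev by (auto simp: cl_def)
    show "\<forall>c1\<in>cl ` F. \<forall>c2\<in>cl ` F. c1 \<noteq> c2 \<longrightarrow> c1 \<inter> c2 = {}"
      unfolding cl_def using related_sym[OF \<psi>] related_trans[OF \<psi>] by blast
  qed
  moreover have "\<Union> (cl ` F) = F" using related_refl[OF \<psi>] by (auto simp: cl_def)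
  ultimately show False using odd by simp
qed

section \<open>Tiles of size \<open>2q\<close>\<close>

text \<open>The nonzero \<open>q\<close>-th power sum yields the first block. The remaining
  \<open>q\<close> elements are odd in number, so one of their classes is odd; its
  \<open>q\<close>-th power sum consists of an odd number of signs and is nonzero, and the
  extraction applies again.\<close>

lemma two_blocks:
  fixes \<psi> :: "'a::ring_1 \<Rightarrow> complex"
  assumes \<psi>: "\<psi> \<noteq> (\<lambda>_. 0)" and fin: "finite F" and q: "prime q" "odd q" and card: "card F = 2 * q"
    and cv: "classes_vanish (2 * q) \<psi> F"
    and g: "g \<in> F" "(\<Sum>f | f \<in> F \<and> related (2 * q) \<psi> f g. eig \<psi> (f - g) ^ q) \<noteq> 0"
  obtains S where "S \<subseteq> F" "block q \<psi> S" "block q \<psi> (F - S)"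
proof -
  have pick: "\<exists>S \<subseteq> {f. f \<in> G \<and> related (2 * q) \<psi> f g}. block q \<psi> S"
    if G: "finite G" "classes_vanish (2 * q) \<psi> G" "g \<in> G"
      and nz: "(\<Sum>f | f \<in> G \<and> related (2 * q) \<psi> f g. eig \<psi> (f - g) ^ q) \<noteq> 0" for G g
  proof -
    let ?K = "{f. f \<in> G \<and> related (2 * q) \<psi> f g}"
    obtain S c where S: "S \<subseteq> ?K" "card S = q" "inj_on (\<lambda>f. eig \<psi> (f - g)) S"
      "\<And>f. f \<in> S \<Longrightarrow> eig \<psi> (f - g) ^ q = c" "c \<noteq> 0"
    proof (rule extract_half_orbit[of ?K q "\<lambda>f. eig \<psi> (f - g)"])
      show "finite ?K" using G(1) by simp
      show "eig \<psi> (f - g) ^ (2 * q) = 1" if "f \<in> ?K" for f using that by (simp add: related_def)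
      show "(\<Sum>f\<in>?K. eig \<psi> (f - g) ^ r) = 0" if "r > 0" "coprime r (2 * q)" for r
        using G(2,3) that by (simp add: classes_vanish_def)
    qed (use q nz in auto)
    have "block q \<psi> S"
      by (rule block_of_class[OF \<psi> _ S(2-5)]) (use S(1) in \<open>auto simp: related_def\<close>)
    then show ?thesis using S(1) by blast
  qed
  from pick[OF fin cv g] obtain S where S: "S \<subseteq> F" "block q \<psi> S" by blast
  have finS: "finite (F - S)" using fin by simp
  have cardS: "card (F - S) = q"
    using card S fin by (simp add: card_Diff_subset finite_subset block_def)
  have cv': "classes_vanish (2 * q) \<psi> (F - S)"
    using classes_vanish_Diff_block[OF \<psi> fin cv S] prime_gt_1_nat[OF q(1)] by simp
  obtain h where h: "h \<in> F - S" "odd (card {f. f \<in> F - S \<and> related (2 * q) \<psi> f h})"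
    using odd_class_exists[OF \<psi> finS] cardS q(2) by metis
  have "(\<Sum>f | f \<in> F - S \<and> related (2 * q) \<psi> f h. eig \<psi> (f - h) ^ q) \<noteq> 0"
  proof (rule sum_signs_nonzero[OF _ h(2)])
    show "eig \<psi> (f - h) ^ q * eig \<psi> (f - h) ^ q = 1"
      if "f \<in> {f. f \<in> F - S \<and> related (2 * q) \<psi> f h}" for f
      using that by (simp add: related_def mult_2 flip: power_add)
  qed (use fin in simp)
  from pick[OF finS cv' h(1) this] obtain S' where S': "S' \<subseteq> F - S" "block q \<psi> S'" by blast
  then have "S' = F - S" using cardS finS by (intro card_subset_eq) (auto simp: block_def)
  then show ?thesis using that S S'(2) by blast
qed

section \<open>Relations between the two blocks\<close>

definition part_grp :: "'a::ab_group_add set set \<Rightarrow> 'a set" where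
  "part_grp P = grp {f - g | f g. \<exists>T\<in>P. f \<in> T \<and> g \<in> T}"

lemma part_grp_base: "T \<in> P \<Longrightarrow> f \<in> T \<Longrightarrow> g \<in> T \<Longrightarrow> f - g \<in> part_grp P"
  unfolding part_grp_def by (rule grp_base) blast

lemma add_subgroup_part_grp: "add_subgroup (part_grp P)"
  unfolding part_grp_def by (rule add_subgroup_grp)

lemma part_grp_eig:
  fixes \<psi> :: "'a::ring_1 \<Rightarrow> complex"
  assumes \<psi>: "\<psi> \<noteq> (\<lambda>_. 0)" and P: "\<And>T. T \<in> P \<Longrightarrow> block p \<psi> T" and v: "v \<in> part_grp P"
  shows "v \<in> eigs \<psi>" "eig \<psi> v ^ p = 1"
proof -
  have "add_subgroup {v \<in> eigs \<psi>. eig \<psi> v ^ p = 1}"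
    using eig_0[OF \<psi>] eig_diff[OF \<psi>] by (auto simp: add_subgroup_def power_divide)
  then have "part_grp P \<subseteq> {v \<in> eigs \<psi>. eig \<psi> v ^ p = 1}"
    unfolding part_grp_def by (rule grp_least) (use blockD[OF P] in auto)
  then show "v \<in> eigs \<psi>" "eig \<psi> v ^ p = 1" using v by auto
qed

text \<open>Modulo the block differences, \<open>F\<close> takes only two values, differing by
  \<open>u\<close>. If no odd multiple of \<open>u\<close> were trivial, the parity of the
  coefficient of \<open>u\<close> would be a well-defined character separating the blocks, and
  \<open>F\<close> would tile periodically.\<close>

lemma odd_relation:
  fixes F :: "(int ^ 'd::finite) set"
  assumes npt: "\<not> periodic_tile F" and fin: "finite F" and F0: "0 \<in> F" and \<psi>: "\<psi> \<noteq> (\<lambda>_. 0)"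
    and S: "S \<subseteq> F" "block q \<psi> S" "block q \<psi> (F - S)" and q: "q > 0"
  obtains k where "odd (k::nat)" "\<And>f g. f \<in> F \<Longrightarrow> g \<in> F \<Longrightarrow> of_nat k * (f - g) \<in> part_grp {S, F - S}"
proof -
  let ?G = "part_grp {S, F - S}"
  have G: "add_subgroup ?G" by (rule add_subgroup_part_grp)
  note GD = add_subgroupD[OF G]
  have "card S = q" "card (F - S) = q" using S(2,3) unfolding block_def by blast+
  then have "S \<noteq> {}" "F - S \<noteq> {}" using q by (metis card.empty less_irrefl)+
  then obtain s c where s: "s \<in> S" and c: "c \<in> F - S" by blast
  define u where "u = c - s"
  have mem: "\<exists>n\<in>{0, 1, -1}. f - g - of_int n * u \<in> ?G" if "f \<in> F" "g \<in> F" for f g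
  proof -
    have *: "(f - s \<in> ?G \<or> f - c \<in> ?G)" if "f \<in> F" for f
      using part_grp_base[of S "{S, F - S}" f s] part_grp_base[of "F - S" "{S, F - S}" f c] s c that by blast
    have 1: "(f - s) - (g - s) = f - g" "(f - c) - (g - c) = f - g"
      "(f - s) - (g - c) = f - g + u" "(f - c) - (g - s) = f - g - u" by (auto simp: u_def)
    show ?thesis using *[OF that(1)] *[OF that(2)] GD(2) 1 by (auto; metis)
  qed
  show ?thesis
  proof (cases "\<exists>k::nat. odd k \<and> of_nat k * u \<in> ?G")
    case True
    then obtain k :: nat where k: "odd k" "of_nat k * u \<in> ?G" by blast
    have "of_nat k * (f - g) \<in> ?G" if fg: "f \<in> F" "g \<in> F" for f g
    proof -
      obtain n where n: "f - g - of_int n * u \<in> ?G" using mem[OF fg] by blast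
      have "of_nat k * (f - g - of_int n * u) + of_int n * (of_nat k * u) \<in> ?G"
        by (intro GD(4) add_subgroup_of_nat_mult[OF G] add_subgroup_of_int_mult[OF G] n k)
      then show ?thesis by (simp add: algebra_simps)
    qed
    then show ?thesis using that k(1) by blast
  next
    case False
    define E where "E x \<longleftrightarrow> (\<exists>n. even n \<and> x - of_int n * u \<in> ?G)" for x
    define e :: "int ^ 'd \<Rightarrow> complex" where "e x = (if E x then 1 else - 1)" for x
    have par: "even n = even n'" if "x - of_int n * u \<in> ?G" "x - of_int n' * u \<in> ?G" for x n n'
    proof (rule ccontr)
      assume odd: "even n \<noteq> even n'"
      have "(x - of_int n * u) - (x - of_int n' * u) \<in> ?G" using that GD(2) by blast
      then have *: "of_int (n' - n) * u \<in> ?G" by (simp add: algebra_simps)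
      have "of_nat (nat \<bar>n' - n\<bar>) * u \<in> ?G"
        using * GD(3)[OF *] by (cases "n' \<ge> n") (auto simp: algebra_simps)
      moreover have "odd (nat \<bar>n' - n\<bar>)" using odd by (auto simp: even_nat_iff)
      ultimately show False using False by blast
    qed
    have en: "e x = (- 1) ^ nat \<bar>n\<bar>" if "x - of_int n * u \<in> ?G" for x n
    proof -
      have "E x = even n" using par that unfolding E_def by blast
      then show ?thesis by (auto simp: e_def minus_one_power_iff even_nat_iff)
    qed
    define L where "L = grp F"
    have L: "add_subgroup L" unfolding L_def by (rule add_subgroup_grp)
    have "add_subgroup {x. \<exists>n. x - of_int n * u \<in> ?G}"
      unfolding add_subgroup_def
    proof (intro conjI ballI CollectI; (elim CollectE exE)?)
      show "\<exists>n. 0 - of_int n * u \<in> ?G" using GD(1) by (intro exI[of _ 0]) simp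
      fix x y n m assume "x - of_int n * u \<in> ?G" "y - of_int m * u \<in> ?G"
      then have "(x - of_int n * u) - (y - of_int m * u) \<in> ?G" by (rule GD(2))
      then show "\<exists>n. x - y - of_int n * u \<in> ?G" by (intro exI[of _ "n - m"]) (simp add: algebra_simps)
    qed
    moreover have "F \<subseteq> {x. \<exists>n. x - of_int n * u \<in> ?G}"
    proof
      fix f assume "f \<in> F"
      then have "\<exists>n\<in>{0, 1, -1}. f - 0 - of_int n * u \<in> ?G" by (rule mem[OF _ F0])
      then show "f \<in> {x. \<exists>n. x - of_int n * u \<in> ?G}" unfolding diff_zero by blast
    qed
    ultimately have "L \<subseteq> {x. \<exists>n. x - of_int n * u \<in> ?G}" unfolding L_def by (rule grp_least)
    then have Lrep: "\<exists>n. x - of_int n * u \<in> ?G" if "x \<in> L" for x using that by blast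
    have e_add: "e (x + y) = e x * e y" if xy: "x \<in> L" "y \<in> L" for x y
    proof -
      obtain n m where nm: "x - of_int n * u \<in> ?G" "y - of_int m * u \<in> ?G" using Lrep xy by blast
      have "(x - of_int n * u) + (y - of_int m * u) \<in> ?G" using nm GD(4) by blast
      then have "x + y - of_int (n + m) * u \<in> ?G" by (simp add: algebra_simps)
      from en[OF this] en[OF nm(1)] en[OF nm(2)] show ?thesis
        by (auto simp: minus_one_power_iff even_nat_iff)
    qed
    have FL: "F \<subseteq> L" using grp_base by (auto simp: L_def)
    have sc': "s \<in> L" "c \<in> L" using s c S(1) FL by blast+
    then have sc: "s \<in> L" "c \<in> L" "u \<in> L" using add_subgroupD(2)[OF L sc'(2,1)] by (simp_all add: u_def)
    have e1: "e x = 1 \<or> e x = - 1" for x by (simp add: e_def)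
    have "e u = - 1" using en[of u 1] GD(1) by simp
    then have ec: "e c = - e s" using e_add[of s u] sc by (simp add: u_def)
    have eG: "e x = 1" if "x \<in> ?G" for x using en[of x 0] that by simp
    have GL: "?G \<subseteq> L" unfolding part_grp_def using S(1) FL add_subgroupD(2)[OF L]
      by (intro grp_least[OF L]) blast
    have eS: "e f = e s" if "f \<in> S" for f
      using e_add[of "f - s" s] eG part_grp_base[of S "{S, F - S}" f s] that s sc GL by auto
    have eC: "e f = e c" if "f \<in> F - S" for f
      using e_add[of "f - c" c] eG part_grp_base[of "F - S" "{S, F - S}" f c] that c sc GL by auto
    have "e c \<noteq> e s" using ec e1[of s] by auto
    note ne = this this[symmetric]
    have iff: "e g = e s \<longleftrightarrow> g \<in> S" "e g = e c \<longleftrightarrow> g \<notin> S" if "g \<in> F" for g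
      using ne eS[of g] eC[of g] that by (cases "g \<in> S"; auto)+
    have "periodic_tile F"
    proof (rule periodic_tile_of_blocks[OF fin L FL \<psi> e_add])
      show "e x ^ 2 = 1" for x using e1[of x] by auto
      show "\<exists>f\<in>F. e x = e f" for x
        using e1[of x] e1[of s] ec s c S(1) by (metis DiffD1 minus_minus subsetD)
      show "block q \<psi> {g \<in> F. e g = e f}" if "f \<in> F" for f
      proof (cases "f \<in> S")
        case True
        then have "{g \<in> F. e g = e f} = S" using iff S(1) eS[OF True] by auto
        then show ?thesis using S(2) by simp
      next
        case False
        then have "e f = e c" using iff(2)[OF that] by simp
        then have "{g \<in> F. e g = e f} = F - S" using iff(2) by auto
        then show ?thesis using S(3) by simp
      qed
    qed auto
    then show ?thesis using npt by simp
  qed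
qed

text \<open>Reduce the coefficients of a combination of the generators modulo \<open>N\<close>. This
  is what bounds the number of components, up to translation, of the graph in the next
  lemma.\<close>

lemma grp_finite_mod:
  fixes F :: "'a::ring_1 set"
  assumes "finite F" "N > 0"
  obtains R where "finite R" "\<And>x. x \<in> grp F \<Longrightarrow> \<exists>r\<in>R. \<exists>g\<in>grp F. x = r + of_nat N * g"
proof -
  have G: "add_subgroup (grp F)" by (rule add_subgroup_grp)
  have repr: "\<exists>c. x = (\<Sum>f\<in>F. of_int (c f) * f)" if "x \<in> grp F" for x
    using that
  proof induction
    case zero
    show ?case by (rule exI[of _ "\<lambda>_. 0"]) simp
  next
    case (add x s)
    then obtain c where c: "x = (\<Sum>f\<in>F. of_int (c f) * f)" by blast
    have "x + s = (\<Sum>f\<in>F. of_int (c f + (if f = s then 1 else 0)) * f)"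
      using add assms(1) unfolding c
      by (simp add: distrib_right sum.distrib if_distrib[of "\<lambda>z. z * _"] if_distrib[of of_int] cong: if_cong)
    then show ?case by (rule exI[of _ "\<lambda>f. c f + (if f = s then 1 else 0)"])
  next
    case (diff x s)
    then obtain c where c: "x = (\<Sum>f\<in>F. of_int (c f) * f)" by blast
    have "x - s = (\<Sum>f\<in>F. of_int (c f - (if f = s then 1 else 0)) * f)"
      using diff assms(1) unfolding c
      by (simp add: left_diff_distrib sum_subtractf if_distrib[of "\<lambda>z. z * _"] if_distrib[of of_int] cong: if_cong)
    then show ?case by (rule exI[of _ "\<lambda>f. c f - (if f = s then 1 else 0)"])
  qed
  have *: "\<exists>r\<in>(\<lambda>c. \<Sum>f\<in>F. of_int (c f) * f) ` PiE F (\<lambda>_. {0..<int N}). \<exists>g\<in>grp F. x = r + of_nat N * g"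
    if xF: "x \<in> grp F" for x
  proof -
    obtain c where c: "x = (\<Sum>f\<in>F. of_int (c f) * f)"
      using repr[OF xF] by (elim exE)
    define b where "b = restrict (\<lambda>f. c f mod int N) F"
    define g where "g = (\<Sum>f\<in>F. of_int (c f div int N) * f)"
    have "(of_int (c f) :: 'a) = of_int (c f mod int N) + of_nat N * of_int (c f div int N)" for f
      by (metis add.commute mult_div_mod_eq of_int_add of_int_mult of_int_of_nat_eq)
    then have "x = (\<Sum>f\<in>F. of_int (b f) * f) + of_nat N * g"
      unfolding c g_def b_def by (simp add: distrib_right sum.distrib sum_distrib_left mult.assoc)
    moreover have "b \<in> PiE F (\<lambda>_. {0..<int N})" using assms(2) by (auto simp: b_def)
    moreover have "g \<in> grp F" unfolding g_def
      by (intro add_subgroup_sum[OF G] add_subgroup_of_int_mult[OF G] grp_base)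
    ultimately show ?thesis by blast
  qed
  show ?thesis
    by (rule that[OF _ *]) (auto intro!: finite_PiE assms(1))
qed

text \<open>The graph on \<open>{x. H x = 1}\<close> whose edges are the pairs of which a tiling picks exactly one
  is periodic and properly 2-coloured by \<open>a\<close>. A periodic colouring is obtained by copying the
  colours of one component to its translates along a retraction onto the stabiliser of the
  component, whose doubled elements preserve colours.\<close>

lemma periodic_tile_of_double_cover:
  fixes F :: "(int ^ 'd::finite) set" and a H :: "int ^ 'd \<Rightarrow> int"
  assumes fin: "finite F" and N: "N > 0"
    and a01: "\<And>x. a x = 0 \<or> a x = 1" and tile: "\<And>x. (\<Sum>f\<in>F. a (x - f)) = 1"
    and H012: "\<And>x. H x = 0 \<or> H x = 1 \<or> H x = 2" and H: "\<And>x. (\<Sum>f\<in>F. H (x - f)) = 2"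
    and H0: "\<And>x. H x = 0 \<Longrightarrow> a x = 0"
    and per: "\<And>x g. g \<in> grp F \<Longrightarrow> H (x + of_nat N * g) = H x"
  shows "periodic_tile F"
proof -
  define L where "L = grp F"
  have L: "add_subgroup L" unfolding L_def by (rule add_subgroup_grp)
  have FL: "F \<subseteq> L" unfolding L_def using grp_base by blast
  define T where "T = {of_nat N * g | g. g \<in> L}"
  have T: "add_subgroup T" unfolding add_subgroup_def T_def
    using add_subgroupD[OF L] by (auto simp: right_diff_distrib[symmetric]) (metis mult_zero_right)
  note TD = add_subgroupD[OF T]
  have TL: "T \<subseteq> L" unfolding T_def using add_subgroup_of_nat_mult[OF L] by blast
  have perT: "H (x + v) = H x" if "v \<in> T" for x v using that per by (auto simp: T_def L_def)
  define V where "V = {x \<in> L. H x = 1}"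
  have VT: "u + v \<in> V" if "u \<in> V" "v \<in> T" for u v
    using that perT TL add_subgroupD(4)[OF L] by (auto simp: V_def)
  \<comment> \<open>Two positions with \<open>H\<close> at least 1 already exhaust the total
    2.\<close>
  have Hother: "H (x - h) = 0"
    if "f \<in> F" "g \<in> F" "f \<noteq> g" "h \<in> F" "h \<noteq> f" "h \<noteq> g" "H (x - f) \<ge> 1" "H (x - g) \<ge> 1" for x f g h
  proof -
    have nn: "H y \<ge> 0" for y using H012[of y] by auto
    have "(\<Sum>f\<in>{f, g, h}. H (x - f)) \<le> (\<Sum>f\<in>F. H (x - f))"
      using that fin nn by (intro sum_mono2) auto
    then have "H (x - f) + (H (x - g) + H (x - h)) \<le> 2" using that H by auto
    then show ?thesis using that nn[of "x - h"] by linarith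
  qed
  define E where "E = {(p, p'). p \<in> V \<and> p' \<in> V \<and> (\<exists>f\<in>F. \<exists>g\<in>F. f \<noteq> g \<and> p' - p = f - g)}"
  have E_sym: "sym E"
  proof (rule symI)
    fix p p' assume "(p, p') \<in> E"
    then obtain f g where fg: "p \<in> V" "p' \<in> V" "f \<in> F" "g \<in> F" "f \<noteq> g" "p' - p = f - g"
      by (auto simp: E_def)
    have "p - p' = - (p' - p)" by simp
    also have "\<dots> = g - f" unfolding fg(6) by simp
    finally have "p - p' = g - f" .
    then show "(p', p) \<in> E" unfolding E_def mem_Collect_eq case_prod_conv using fg(1-5) by metis
  qed
  have E_flip: "a p' = 1 - a p" if pp': "(p, p') \<in> E" for p p'
  proof -
    obtain f g where fg: "p \<in> V" "p' \<in> V" "f \<in> F" "g \<in> F" "f \<noteq> g" "p' - p = f - g"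
      using pp' by (auto simp: E_def)
    have x: "p + f - f = p" "p + f - g = p'" using fg(6) by (auto simp: algebra_simps)
    have "(\<Sum>h\<in>F. a (p + f - h)) = (\<Sum>h\<in>{f, g}. a (p + f - h))"
    proof (rule sum.mono_neutral_right[OF fin])
      show "\<forall>h\<in>F - {f, g}. a (p + f - h) = 0"
      proof
        fix h assume "h \<in> F - {f, g}"
        then have "H (p + f - h) = 0" using Hother[OF fg(3-5), of h "p + f"] fg(1,2) x by (auto simp: V_def)
        then show "a (p + f - h) = 0" by (rule H0)
      qed
    qed (use fg in auto)
    then show ?thesis using tile[of "p + f"] fg(5) x by auto
  qed
  have E_shift: "(p + v, p' + v) \<in> E" if "(p, p') \<in> E" "v \<in> T" for p p' v
    using that VT unfolding E_def by auto
  let ?C = "E\<^sup>*"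
  have C_sym: "(p', p) \<in> ?C" if "(p, p') \<in> ?C" for p p'
    using sym_rtrancl[OF E_sym] that by (auto dest: symD)
  have C_shift: "(p + v, p' + v) \<in> ?C" if "(p, p') \<in> ?C" "v \<in> T" for p p' v
    using that(1) by induction (auto intro: rtrancl_into_rtrancl E_shift that(2))
  have C_diff: "(p - v, p' - v) \<in> ?C" if "(p, p') \<in> ?C" "v \<in> T" for p p' v
    using C_shift[OF that(1) TD(3)[OF that(2)]] by simp
  have C_V: "p' \<in> V" if "(p, p') \<in> ?C" "p \<in> V" for p p'
    using that by induction (auto simp: E_def)
  define St where "St p = {v \<in> T. (p, p + v) \<in> ?C}" for p
  have St: "add_subgroup (St p)" for p
  proof -
    have "(p, p + (v - w)) \<in> ?C" if "v \<in> T" "w \<in> T" "(p, p + v) \<in> ?C" "(p, p + w) \<in> ?C" for v w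
    proof -
      have "(p, p - w) \<in> ?C" using C_sym[OF C_diff[OF that(4,2)]] by simp
      also have "(p - w, p + v - w) \<in> ?C" by (rule C_diff[OF that(3,2)])
      finally show ?thesis by (simp add: algebra_simps)
    qed
    then show ?thesis unfolding add_subgroup_def St_def using TD by auto
  qed
  have St_C: "(p, u + v) \<in> ?C" if "(p, u) \<in> ?C" "v \<in> St p" for p u v
    using C_shift[OF that(1), of v] that(2) by (auto simp: St_def intro: rtrancl_trans)
  \<comment> \<open>An edge flips both colours being compared, so whether a translation by
    \<open>v\<close> preserves colours is constant along a component.\<close>
  have parity: "(a (u + v) = a u) = (a (p + v) = a p)" if "(p, u) \<in> ?C" "v \<in> T" for p u v
    using that(1)
  proof induction
    case (step u u')
    have "a (u' + v) = 1 - a (u + v)" "a u' = 1 - a u"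
      using E_flip step(2) E_shift[OF step(2) that(2)] by auto
    then show ?case using step.IH by auto
  qed simp
  \<comment> \<open>A translation that stabilises the component preserves its two colours or swaps
    them throughout; applied twice, it preserves them.\<close>
  have double: "a (u + (v + v)) = a u" if "(p, u) \<in> ?C" "v \<in> St p" for p u v
  proof -
    have v: "v \<in> T" using that(2) by (simp add: St_def)
    have "(a (u + v + v) = a (u + v)) = (a (u + v) = a u)"
      using parity[OF St_C[OF that] v] parity[OF that(1) v] by simp
    then show ?thesis using a01[of "u + v + v"] a01[of "u + v"] a01[of u] by (auto simp: add.assoc)
  qed
  \<comment> \<open>All vertices whose component is a \<open>T\<close>-translate of that of
    \<open>u\<close>. There are finitely many such sets, since \<open>T\<close> has finitely many
    cosets in \<open>L\<close>.\<close>
  define cl where "cl u = {p \<in> V. \<exists>v\<in>T. (u, p + v) \<in> ?C}" for u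
  have cl_eq: "cl u = cl u'" if "(u, u' + v) \<in> ?C" "v \<in> T" for u u' v
  proof -
    have *: "cl u' \<subseteq> cl u" if uv: "(u, u' + v) \<in> ?C" "v \<in> T" for u u' v
    proof
      fix p assume "p \<in> cl u'"
      then obtain w where p: "p \<in> V" "w \<in> T" "(u', p + w) \<in> ?C" by (auto simp: cl_def)
      have "(u, p + w + v) \<in> ?C" using rtrancl_trans[OF uv(1) C_shift[OF p(3) uv(2)]] .
      then show "p \<in> cl u" unfolding cl_def using p TD(4)[OF p(2) uv(2)] by (auto simp: add.assoc)
    qed
    have "(u', u + - v) \<in> ?C" using C_sym[OF C_diff[OF that]] by simp
    then show ?thesis using *[OF that] *[OF _ TD(3)[OF that(2)]] by blast
  qed
  have cl_self: "u \<in> cl u" if "u \<in> V" for u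
    using that TD(1) unfolding cl_def by (auto intro!: bexI[of _ 0])
  define rep where "rep u = (SOME p. p \<in> cl u)" for u
  have rep: "rep u \<in> cl u" if "u \<in> V" for u
    unfolding rep_def using cl_self[OF that] by (rule someI)
  have "finite (cl ` V)"
  proof -
    obtain R where R: "finite R" "\<And>x. x \<in> L \<Longrightarrow> \<exists>r\<in>R. \<exists>g\<in>L. x = r + of_nat N * g"
      using grp_finite_mod[OF fin N] unfolding L_def by metis
    have "cl ` V \<subseteq> cl ` R"
    proof
      fix c assume "c \<in> cl ` V"
      then obtain u where u: "u \<in> V" "c = cl u" by blast
      then obtain r g where r: "r \<in> R" "g \<in> L" "u = r + of_nat N * g"
        using R(2)[of u] by (auto simp: V_def)
      then have "cl u = cl r" by (intro cl_eq[of _ _ "of_nat N * g"]) (auto simp: T_def)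
      then show "c \<in> cl ` R" using u r by blast
    qed
    then show ?thesis using R(1) finite_surj by blast
  qed
  then have fin_rep: "finite (rep ` V)"
  proof -
    have "rep ` V = (\<lambda>c. SOME p. p \<in> c) ` cl ` V" unfolding rep_def by auto
    then show ?thesis using \<open>finite (cl ` V)\<close> by simp
  qed
  have "\<exists>\<gamma> M. M > (0::nat) \<and> (\<forall>z. \<gamma> z \<in> St p) \<and> (\<forall>z. \<forall>g\<in>St p. \<gamma> (z + g) = \<gamma> z + g) \<and>
      (\<forall>w. \<exists>g\<in>St p. \<forall>z n. \<gamma> (z + of_nat (M * n) * w) = \<gamma> z + of_nat n * g)" for p
    by (rule subgroup_retract[OF St[of p]]) blast
  then obtain \<gamma> M where M: "\<And>p. M p > (0::nat)" and \<gamma>: "\<And>p z. \<gamma> p z \<in> St p"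
    "\<And>p z g. g \<in> St p \<Longrightarrow> \<gamma> p (z + g) = \<gamma> p z + g"
    and \<gamma>M: "\<And>p w. \<exists>g\<in>St p. \<forall>z n. \<gamma> p (z + of_nat (M p * n) * w) = \<gamma> p z + of_nat n * g"
    by metis
  define Q where "Q = (\<Prod>p\<in>rep ` V. M p)"
  have Q: "Q > 0" unfolding Q_def using M by (intro prod_pos) auto
  define vv where "vv u = (SOME v. v \<in> T \<and> (u, rep u + v) \<in> ?C)" for u
  \<comment> \<open>Go back by \<open>vv u\<close> to the component of the representative, move
    there by the stabilising vector that the retraction assigns to \<open>vv u\<close>, and read off
    the colour. The next fact shows that any other admissible vector in place of \<open>vv u\<close>
    gives the same colour.\<close>
  define a' where "a' u = a (u - vv u + \<gamma> (rep u) (vv u))" for u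
  have a': "a' u = a (u - v + \<gamma> (rep u) v)" if u: "u \<in> V" and v: "v \<in> T" "(u, rep u + v) \<in> ?C" for u v
  proof -
    let ?p = "rep u" and ?v = "vv u"
    have vv: "?v \<in> T" "(u, ?p + ?v) \<in> ?C"
      unfolding vv_def using someI[of "\<lambda>v. v \<in> T \<and> (u, ?p + v) \<in> ?C"] v by blast+
    have "(?p + v, ?p + ?v) \<in> ?C" using rtrancl_trans[OF C_sym[OF v(2)] vv(2)] .
    from C_diff[OF this v(1)] have "?v - v \<in> St ?p"
      unfolding St_def using TD(2)[OF vv(1) v(1)] by (simp add: algebra_simps)
    from \<gamma>(2)[OF this, of v] have "\<gamma> ?p ?v = \<gamma> ?p v + (?v - v)" by simp
    then have "u - ?v + \<gamma> ?p ?v = u - v + \<gamma> ?p v" by simp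
    then show ?thesis unfolding a'_def by (rule arg_cong)
  qed
  have valid: "\<exists>v\<in>T. (u, rep u + v) \<in> ?C" if "u \<in> V" for u
    using rep[OF that] by (auto simp: cl_def)
  have a'_flip: "a' u' = 1 - a' u" if uu': "(u, u') \<in> E" for u u'
  proof -
    have V: "u \<in> V" "u' \<in> V" using uu' by (auto simp: E_def)
    obtain v where v: "v \<in> T" "(u, rep u + v) \<in> ?C" using valid[OF V(1)] by blast
    have rep_eq: "rep u' = rep u" using cl_eq[of u u' 0] r_into_rtrancl[OF uu'] TD(1) by (simp add: rep_def)
    have v': "(u', rep u' + v) \<in> ?C"
      using rtrancl_trans[OF C_sym[OF r_into_rtrancl[OF uu']] v(2)] rep_eq by simp
    have "\<gamma> (rep u) v - v \<in> T" using \<gamma>(1)[of "rep u" v] v(1) TD(2) by (auto simp: St_def)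
    from E_flip[OF E_shift[OF uu' this]] show ?thesis
      unfolding a'[OF V(1) v] a'[OF V(2) v(1) v'] rep_eq by (simp add: algebra_simps)
  qed
  \<comment> \<open>\<open>N\<close> brings the shift into \<open>T\<close>, \<open>Q\<close> is a
    common multiple of the retraction constants of the finitely many representatives, and 2 makes
    the retraction move by a doubled stabiliser element, which preserves colours.\<close>
  have a'_per: "a' (u + of_nat (N * (2 * Q)) * g) = a' u" if u: "u \<in> V" and g: "g \<in> L" for u g
  proof -
    let ?t = "of_nat (N * (2 * Q)) * g" and ?p = "rep u"
    have t_eq: "?t = of_nat N * (of_nat (2 * Q) * g)" by (simp add: mult.assoc)
    have t: "?t \<in> T" unfolding t_eq T_def using add_subgroup_of_nat_mult[OF L g] by blast
    obtain v where v: "v \<in> T" "(u, ?p + v) \<in> ?C" using valid[OF u] by blast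
    have rep_eq: "rep (u + ?t) = ?p" using cl_eq[of "u + ?t" u ?t] t by (simp add: rep_def)
    have v': "(u + ?t, rep (u + ?t) + (v + ?t)) \<in> ?C"
      using C_shift[OF v(2) t] rep_eq by (simp add: add.assoc)
    obtain c where c: "Q = M ?p * c"
      using dvd_prodI[OF fin_rep, of ?p M] u unfolding Q_def by (auto elim: dvdE)
    obtain h where h: "h \<in> St ?p"
      "\<And>z n. \<gamma> ?p (z + of_nat (M ?p * n) * (of_nat N * g)) = \<gamma> ?p z + of_nat n * h"
      using \<gamma>M by blast
    let ?w = "of_nat c * h"
    have "?t = of_nat (M ?p * (c + c)) * (of_nat N * g)" unfolding c by (simp add: algebra_simps)
    then have "\<gamma> ?p (v + ?t) = \<gamma> ?p v + (?w + ?w)" using h(2)[of v "c + c"] by (simp add: algebra_simps)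
    then have "a' (u + ?t) = a (u - v + \<gamma> ?p v + (?w + ?w))"
      using a'[OF VT[OF u t] TD(4)[OF v(1) t] v'] rep_eq by (simp add: algebra_simps)
    also have "\<dots> = a (u - v + \<gamma> ?p v)"
    proof (rule double)
      have "(?p, u - v) \<in> ?C" using C_sym[OF C_diff[OF v(2,1)]] by simp
      then show "(?p, u - v + \<gamma> ?p v) \<in> ?C" using \<gamma>(1) by (rule St_C)
      show "?w \<in> St ?p" by (rule add_subgroup_of_nat_mult[OF St h(1)])
    qed
    finally show ?thesis using a'[OF u v] by simp
  qed
  define B where "B = {u \<in> L. H u = 2 \<or> (H u = 1 \<and> a' u = 1)}"
  show ?thesis
  proof (rule periodic_tile_of_subgroup[OF L FL, of "N * (2 * Q)" B])
    show "N * (2 * Q) > 0" using N Q by simp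
    show "x + of_nat (N * (2 * Q)) * g \<in> B" if "x \<in> L" "g \<in> L" "x \<in> B" for x g
    proof -
      let ?t = "of_nat (N * (2 * Q)) * g"
      have "?t = of_nat N * (of_nat (2 * Q) * g)" by (simp add: mult.assoc)
      then have t: "?t \<in> T" unfolding T_def using add_subgroup_of_nat_mult[OF L that(2)] by blast
      have "x + ?t \<in> L" using add_subgroupD(4)[OF L that(1)] t TL by blast
      moreover have "H (x + ?t) = H x" by (rule perT[OF t])
      moreover have "a' (x + ?t) = a' x" if "H x = 1"
        using a'_per[of x g] \<open>x \<in> L\<close> \<open>g \<in> L\<close> that by (simp add: V_def)
      ultimately show ?thesis using that(3) unfolding B_def by auto
    qed
    show "\<exists>!f. f \<in> F \<and> x - f \<in> B" if x: "x \<in> L" for x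
    proof -
      have B0: "H y \<noteq> 0" if "y \<in> B" for y using that by (auto simp: B_def)
      have xf: "x - f \<in> L" if "f \<in> F" for f using add_subgroupD(2)[OF L x] FL that by blast
      have "\<exists>f\<in>F. H (x - f) \<noteq> 0"
      proof (rule ccontr)
        assume "\<not> ?thesis"
        then have "(\<Sum>f\<in>F. H (x - f)) = 0" by (intro sum.neutral) auto
        then show False using H by simp
      qed
      then obtain f where f: "f \<in> F" "H (x - f) \<noteq> 0" by blast
      have rest: "(\<Sum>h\<in>F - {f}. H (x - h)) = 2 - H (x - f)"
        using sum.remove[OF fin f(1), of "\<lambda>h. H (x - h)"] H[of x] by simp
      have nn: "H y \<ge> 0" for y using H012[of y] by auto
      show ?thesis
      proof (cases "H (x - f) = 2")
        case True
        have "\<forall>h\<in>F - {f}. H (x - h) = 0"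
          using True rest sum_nonneg_eq_0_iff[of "F - {f}" "\<lambda>h. H (x - h)"] fin nn by simp
        then have z: "H (x - h) = 0" if "h \<in> F" "h \<noteq> f" for h using that by blast
        show ?thesis
        proof (rule ex1I[of _ f])
          show "f \<in> F \<and> x - f \<in> B" using f True xf by (simp add: B_def)
          show "h = f" if "h \<in> F \<and> x - h \<in> B" for h using that B0 z by blast
        qed
      next
        case False
        then have f1: "H (x - f) = 1" using H012[of "x - f"] f(2) by auto
        have "\<exists>g\<in>F - {f}. H (x - g) \<noteq> 0"
        proof (rule ccontr)
          assume "\<not> ?thesis"
          then have "(\<Sum>f\<in>F - {f}. H (x - f)) = 0" by (intro sum.neutral) auto
          then show False using rest f1 by simp
        qed
        then obtain g where g: "g \<in> F" "g \<noteq> f" "H (x - g) \<noteq> 0" by blast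
        have "H (x - g) \<le> (\<Sum>h\<in>F - {f}. H (x - h))"
          using g fin nn by (intro member_le_sum) auto
        then have g1: "H (x - g) = 1" using rest f1 g(3) H012[of "x - g"] by auto
        have oth: "H (x - h) = 0" if "h \<in> F" "h \<noteq> f" "h \<noteq> g" for h
          using Hother[OF f(1) g(1) _ that, of x] g(2) f1 g1 by auto
        have "x - f \<in> V" "x - g \<in> V" using f1 g1 xf[OF f(1)] xf[OF g(1)] by (auto simp: V_def)
        moreover have "x - g - (x - f) = f - g" by simp
        ultimately have "(x - f, x - g) \<in> E"
          unfolding E_def mem_Collect_eq case_prod_conv using f(1) g(1,2) by metis
        then have fl: "a' (x - g) = 1 - a' (x - f)" by (rule a'_flip)
        have "a' (x - f) = 0 \<or> a' (x - f) = 1" unfolding a'_def by (rule a01)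
        then have "(x - f \<in> B \<and> x - g \<notin> B) \<or> (x - g \<in> B \<and> x - f \<notin> B)"
          using fl f1 g1 xf[OF f(1)] xf[OF g(1)] by (auto simp: B_def)
        moreover have "h = f \<or> h = g" if "h \<in> F" "x - h \<in> B" for h
          using that B0 oth by blast
        ultimately show ?thesis using f(1) g(1) by metis
      qed
    qed
  qed
qed

section \<open>Periodicity of the dilated count\<close>

lemma tile_dilate_complex:
  fixes F :: "'a::ring_1 set" and a :: "'a \<Rightarrow> int"
  assumes "finite F" "coprime r (card F)" "r > 0" "\<And>x. a x = 0 \<or> a x = 1" "\<And>x. (\<Sum>f\<in>F. a (x - f)) = 1"
  shows "(\<Sum>f\<in>F. complex_of_int (a (x - of_nat r * f))) = 1"
proof -
  have "a x \<ge> 0" for x using assms(4)[of x] by auto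
  then have "(\<Sum>f\<in>F. a (x - of_nat r * f)) = 1"
    using tiling_dilate[OF assms(1-3), of a "\<lambda>f. f" x] assms(5) by (simp add: translate_sum_def)
  then show ?thesis by (metis of_int_1 of_int_sum)
qed

text \<open>The spectrum of \<open>h\<close> only contains the types with two blocks of size \<open>q\<close>: on the types made of
  antipodal pairs the sum defining \<open>h\<close> vanishes.\<close>

lemma dilated_count_periodic:
  fixes F :: "(int ^ 'd::finite) set" and a :: "int ^ 'd \<Rightarrow> int"
  assumes npt: "\<not> periodic_tile F" and fin: "finite F" and F0: "0 \<in> F"
    and q: "prime q" "odd q" and card: "card F = 2 * q"
    and a01: "\<And>x. a x = 0 \<or> a x = 1" and tile: "\<And>x. (\<Sum>f\<in>F. a (x - f)) = 1"
  obtains M where "odd (M::nat)"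
    "\<And>f g x. f \<in> F \<Longrightarrow> g \<in> F \<Longrightarrow> (\<Sum>h\<in>F. a (x - of_nat (q * M) * (f - g) - of_nat (q * M) * h)) =
      (\<Sum>h\<in>F. a (x - of_nat (q * M) * h))"
proof -
  have q0: "q > 0" using q(1) prime_gt_0_nat by blast
  define good where "good k S \<longleftrightarrow> odd k \<and> (\<forall>f\<in>F. \<forall>g\<in>F. of_nat k * (f - g) \<in> part_grp {S, F - S})"
    for k :: nat and S
  \<comment> \<open>The odd constant for each potential first block \<open>S\<close>, or 1 if there
    is none. The block is found only after the period has been fixed, so \<open>M\<close> must serve
    all subsets at once.\<close>
  define K where "K S = (if \<exists>k. good k S then SOME k. good k S else 1)" for S
  have K: "good (K S) S" if "good k S" for k S
    using that unfolding K_def by (auto intro: someI)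
  have Kodd: "odd (K S)" for S
  proof (cases "\<exists>k. good k S")
    case True
    then have "good (K S) S" using K by blast
    then show ?thesis by (simp add: good_def)
  next
    case False
    then show ?thesis by (simp add: K_def)
  qed
  define M where "M = (\<Prod>S\<in>Pow F. K S)"
  have M: "odd M" unfolding M_def using Kodd fin by (simp add: even_prod_iff)
  define m where "m = q * M"
  let ?a = "\<lambda>x. complex_of_int (a x)"
  define y where "y x = (\<Sum>h\<in>F. ?a (x - of_nat m * h))" for x
  have "y (x - of_nat m * (f - g)) = y x" if fg: "f \<in> F" "g \<in> F" for f g x
  proof (rule ccontr)
    assume neq: "\<not> ?thesis"
    define w where "w = of_nat m * (f - g)"
    define D where "D x = ?a (x - w) - ?a x" for x
    \<comment> \<open>\<open>D\<close> is a difference of two tilings, hence killed by all dilates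
      coprime to \<open>2q\<close>. Writing the increment of \<open>y\<close> as a convolution of
      \<open>D\<close> supplies the bounded preimage for the second case.\<close>
    have \<phi>: "(\<lambda>x. y (x - w) - y x) = (\<lambda>x. \<Sum>h\<in>F. D (x - of_nat m * h))"
      unfolding y_def D_def sum_subtractf by (simp add: algebra_simps)
    have bdd_a: "bounded (range ?a)"
    proof -
      have "norm (?a x) \<le> 1" for x using a01[of x] by auto
      then show ?thesis by (auto simp: bounded_iff)
    qed
    have bdd_y: "bounded (range y)"
    proof -
      have "norm (y x) \<le> real (card F) * 1" for x
        unfolding y_def using a01 by (intro sum_norm_bound) (metis norm_one norm_zero of_int_0 of_int_1 order_refl zero_le_one)
      then show ?thesis by (auto simp: bounded_iff)
    qed
    have D_ann: "(\<Sum>g\<in>F. D (x - of_nat r * g)) = 0" if "r > 0" "coprime r (2 * q)" for r x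
      using tile_dilate_complex[OF fin _ that(1) a01 tile, of x] that(2) card
        tile_dilate_complex[OF fin _ that(1) a01 tile, of "x - w"]
      unfolding D_def sum_subtractf by (simp add: algebra_simps)
    obtain \<psi> where \<psi>: "\<psi> \<in> shift_span (\<lambda>x. y (x - w) - y x)" "\<psi> \<noteq> (\<lambda>_. 0)"
      and vanish: "\<And>g r. g \<in> F \<Longrightarrow> r > 0 \<Longrightarrow> coprime r (2 * q) \<Longrightarrow>
        (\<Sum>f | f \<in> F \<and> related (2 * q) \<psi> f g. eig \<psi> (f - g) ^ r) = 0"
    proof (rule terminal_vector[OF fin, of "2 * q" "\<lambda>x. y (x - w) - y x"])
      show "2 * q > 0" using q0 by simp
      show "(\<lambda>x. y (x - w) - y x) \<noteq> (\<lambda>_. 0)"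
        using neq unfolding w_def by (metis eq_iff_diff_eq_0)
      show "(\<Sum>f\<in>F. y (x - of_nat r * f - w) - y (x - of_nat r * f)) = 0"
        if "r > 0" "coprime r (2 * q)" for r x
      proof -
        have "(\<Sum>f\<in>F. y (x - of_nat r * f - w) - y (x - of_nat r * f)) =
            (\<Sum>f\<in>F. \<Sum>h\<in>F. D (x - of_nat r * f - of_nat m * h))"
          using fun_cong[OF \<phi>] by simp
        also have "\<dots> = (\<Sum>h\<in>F. \<Sum>f\<in>F. D ((x - of_nat m * h) - of_nat r * f))"
          by (subst sum.swap) (simp add: algebra_simps)
        finally show ?thesis using D_ann[OF that] by simp
      qed
    qed blast
    show False
    proof (cases "\<exists>g\<in>F. (\<Sum>f | f \<in> F \<and> related (2 * q) \<psi> f g. eig \<psi> (f - g) ^ q) \<noteq> 0")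
      case True
      then obtain g0 where g0: "g0 \<in> F"
        "(\<Sum>f | f \<in> F \<and> related (2 * q) \<psi> f g0. eig \<psi> (f - g0) ^ q) \<noteq> 0" by blast
      have "classes_vanish (2 * q) \<psi> F" using vanish by (auto simp: classes_vanish_def)
      from two_blocks[OF \<psi>(2) fin q card this g0]
      obtain S where S: "S \<subseteq> F" "block q \<psi> S" "block q \<psi> (F - S)" .
      obtain k :: nat where
        "odd k" "\<And>f g. f \<in> F \<Longrightarrow> g \<in> F \<Longrightarrow> of_nat k * (f - g) \<in> part_grp {S, F - S}"
        by (rule odd_relation[OF npt fin F0 \<psi>(2) S q0]) blast
      then have "good k S" unfolding good_def by blast
      then have KS: "good (K S) S" by (rule K)
      have "K S dvd M" unfolding M_def using S(1) fin by (intro dvd_prodI) auto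
      then obtain c where c: "M = c * K S" by (metis dvdE mult.commute)
      have "of_nat c * (of_nat (K S) * (f - g)) \<in> part_grp {S, F - S}"
        by (rule add_subgroup_of_nat_mult[OF add_subgroup_part_grp]) (use KS fg in \<open>auto simp: good_def\<close>)
      then have Mfg: "of_nat M * (f - g) \<in> part_grp {S, F - S}" by (simp add: c mult.assoc)
      have bl: "block q \<psi> T" if "T \<in> {S, F - S}" for T using that S by auto
      have e: "of_nat M * (f - g) \<in> eigs \<psi>" "eig \<psi> (of_nat M * (f - g)) ^ q = 1"
        using part_grp_eig[OF \<psi>(2) bl Mfg] by auto
      \<comment> \<open>\<open>M (f - g)\<close> acts by a \<open>q\<close>-th root of unity; the
        factor \<open>q\<close> in \<open>m\<close> therefore makes \<open>w\<close> act trivially,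
        against boundedness of \<open>y\<close>.\<close>
      have w: "w = of_nat q * (of_nat M * (f - g))" by (simp add: w_def m_def mult.assoc)
      have "\<psi> (x - w) = \<psi> x" for x
        using eigD[OF \<psi>(2) eig_of_nat_mult(1)[OF \<psi>(2) e(1)], of x q]
          eig_of_nat_mult(2)[OF \<psi>(2) e(1), of q] e(2) by (simp add: w)
      from periodic_difference_eq_0[OF bdd_y \<psi>(1) this] show False using \<psi>(2) by simp
    next
      case False
      \<comment> \<open>Now all classes have vanishing \<open>q\<close>-th power sums. With a
        preimage that shares the eigenvalues of \<open>\<psi>\<close>, each class sum at dilation
        \<open>m\<close> becomes such a power sum: the \<open>q\<close>-th power of an eigenvalue is
        a sign and \<open>M\<close> is odd, so its \<open>m\<close>-th and \<open>q\<close>-th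
        powers agree. Thus \<open>\<psi>\<close> would vanish.\<close>
      from \<psi>(1) obtain u where u: "u \<in> shift_span D" "\<psi> = (\<lambda>x. \<Sum>h\<in>F. u (x - of_nat m * h))"
        unfolding \<phi> by (rule shift_span_image)
      have bdd_u: "bounded (range u)"
      proof (rule shift_span_bounded)
        have "norm (D x) \<le> 1" for x using a01[of x] a01[of "x - w"] by (auto simp: D_def)
        then show "bounded (range D)" by (auto simp: bounded_iff)
      qed (rule u(1))
      let ?P = "{p \<in> F \<times> F. related (2 * q) \<psi> (fst p) (snd p)}"
      have "finite ?P" by (rule finite_subset[OF _ finite_cartesian_product[OF fin fin]]) blast
      from finite_list[OF this] obtain ps where ps: "set ps = ?P" by (elim exE)
      define vs where "vs = map (\<lambda>(f, g). (f - g, eig \<psi> (f - g))) ps"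
      obtain u' where u': "\<psi> = (\<lambda>x. \<Sum>h\<in>F. u' (x - of_nat m * h))"
        "\<And>v z x. (v, z) \<in> set vs \<Longrightarrow> u' (x - v) = z * u' x"
      proof (rule averaging_list[OF bdd_u u(2), of vs])
        fix v z assume "(v, z) \<in> set vs"
        then obtain f g where "f \<in> F" "g \<in> F" "related (2 * q) \<psi> f g" "v = f - g" "z = eig \<psi> (f - g)"
          by (auto simp: vs_def ps)
        then show "norm z = 1 \<and> (\<forall>x. \<psi> (x - v) = z * \<psi> x)"
          using norm_eig[OF \<psi>(2), of v "2 * q"] eigD[OF \<psi>(2), of v] q0 by (auto simp: related_def)
      qed blast
      have "\<psi> x = 0" for x
        unfolding u'(1)
      proof (rule sum_over_classes[OF \<psi>(2) fin])
        fix g assume g: "g \<in> F"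
        have pw: "u' (x - of_nat n * v) = z ^ n * u' x" if "(v, z) \<in> set vs" for v z n x
        proof (induction n)
          case (Suc n)
          then show ?case using u'(2)[OF that, of "x - of_nat n * v"] by (simp add: algebra_simps)
        qed simp
        have *: "u' (x - of_nat m * f) = eig \<psi> (f - g) ^ q * u' (x - of_nat m * g)"
          if f: "f \<in> F" "related (2 * q) \<psi> f g" for f
        proof -
          have "(f - g, eig \<psi> (f - g)) \<in> set vs" using f g by (force simp: vs_def ps)
          from pw[OF this, of "x - of_nat m * g" m]
          have "u' (x - of_nat m * f) = eig \<psi> (f - g) ^ m * u' (x - of_nat m * g)"
            by (simp add: algebra_simps)
          also have "eig \<psi> (f - g) ^ m = (eig \<psi> (f - g) ^ q) ^ M" by (simp add: m_def power_mult)
          also have "\<dots> = eig \<psi> (f - g) ^ q"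
          proof -
            have "(eig \<psi> (f - g) ^ q)\<^sup>2 = 1" using f(2) by (simp add: related_def mult.commute flip: power_mult)
            then have "eig \<psi> (f - g) ^ q = 1 \<or> eig \<psi> (f - g) ^ q = - 1" by (simp add: power2_eq_1_iff)
            then show ?thesis using M by auto
          qed
          finally show ?thesis .
        qed
        then have "(\<Sum>f | f \<in> F \<and> related (2 * q) \<psi> f g. u' (x - of_nat m * f)) =
          (\<Sum>f | f \<in> F \<and> related (2 * q) \<psi> f g. eig \<psi> (f - g) ^ q) * u' (x - of_nat m * g)"
          by (simp add: sum_distrib_right)
        then show "(\<Sum>f | f \<in> F \<and> related (2 * q) \<psi> f g. u' (x - of_nat m * f)) = 0"
          using False g by auto
      qed
      then show False using \<psi>(2) by auto
    qed
  qed
  moreover have "y x = of_int (\<Sum>h\<in>F. a (x - of_nat m * h))" for x by (simp add: y_def)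
  ultimately have "(\<Sum>h\<in>F. a (x - of_nat m * (f - g) - of_nat m * h)) = (\<Sum>h\<in>F. a (x - of_nat m * h))"
    if "f \<in> F" "g \<in> F" for f g x
    using that by (simp only: of_int_eq_iff)
  then show ?thesis using that[OF M] by (simp add: m_def)
qed

lemma periodic_tile_2q:
  fixes F :: "(int ^ 'd::finite) set" and a :: "int ^ 'd \<Rightarrow> int"
  assumes fin: "finite F" and F0: "0 \<in> F"
    and q: "prime q" "odd q" and card: "card F = 2 * q"
    and a01: "\<And>x. a x = 0 \<or> a x = 1" and tile: "\<And>x. (\<Sum>f\<in>F. a (x - f)) = 1"
  shows "periodic_tile F"
proof (rule ccontr)
  assume npt: "\<not> periodic_tile F"
  have q0: "q > 0" using q(1) prime_gt_0_nat by blast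
  obtain M where M: "odd (M::nat)"
    "\<And>f g x. f \<in> F \<Longrightarrow> g \<in> F \<Longrightarrow> (\<Sum>h\<in>F. a (x - of_nat (q * M) * (f - g) - of_nat (q * M) * h)) =
      (\<Sum>h\<in>F. a (x - of_nat (q * M) * h))"
    by (rule dilated_count_periodic[OF npt fin F0 q card a01 tile]) blast
  define m where "m = q * M"
  have m0: "m > 0" using q0 M(1) odd_pos by (auto simp: m_def)
  define h where "h x = (\<Sum>f\<in>F. a (x - of_nat m * f))" for x
  have nn: "a x \<ge> 0" for x using a01[of x] by auto
  \<comment> \<open>Factors \<open>q\<close> of \<open>n\<close> are stripped by
    \<open>translate_sum_dvd_dilate\<close>. Once \<open>q\<close> does not divide \<open>n\<close>,
    the dilate \<open>n F\<close> tiles, its \<open>q\<close>-fold iterated sum is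
    \<open>card F ^ (q - 1)\<close>, and Frobenius transfers divisibility to the dilate by
    \<open>q n\<close>.\<close>
  have dvd: "int q dvd translate_sum F (\<lambda>f. of_nat (q * n) * f) a x" if "odd n" for n x
    using that
  proof (induction n arbitrary: x rule: less_induct)
    case (less n)
    show ?case
    proof (cases "q dvd n")
      case True
      then obtain n' where n': "n = q * n'" by blast
      then have "n' < n" "odd n'" using less.prems prime_gt_1_nat[OF q(1)] by (auto intro: odd_pos)
      then have "int q dvd translate_sum F (\<lambda>f. of_nat (q * n') * f) a x" for x using less.IH by blast
      from translate_sum_dvd_dilate[OF fin q(1) this] show ?thesis by (simp add: n' mult.assoc)
    next
      case False
      then have "coprime n q" using prime_imp_coprime[OF q(1)] by (simp add: ac_simps)
      then have "coprime n (card F)" "n > 0"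
        using less.prems card by (auto intro: odd_pos)
      from tiling_dilate[OF fin this, of a "\<lambda>f. f"]
      have "translate_sum F (\<lambda>f. of_nat n * f) a x = 1" for x
        using nn tile by (simp add: translate_sum_def)
      then have t: "translate_sum F (\<lambda>f. of_nat n * f) a = (\<lambda>_. 1)" by auto
      \<comment> \<open>The iterated sum loses one factor of \<open>card F\<close>; \<open>q\<close>
        at least 2 guarantees that one remains.\<close>
      obtain j where j: "q = Suc (Suc j)" using prime_gt_1_nat[OF q(1)] that[of "q - 2"] by simp
      have "(translate_sum F (\<lambda>f. of_nat n * f) ^^ q) a x = int (card F) ^ Suc j"
        using translate_sum_pow_const[OF fin, of "\<lambda>f. of_nat n * f" a 1 "Suc j" x] t by (simp add: j)
      then have "int q dvd (translate_sum F (\<lambda>f. of_nat n * f) ^^ q) a x" by (simp add: card)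
      then show ?thesis
        using translate_sum_frobenius[OF fin q(1), of "\<lambda>f. of_nat n * f" a x]
        by (simp add: cong_dvd_iff mult.assoc)
    qed
  qed
  have hq: "int q dvd h x" for x using dvd[OF M(1), of x] by (simp add: translate_sum_def h_def m_def)
  have h_le: "h x \<le> 2 * int q" "h x \<ge> 0" for x
  proof -
    have "h x \<le> (\<Sum>f\<in>F. 1)" unfolding h_def by (intro sum_mono) (metis a01 order_refl zero_le_one)
    then show "h x \<le> 2 * int q" by (simp add: card)
    show "h x \<ge> 0" unfolding h_def by (intro sum_nonneg nn)
  qed
  define H where "H x = h x div int q" for x
  have hH: "h x = int q * H x" for x using hq[of x] by (simp add: H_def)
  have H012: "H x = 0 \<or> H x = 1 \<or> H x = 2" for x
  proof -
    have "int q * H x \<le> int q * 2" "int q * 0 \<le> int q * H x" using h_le[of x] hH[of x] by auto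
    then have "H x \<le> 2" "0 \<le> H x" using q0 by (auto simp: zero_le_mult_iff)
    then show ?thesis by linarith
  qed
  have h_per: "h (x - of_nat m * f) = h x" if "f \<in> F" for f x
    using M(2)[OF that F0, of x] by (simp add: h_def m_def)
  have h_per': "h (x + of_nat m * g) = h x" if "g \<in> grp F" for x g
    using that
  proof (induction arbitrary: x)
    case (add g f)
    then show ?case using h_per[OF add.hyps(2), of "x + of_nat m * (g + f)"] by (simp add: algebra_simps)
  next
    case (diff g f)
    then show ?case using h_per[OF diff.hyps(2), of "x + of_nat m * g"] by (simp add: algebra_simps)
  qed simp
  show False
  proof (rule notE[OF npt], rule periodic_tile_of_double_cover[OF fin m0 a01 tile H012])
    show "(\<Sum>f\<in>F. H (x - f)) = 2" for x
    proof -
      have "int q * (\<Sum>f\<in>F. H (x - f)) = (\<Sum>f\<in>F. \<Sum>g\<in>F. a (x - f - of_nat m * g))"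
        by (simp add: sum_distrib_left hH[symmetric] h_def)
      also have "\<dots> = (\<Sum>g\<in>F. \<Sum>f\<in>F. a ((x - of_nat m * g) - f))"
        by (subst sum.swap) (simp add: algebra_simps)
      also have "\<dots> = int q * 2" by (simp add: tile card)
      finally show ?thesis using q0 by simp
    qed
    \<comment> \<open>As \<open>0 \<in> F\<close>, the value \<open>a x\<close> is itself a summand
      of \<open>h x\<close>.\<close>
    show "a x = 0" if "H x = 0" for x
    proof -
      have "h x = 0" using that hH by simp
      then have "\<forall>f\<in>F. a (x - of_nat m * f) = 0"
        unfolding h_def using sum_nonneg_eq_0_iff[OF fin, of "\<lambda>f. a (x - of_nat m * f)"] nn by simp
      then show ?thesis using F0 by force
    qed
    show "H (x + of_nat m * g) = H x" if "g \<in> grp F" for x g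
      using h_per'[OF that] by (simp add: H_def)
  qed
qed

section \<open>Asymptotic pairs\<close>

definition real_vec :: "int ^ 'd \<Rightarrow> real ^ 'd" where
  "real_vec x = (\<chi> i. real_of_int (x $ i))"

lemma real_vec_add: "real_vec (x + y) = real_vec x + real_vec y"
  by (simp add: real_vec_def vec_eq_iff)

text \<open>Kept as a natural number, so that a set of lattice points has one of least norm.\<close>

definition sq_norm :: "int ^ 'd \<Rightarrow> nat" where
  "sq_norm x = nat (\<Sum>i\<in>UNIV. (x $ i)\<^sup>2)"

lemma norm_real_vec: "(norm (real_vec x))\<^sup>2 = real (sq_norm x)"
proof -
  have "(norm (real_vec x))\<^sup>2 = (\<Sum>i\<in>UNIV. (real_of_int (x $ i))\<^sup>2)"
    by (simp add: norm_vec_def L2_set_def sum_nonneg real_vec_def)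
  also have "\<dots> = real_of_int (\<Sum>i\<in>UNIV. (x $ i)\<^sup>2)" by simp
  also have "\<dots> = real (sq_norm x)" by (simp add: sq_norm_def sum_nonneg)
  finally show ?thesis .
qed

lemma finite_sq_norm_le: "finite {x :: int ^ 'd::finite. sq_norm x \<le> n}"
proof (rule finite_subset)
  show "{x :: int ^ 'd. sq_norm x \<le> n} \<subseteq> (\<lambda>f. \<chi> i. f i) ` (PiE UNIV (\<lambda>_. {- int n..int n}))"
  proof
    fix x :: "int ^ 'd" assume "x \<in> {x. sq_norm x \<le> n}"
    then have "(\<Sum>i\<in>UNIV. (x $ i)\<^sup>2) \<le> int n" by (simp add: sq_norm_def)
    moreover have "(x $ i)\<^sup>2 \<le> (\<Sum>i\<in>UNIV. (x $ i)\<^sup>2)" for i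
      by (rule member_le_sum) auto
    ultimately have *: "(x $ i)\<^sup>2 \<le> int n" for i by (meson order_trans)
    have "\<bar>x $ i\<bar> \<le> int n" for i
    proof (cases "x $ i = 0")
      case False
      then have "\<bar>x $ i\<bar> * 1 \<le> \<bar>x $ i\<bar> * \<bar>x $ i\<bar>" by (intro mult_left_mono) auto
      then show ?thesis using *[of i] by (simp add: power2_eq_square)
    qed simp
    then have "(\<lambda>i. x $ i) \<in> PiE UNIV (\<lambda>_. {- int n..int n})" by (auto simp: abs_le_iff minus_le_iff)
    moreover have "x = (\<chi> i. x $ i)" by (simp add: vec_eq_iff)
    ultimately show "x \<in> (\<lambda>f. \<chi> i. f i) ` (PiE UNIV (\<lambda>_. {- int n..int n}))" by blast
  qed
qed (intro finite_imageI finite_PiE, auto)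

lemma convergent_01_eventually_const:
  fixes s :: "nat \<Rightarrow> int"
  assumes "\<And>n. s n = 0 \<or> s n = 1" "(\<lambda>n. real_of_int (s n)) \<longlonglongrightarrow> l"
  obtains c where "\<forall>\<^sub>F n in sequentially. s n = c" "c = 0 \<or> c = 1"
proof -
  have "\<forall>\<^sub>F n in sequentially. dist (real_of_int (s n)) l < 1 / 2"
    using tendstoD[OF assms(2), of "1 / 2"] by simp
  then obtain N where N: "\<And>n. n \<ge> N \<Longrightarrow> \<bar>real_of_int (s n) - l\<bar> < 1 / 2"
    by (auto simp: eventually_sequentially dist_real_def)
  have "s n = s N" if "n \<ge> N" for n using N[OF that] N[OF order_refl] by linarith
  then have "\<forall>\<^sub>F n in sequentially. s n = s N" unfolding eventually_sequentially by blast
  then show ?thesis using that assms(1) by blast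
qed

text \<open>There are finitely many patterns on a ball. If the pattern determined the translate,
  then among the multiples \<open>0, g, ..., k g\<close>, with \<open>k\<close> the number of
  patterns, two would coincide, and \<open>fact k\<close> would give a common period for all
  \<open>g\<close>. So two distinct translates share a pattern; \<open>x\<close> is a point nearest
  the origin where they differ.\<close>

lemma distinct_translates_agreeing_on_ball:
  fixes a :: "int ^ 'd::finite \<Rightarrow> int"
  assumes G: "add_subgroup G" and a01: "\<And>x. a x = 0 \<or> a x = 1"
    and nonper: "\<And>N. N > 0 \<Longrightarrow> \<exists>x\<in>G. \<exists>g\<in>G. a (x + of_nat N * g) \<noteq> a x"
  obtains v v' x where "v \<in> G" "v' \<in> G" "x \<in> G" "a (x + v) \<noteq> a (x + v')" "sq_norm x > n"
    "\<And>b. b \<in> G \<Longrightarrow> sq_norm b < sq_norm x \<Longrightarrow> a (b + v) = a (b + v')"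
proof -
  note GD = add_subgroupD[OF G]
  define B where "B = {b \<in> G. sq_norm b \<le> n}"
  have B: "finite B" unfolding B_def
    by (rule finite_subset[OF _ finite_sq_norm_le[of n]]) auto
  let ?P = "PiE B (\<lambda>_. {0, 1 :: int})"
  have P: "finite ?P" using B by (intro finite_PiE) auto
  define pat where "pat v = restrict (\<lambda>b. a (b + v)) B" for v
  have pat: "pat v \<in> ?P" for v unfolding pat_def using a01 by auto
  have "\<exists>v\<in>G. \<exists>v'\<in>G. pat v = pat v' \<and> (\<exists>x\<in>G. a (x + v) \<noteq> a (x + v'))"
  proof (rule ccontr)
    assume "\<not> ?thesis"
    then have same: "a (x + v) = a (x + v')" if "v \<in> G" "v' \<in> G" "pat v = pat v'" "x \<in> G" for v v' x
      using that by blast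
    define k where "k = card ?P"
    have per: "a (x + of_nat (fact k) * g) = a x" if x: "x \<in> G" and g: "g \<in> G" for x g
    proof -
      have "\<not> inj_on (\<lambda>i. pat (of_nat i * g)) {0..k}"
      proof
        assume inj: "inj_on (\<lambda>i. pat (of_nat i * g)) {0..k}"
        have "card {0..k} \<le> card ?P" by (rule card_inj_on_le[OF inj _ P]) (use pat in auto)
        then show False by (simp add: k_def)
      qed
      then obtain i j where ij: "i < j" "j \<le> k" "pat (of_nat i * g) = pat (of_nat j * g)"
        unfolding inj_on_def by (metis atLeastAtMost_iff linorder_neqE_nat)
      have mem: "of_nat n * g \<in> G" for n by (rule add_subgroup_of_nat_mult[OF G g])
      have step: "a (y + of_nat (j - i) * g) = a y" if y: "y \<in> G" for y
      proof -
        have "a ((y - of_nat i * g) + of_nat i * g) = a ((y - of_nat i * g) + of_nat j * g)"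
          by (rule same[OF mem mem ij(3)]) (rule GD(2)[OF y mem])
        then show ?thesis using ij(1) by (simp add: of_nat_diff algebra_simps)
      qed
      have mult: "a (x + of_nat (c * (j - i)) * g) = a x" for c
      proof (induction c)
        case (Suc c)
        have "x + of_nat (Suc c * (j - i)) * g = (x + of_nat (c * (j - i)) * g) + of_nat (j - i) * g"
          by (simp only: mult_Suc of_nat_add distrib_right add_ac)
        then show ?case using step[OF GD(4)[OF x mem]] Suc by metis
      qed simp
      have "j - i dvd fact k" using ij by (intro dvd_fact) auto
      then obtain c where "fact k = (j - i) * c" by blast
      then have "fact k = c * (j - i)" by simp
      from mult[of c, folded this] show ?thesis .
    qed
    show False using nonper[of "fact k"] per by auto
  qed
  then obtain v v' where v: "v \<in> G" "v' \<in> G" "pat v = pat v'" "\<exists>x\<in>G. a (x + v) \<noteq> a (x + v')" by blast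
  define D where "D x \<longleftrightarrow> x \<in> G \<and> a (x + v) \<noteq> a (x + v')" for x
  have "\<exists>x. D x" using v(4) by (auto simp: D_def)
  then obtain x where x: "D x" and min: "\<And>y. D y \<Longrightarrow> sq_norm x \<le> sq_norm y"
    using ex_has_least_nat[of D _ sq_norm] by blast
  have "sq_norm x > n"
  proof (rule ccontr)
    assume "\<not> sq_norm x > n"
    then have "x \<in> B" using x by (auto simp: B_def D_def)
    then have "a (x + v) = a (x + v')" using fun_cong[OF v(3), of x] by (simp add: pat_def)
    then show False using x by (simp add: D_def)
  qed
  moreover have "a (b + v) = a (b + v')" if "b \<in> G" "sq_norm b < sq_norm x" for b
    using min[of b] that by (auto simp: D_def)
  ultimately show ?thesis using that v(1,2) x by (auto simp: D_def)
qed

text \<open>Translates that agree on a large ball but differ at a point of its boundary sphere converge,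
  seen from that point, to two functions that agree on a half-space.\<close>

lemma asymptotic_pair:
  fixes a :: "int ^ 'd::finite \<Rightarrow> int"
  assumes G: "add_subgroup G" and a01: "\<And>x. a x = 0 \<or> a x = 1"
    and nonper: "\<And>N. N > 0 \<Longrightarrow> \<exists>x\<in>G. \<exists>g\<in>G. a (x + of_nat N * g) \<noteq> a x"
  obtains \<nu> :: "int ^ 'd \<Rightarrow> real" and a0 a1 :: "int ^ 'd \<Rightarrow> int"
  where "\<And>x y. \<nu> (x + y) = \<nu> x + \<nu> y" "\<exists>x\<in>G. \<nu> x \<noteq> 0"
    "\<And>W. finite W \<Longrightarrow> \<exists>v. \<forall>x\<in>W. a0 x = a (x + v)" "\<And>W. finite W \<Longrightarrow> \<exists>v. \<forall>x\<in>W. a1 x = a (x + v)"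
    "\<And>x. x \<in> G \<Longrightarrow> \<nu> x < 0 \<Longrightarrow> a0 x = a1 x" "a0 0 \<noteq> a1 0"
proof -
  note GD = add_subgroupD[OF G]
  have "\<exists>v v' x. v \<in> G \<and> v' \<in> G \<and> x \<in> G \<and> a (x + v) \<noteq> a (x + v') \<and> sq_norm x > n \<and>
    (\<forall>b\<in>G. sq_norm b < sq_norm x \<longrightarrow> a (b + v) = a (b + v'))" for n
    by (rule distinct_translates_agreeing_on_ball[OF G a01 nonper, of n]) blast+
  then obtain v v' X where X: "\<And>n. X n \<in> G" "\<And>n. a (X n + v n) \<noteq> a (X n + v' n)" "\<And>n. sq_norm (X n) > n"
    and agree: "\<And>n b. b \<in> G \<Longrightarrow> sq_norm b < sq_norm (X n) \<Longrightarrow> a (b + v n) = a (b + v' n)"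
    by metis
  let ?r = "\<lambda>n. norm (real_vec (X n))"
  have r_pos: "?r n > 0" for n using X(3)[of n] norm_real_vec[of "X n"] by (metis gr_implies_not0 norm_eq_zero norm_ge_zero of_nat_0_eq_iff order_le_less power_zero_numeral)
  define U where "U n = (1 / ?r n) *\<^sub>R real_vec (X n)" for n
  have U1: "norm (U n) = 1" for n using r_pos[of n] by (simp add: U_def)
  \<comment> \<open>Three bounded families in one, so that a single subsequence makes both
    translates and the directions \<open>U n\<close> converge. The divisor \<open>1 + norm\<close>
    brings the third family below 1.\<close>
  define f where "f n = (\<lambda>(y, t :: nat). if t = 0 then real_of_int (a (y + X n + v n))
    else if t = 1 then real_of_int (a (y + X n + v' n))
    else (U n \<bullet> real_vec y) / (1 + norm (real_vec y)))" for n
  have fb: "norm (f n p) \<le> 1" for n p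
  proof -
    obtain y t where p: "p = (y, t)" by force
    have "\<bar>U n \<bullet> real_vec y\<bar> \<le> norm (real_vec y)"
      using Cauchy_Schwarz_ineq2[of "U n" "real_vec y"] U1[of n] by simp
    then have "\<bar>U n \<bullet> real_vec y\<bar> / (1 + norm (real_vec y)) \<le> 1"
      by (subst divide_le_eq_1_pos) (auto intro: add_pos_nonneg)
    then show ?thesis unfolding f_def p
      using a01[of "y + X n + v n"] a01[of "y + X n + v' n"] by (auto simp: abs_of_nonneg)
  qed
  obtain k where k: "strict_mono (k :: nat \<Rightarrow> nat)"
    "\<And>p. p \<in> UNIV \<Longrightarrow> \<exists>l. (\<lambda>n. f (k n) p) \<longlonglongrightarrow> l"
    by (rule function_convergent_subsequence[of UNIV f 1, OF countableI_type]) (rule fb, blast)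
  have conv: "\<exists>l. (\<lambda>n. f (k n) (y, t)) \<longlonglongrightarrow> l" for y t using k(2) by blast
  have "\<exists>c. (\<forall>\<^sub>F n in sequentially. a (y + X (k n) + v (k n)) = c)" for y
    using conv[of y 0] convergent_01_eventually_const[of "\<lambda>n. a (y + X (k n) + v (k n))"] a01
    by (fastforce simp: f_def)
  then obtain a0 where a0: "\<And>y. \<forall>\<^sub>F n in sequentially. a (y + X (k n) + v (k n)) = a0 y" by metis
  have "\<exists>c. (\<forall>\<^sub>F n in sequentially. a (y + X (k n) + v' (k n)) = c)" for y
    using conv[of y 1] convergent_01_eventually_const[of "\<lambda>n. a (y + X (k n) + v' (k n))"] a01
    by (fastforce simp: f_def)
  then obtain a1 where a1: "\<And>y. \<forall>\<^sub>F n in sequentially. a (y + X (k n) + v' (k n)) = a1 y" by metis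
  have "\<exists>l. (\<lambda>n. U (k n) $ i) \<longlonglongrightarrow> l" for i
  proof -
    let ?e = "axis i 1 :: int ^ 'd"
    have e: "real_vec ?e = axis i 1" by (auto simp: real_vec_def axis_def vec_eq_iff)
    obtain l where "(\<lambda>n. f (k n) (?e, 2)) \<longlonglongrightarrow> l" using conv by blast
    \<comment> \<open>The axis vector has norm 1, so the divisor in \<open>f\<close> is 2.\<close>
    then have "(\<lambda>n. U (k n) $ i / 2) \<longlonglongrightarrow> l"
      by (simp add: f_def e inner_axis norm_axis_1)
    then have "(\<lambda>n. 2 * (U (k n) $ i / 2)) \<longlonglongrightarrow> 2 * l" by (intro tendsto_intros)
    then show ?thesis by auto
  qed
  then obtain u where u: "\<And>i. (\<lambda>n. U (k n) $ i) \<longlonglongrightarrow> u i" by metis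
  define u0 where "u0 = (\<chi> i. u i)"
  have Ulim: "(\<lambda>n. U (k n)) \<longlonglongrightarrow> u0" unfolding u0_def by (rule vec_tendstoI) (simp add: u)
  define \<nu> where "\<nu> x = u0 \<bullet> real_vec x" for x
  show ?thesis
  proof (rule that)
    show "\<nu> (x + y) = \<nu> x + \<nu> y" for x y by (simp add: \<nu>_def real_vec_add inner_add_right)
    \<comment> \<open>The limit \<open>u0\<close> of the directions is a unit vector in the closed
      real span of \<open>G\<close>, so it cannot be orthogonal to all of \<open>G\<close>.\<close>
    show "\<exists>x\<in>G. \<nu> x \<noteq> 0"
    proof (rule ccontr)
      assume "\<not> ?thesis"
      then have 0: "u0 \<bullet> z = 0" if "z \<in> real_vec ` G" for z using that by (auto simp: \<nu>_def)
      have "U n \<in> span (real_vec ` G)" for n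
        unfolding U_def using X(1) by (intro span_scale span_base) auto
      then have "u0 \<in> span (real_vec ` G)"
        using closed_sequentially[OF closed_span, of "\<lambda>n. U (k n)"] Ulim by blast
      moreover have "span (real_vec ` G) \<subseteq> {z. u0 \<bullet> z = 0}"
        by (rule span_minimal) (use 0 in \<open>auto simp: subspace_hyperplane\<close>)
      ultimately have "u0 \<bullet> u0 = 0" by blast
      moreover have "norm u0 = 1"
        using LIMSEQ_unique[OF tendsto_norm[OF Ulim]] U1 by simp
      ultimately show False by simp
    qed
    show "\<exists>w. \<forall>x\<in>W. a0 x = a (x + w)" if "finite W" for W
    proof -
      have "\<forall>\<^sub>F n in sequentially. \<forall>x\<in>W. a (x + X (k n) + v (k n)) = a0 x"
        using that a0 by (intro eventually_ball_finite) auto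
      then obtain n where "\<forall>x\<in>W. a (x + X (k n) + v (k n)) = a0 x"
        by (auto simp: eventually_sequentially)
      then show ?thesis by (intro exI[of _ "X (k n) + v (k n)"]) (simp add: add.assoc)
    qed
    show "\<exists>w. \<forall>x\<in>W. a1 x = a (x + w)" if "finite W" for W
    proof -
      have "\<forall>\<^sub>F n in sequentially. \<forall>x\<in>W. a (x + X (k n) + v' (k n)) = a1 x"
        using that a1 by (intro eventually_ball_finite) auto
      then obtain n where "\<forall>x\<in>W. a (x + X (k n) + v' (k n)) = a1 x"
        by (auto simp: eventually_sequentially)
      then show ?thesis by (intro exI[of _ "X (k n) + v' (k n)"]) (simp add: add.assoc)
    qed
    show "a0 0 \<noteq> a1 0"
    proof
      assume eq: "a0 0 = a1 0"
      have "\<forall>\<^sub>F n in sequentially. a (0 + X (k n) + v (k n)) = a (0 + X (k n) + v' (k n))"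
        using a0[of 0] a1[of 0] by eventually_elim (simp add: eq)
      then show False using X(2) by (auto simp: eventually_sequentially)
    qed
    show "a0 y = a1 y" if y: "y \<in> G" "\<nu> y < 0" for y
    proof -
      have "(\<lambda>n. U (k n) \<bullet> real_vec y) \<longlonglongrightarrow> \<nu> y"
        unfolding \<nu>_def by (intro tendsto_intros Ulim)
      then have 1: "\<forall>\<^sub>F n in sequentially. U (k n) \<bullet> real_vec y < \<nu> y / 2"
        using y(2) by (intro order_tendstoD) auto
      \<comment> \<open>For norms of \<open>X\<close> beyond this bound, the negative linear term in
        the squared norm of \<open>y + X\<close> outweighs the squared norm of \<open>y\<close>.
        Then \<open>y + X\<close> is closer to the origin than \<open>X\<close>, where the two
        translates agree.\<close>
      obtain n0 :: nat where n0: "real n0 > ((norm (real_vec y))\<^sup>2 / (- \<nu> y))\<^sup>2"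
        using reals_Archimedean2 by blast
      have 2: "\<forall>\<^sub>F n in sequentially. n \<ge> n0" by (rule eventually_ge_at_top)
      have "\<forall>\<^sub>F n in sequentially. a (y + X (k n) + v (k n)) = a (y + X (k n) + v' (k n))"
        using 1 2
      proof eventually_elim
        case (elim n)
        let ?x = "X (k n)" and ?s = "norm (real_vec (X (k n)))"
        have "real n0 \<le> real (k n)" using elim(2) seq_suble[OF k(1), of n] by simp
        also have "\<dots> < ?s\<^sup>2" using X(3)[of "k n"] by (simp add: norm_real_vec)
        finally have "((norm (real_vec y))\<^sup>2 / (- \<nu> y))\<^sup>2 < ?s\<^sup>2" using n0 by simp
        then have "(norm (real_vec y))\<^sup>2 / (- \<nu> y) < ?s"
          by (rule power2_less_imp_less) simp
        then have b: "(norm (real_vec y))\<^sup>2 < - \<nu> y * ?s"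
          using y(2) by (subst (asm) pos_divide_less_eq) (auto simp: mult.commute)
        have "real_vec y \<bullet> real_vec ?x = ?s * (U (k n) \<bullet> real_vec y)"
          using r_pos[of "k n"] by (simp add: U_def inner_commute)
        also have "\<dots> \<le> ?s * (\<nu> y / 2)" using elim(1) by (intro mult_left_mono) auto
        finally have c: "2 * (real_vec y \<bullet> real_vec ?x) \<le> \<nu> y * ?s"
          by (simp add: mult.commute)
        have "(norm (real_vec (y + ?x)))\<^sup>2 =
          (norm (real_vec y))\<^sup>2 + 2 * (real_vec y \<bullet> real_vec ?x) + ?s\<^sup>2"
          unfolding real_vec_add power2_norm_eq_inner
          by (simp add: inner_add_left inner_add_right inner_commute)
        then have "(norm (real_vec (y + ?x)))\<^sup>2 < ?s\<^sup>2" using b c by simp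
        then have "sq_norm (y + ?x) < sq_norm ?x" by (simp add: norm_real_vec)
        then show ?case using agree[OF GD(4)[OF y(1) X(1)]] by blast
      qed
      then have "\<forall>\<^sub>F n in sequentially. a0 y = a1 y"
        using a0[of y] a1[of y] by eventually_elim simp
      then show ?thesis by (auto simp: eventually_sequentially)
    qed
  qed
qed

section \<open>Vectors supported in a half space\<close>

lemma additive_real:
  fixes \<nu> :: "'a::ring_1 \<Rightarrow> real"
  assumes add: "\<And>x y. \<nu> (x + y) = \<nu> x + \<nu> y"
  shows "\<nu> 0 = 0" "\<nu> (- x) = - \<nu> x" "\<nu> (x - y) = \<nu> x - \<nu> y"
    "\<nu> (of_nat n * x) = of_nat n * \<nu> x" "\<nu> (of_int k * x) = of_int k * \<nu> x"
proof -
  show 0: "\<nu> 0 = 0" using add[of 0 0] by simp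
  show m: "\<nu> (- x) = - \<nu> x" for x using add[of x "- x"] 0 by simp
  show "\<nu> (x - y) = \<nu> x - \<nu> y" using add[of x "- y"] m[of y] by simp
  show n: "\<nu> (of_nat n * x) = of_nat n * \<nu> x" for n
    by (induction n) (simp_all add: 0 add algebra_simps)
  show "\<nu> (of_int k * x) = of_int k * \<nu> x"
  proof (cases "k \<ge> 0")
    case True
    then show ?thesis using n[of "nat k"] by simp
  next
    case False
    then have "of_int k * x = - (of_nat (nat (- k)) * x)" "real (nat (- k)) = - of_int k" by auto
    then show ?thesis using n[of "nat (- k)"] m by (simp del: of_nat_nat)
  qed
qed

definition one_sided :: "('a \<Rightarrow> real) \<Rightarrow> ('a \<Rightarrow> complex) \<Rightarrow> bool" where
  "one_sided \<nu> \<psi> \<longleftrightarrow> (\<exists>C. \<forall>x. \<nu> x < C \<longrightarrow> \<psi> x = 0)"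

lemma one_sided_shift_span:
  fixes \<nu> :: "'a::ring_1 \<Rightarrow> real"
  assumes add: "\<And>x y. \<nu> (x + y) = \<nu> x + \<nu> y" and "\<psi> \<in> shift_span \<phi>" and \<phi>: "one_sided \<nu> \<phi>"
  shows "one_sided \<nu> \<psi>"
  using assms(2)
proof induction
  case base
  show ?case by (rule \<phi>)
next
  case (add u v)
  obtain C D where "\<forall>x. \<nu> x < C \<longrightarrow> u x = 0" "\<forall>x. \<nu> x < D \<longrightarrow> v x = 0"
    using add.IH unfolding one_sided_def by blast
  then show ?case unfolding one_sided_def by (intro exI[of _ "min C D"]) auto
next
  case (scale u c)
  then show ?case unfolding one_sided_def by auto
next
  case (shift u v)
  then obtain C where "\<forall>x. \<nu> x < C \<longrightarrow> u x = 0" unfolding one_sided_def by blast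
  then show ?case unfolding one_sided_def
    by (intro exI[of _ "C + \<nu> v"]) (auto simp: additive_real[OF assms(1)])
qed

text \<open>Otherwise multiples of \<open>v\<close> or \<open>- v\<close> carry a nonzero value into
  the half-space where \<open>\<psi>\<close> vanishes, although eigenvalues are nonzero. In
  particular, related elements of \<open>F\<close> have the same value of
  \<open>\<nu>\<close>.\<close>

lemma one_sided_eig:
  fixes \<nu> :: "'a::ring_1 \<Rightarrow> real"
  assumes add: "\<And>x y. \<nu> (x + y) = \<nu> x + \<nu> y" and os: "one_sided \<nu> \<psi>" and \<psi>: "\<psi> \<noteq> (\<lambda>_. 0)"
    and v: "v \<in> eigs \<psi>"
  shows "\<nu> v = 0"
proof (rule ccontr)
  assume nz: "\<nu> v \<noteq> 0"
  obtain C where C: "\<And>x. \<nu> x < C \<Longrightarrow> \<psi> x = 0" using os unfolding one_sided_def by blast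
  obtain y where y: "\<psi> y \<noteq> 0" using \<psi> by blast
  define w where "w = (if \<nu> v > 0 then v else - v)"
  have w: "w \<in> eigs \<psi>" "\<nu> w > 0" using v nz eig_minus[OF \<psi> v] additive_real[OF add] by (auto simp: w_def)
  obtain n where n: "real n * \<nu> w > \<nu> y - C" using reals_Archimedean3[OF w(2)] by blast
  have "\<psi> (y - of_nat n * w) = eig \<psi> w ^ n * \<psi> y"
    using eigD[OF \<psi> eig_of_nat_mult(1)[OF \<psi> w(1)]] eig_of_nat_mult(2)[OF \<psi> w(1)] by metis
  moreover have "\<psi> (y - of_nat n * w) = 0" using n by (intro C) (simp add: additive_real[OF add])
  ultimately show False using y eig_nonzero[OF \<psi> w(1)] by simp
qed

section \<open>Decompositions into three blocks\<close>

lemma coprime_less_prime: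
  assumes "prime p" "0 < r" "r < p"
  shows "coprime r (p::nat)"
  using prime_imp_coprime[OF assms(1), of r] assms nat_dvd_not_less[of r p] by (auto simp: coprime_commute)

text \<open>All exponents below the prime \<open>p\<close> are coprime to it, so each class takes
  every \<open>p\<close>-th root of unity; one element for each root forms a block.\<close>

lemma vanishing_class_contains_block:
  fixes \<psi> :: "'a::ring_1 \<Rightarrow> complex"
  assumes \<psi>: "\<psi> \<noteq> (\<lambda>_. 0)" and fin: "finite G" and cv: "classes_vanish p \<psi> G" and p: "prime p"
    and ne: "G \<noteq> {}"
  obtains S where "S \<subseteq> G" "block p \<psi> S"
proof -
  obtain g where g: "g \<in> G" using ne by blast
  define K where "K = {f. f \<in> G \<and> related p \<psi> f g}"
  have K: "f - g \<in> eigs \<psi>" "eig \<psi> (f - g) ^ p = 1" if "f \<in> K" for f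
    using that by (auto simp: K_def related_def)
  have s: "(\<Sum>f\<in>K. eig \<psi> (f - g) ^ r) = 0" if r: "0 < r" "r < p" for r
  proof -
    have "coprime r p" using r by (rule coprime_less_prime[OF p])
    then show ?thesis using cv g r unfolding classes_vanish_def K_def by blast
  qed
  obtain S where S: "S \<subseteq> K" "card S = p" "inj_on (\<lambda>f. eig \<psi> (f - g)) S"
  proof (rule extract_full_orbit[of K p "\<lambda>f. eig \<psi> (f - g)"])
    show "finite K" using fin by (simp add: K_def)
    show "p > 0" using p by (rule prime_gt_0_nat)
    show "K \<noteq> {}" using g related_refl[OF \<psi>, of p g] by (auto simp: K_def)
  qed (use K s in auto)
  have "block p \<psi> S"
    by (rule block_of_class[where g = g and c = 1, OF \<psi> _ S(2,3)]) (use S(1) K in auto)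
  moreover have "S \<subseteq> G" using S(1) by (auto simp: K_def)
  ultimately show ?thesis using that by blast
qed

lemma three_blocks:
  fixes \<psi> :: "'a::ring_1 \<Rightarrow> complex"
  assumes \<psi>: "\<psi> \<noteq> (\<lambda>_. 0)" and fin: "finite F" and cv: "classes_vanish 3 \<psi> F" and card: "card F = 9"
  obtains T1 T2 T3 where "F = T1 \<union> T2 \<union> T3" "T1 \<inter> T2 = {}" "T1 \<inter> T3 = {}" "T2 \<inter> T3 = {}"
    "block 3 \<psi> T1" "block 3 \<psi> T2" "block 3 \<psi> T3"
proof -
  have p: "prime (3::nat)" by simp
  obtain T1 where T1: "T1 \<subseteq> F" "block 3 \<psi> T1"
    by (rule vanishing_class_contains_block[OF \<psi> fin cv p]) (use card in auto)
  have c1: "card (F - T1) = 6" using T1 card fin by (subst card_Diff_subset) (auto simp: block_def finite_subset)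
  have cv1: "classes_vanish 3 \<psi> (F - T1)"
    by (rule classes_vanish_Diff_block[OF \<psi> fin cv T1]) auto
  have ne1: "F - T1 \<noteq> {}" using c1 by (metis card.empty zero_neq_numeral)
  obtain T2 where T2: "T2 \<subseteq> F - T1" "block 3 \<psi> T2"
    by (rule vanishing_class_contains_block[OF \<psi> _ cv1 p ne1]) (use fin in auto)
  have c2: "card (F - T1 - T2) = 3" using T2 c1 fin
    by (subst card_Diff_subset) (auto simp: block_def intro: finite_subset)
  have cv2: "classes_vanish 3 \<psi> (F - T1 - T2)"
    by (rule classes_vanish_Diff_block[OF \<psi> _ cv1 T2]) (use fin in auto)
  have ne2: "F - T1 - T2 \<noteq> {}" using c2 by (metis card.empty zero_neq_numeral)
  obtain T3 where T3: "T3 \<subseteq> F - T1 - T2" "block 3 \<psi> T3"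
    by (rule vanishing_class_contains_block[OF \<psi> _ cv2 p ne2]) (use fin in auto)
  have "T3 = F - T1 - T2" using T3 c2 fin by (intro card_subset_eq) (auto simp: block_def)
  then show ?thesis using that[of T1 T2 T3] T1 T2 T3 by auto
qed

lemma cube_roots_of_unity:
  obtains \<omega> :: complex where "\<omega> ^ 3 = 1" "\<omega> \<noteq> 0" "\<omega> \<noteq> 1" "\<omega>\<^sup>2 \<noteq> 1" "\<omega>\<^sup>2 \<noteq> \<omega>"
    "\<And>z. z ^ 3 = 1 \<Longrightarrow> z = 1 \<or> z = \<omega> \<or> z = \<omega>\<^sup>2"
proof -
  have "card {z :: complex. z ^ 3 = 1} = 3" by (rule card_roots_unity_eq) simp
  then have "\<not> {z :: complex. z ^ 3 = 1} \<subseteq> {1}"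
    by (metis card_mono card.empty card_insert_disjoint empty_iff finite.emptyI finite.insertI
        numeral_le_one_iff One_nat_def semiring_norm(70))
  then obtain \<omega> :: complex where w: "\<omega> ^ 3 = 1" "\<omega> \<noteq> 1" by auto
  then have s: "1 + \<omega> + \<omega>\<^sup>2 = 0"
    using mult_eq_0_iff[of "\<omega> - 1" "1 + \<omega> + \<omega>\<^sup>2"] by (auto simp: algebra_simps power2_eq_square power3_eq_cube)
  have w0: "\<omega> \<noteq> 0" using w by auto
  have w2: "\<omega>\<^sup>2 \<noteq> 1" "\<omega>\<^sup>2 \<noteq> \<omega>" using w w0 by (auto simp: power2_eq_square power3_eq_cube)
  have "z = 1 \<or> z = \<omega> \<or> z = \<omega>\<^sup>2" if "z ^ 3 = 1" for z
  proof -
    have "\<omega>\<^sup>2 = - 1 - \<omega>" using s by (metis add.commute diff_minus_eq_add eq_neg_iff_add_eq_0 minus_diff_eq uminus_add_conv_diff)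
    moreover have "(z - 1) * (z - \<omega>) * (z - (- 1 - \<omega>)) = z ^ 3 - 1 - (z - 1) * (1 + \<omega> + \<omega>\<^sup>2)"
      by (simp add: algebra_simps power2_eq_square power3_eq_cube)
    ultimately have "(z - 1) * (z - \<omega>) * (z - \<omega>\<^sup>2) = 0" using that s by simp
    then show ?thesis by auto
  qed
  then show ?thesis using that w w0 w2 by blast
qed

text \<open>Modulo the block differences \<open>F\<close> has at most three values. As
  \<open>0 \<in> F\<close>, one of them is trivial, so the differences of the values generate
  everything.\<close>

lemma grp_mod_part_grp:
  fixes F :: "'a::comm_ring_1 set"
  assumes F: "F = T1 \<union> T2 \<union> T3" "0 \<in> F" and t: "t1 \<in> T1" "t2 \<in> T2" "t3 \<in> T3" and x: "x \<in> grp F"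
  obtains \<alpha> \<beta> :: int where
    "x - (of_int \<alpha> * (t2 - t1) + of_int \<beta> * (t3 - t1)) \<in> part_grp {T1, T2, T3}"
proof -
  let ?P = "part_grp {T1, T2, T3}"
  define c where "c \<alpha> \<beta> = of_int \<alpha> * (t2 - t1) + of_int \<beta> * (t3 - t1)" for \<alpha> \<beta> :: int
  have c: "c (\<alpha> - \<alpha>') (\<beta> - \<beta>') = c \<alpha> \<beta> - c \<alpha>' \<beta>'" for \<alpha> \<alpha>' \<beta> \<beta>'
    by (simp add: c_def algebra_simps)
  have P: "add_subgroup ?P" by (rule add_subgroup_part_grp)
  define H where "H = {x. \<exists>\<alpha> \<beta>. x - c \<alpha> \<beta> \<in> ?P}"
  have "x - c 0 0 \<in> ?P" if "x \<in> ?P" for x using that by (simp add: c_def)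
  then have PH: "?P \<subseteq> H" unfolding H_def by blast
  have H: "add_subgroup H"
    unfolding add_subgroup_def
  proof (intro conjI ballI)
    show "0 \<in> H" using PH add_subgroupD(1)[OF P] by blast
    fix x y assume "x \<in> H" "y \<in> H"
    then obtain \<alpha> \<beta> \<alpha>' \<beta>' where "x - c \<alpha> \<beta> \<in> ?P" "y - c \<alpha>' \<beta>' \<in> ?P" unfolding H_def by blast
    then have "(x - c \<alpha> \<beta>) - (y - c \<alpha>' \<beta>') \<in> ?P" using add_subgroupD(2)[OF P] by blast
    then have "x - y - c (\<alpha> - \<alpha>') (\<beta> - \<beta>') \<in> ?P" by (simp add: c algebra_simps)
    then show "x - y \<in> H" unfolding H_def by blast
  qed
  have "t2 - t1 - c 1 0 \<in> ?P" "t3 - t1 - c 0 1 \<in> ?P"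
    using add_subgroupD(1)[OF P] by (simp_all add: c_def)
  then have u: "t2 - t1 \<in> H" "t3 - t1 \<in> H" unfolding H_def by blast+
  have d: "f - g \<in> H" if "T \<in> {T1, T2, T3}" "f \<in> T" "g \<in> T" for T f g
    using part_grp_base[OF that] PH by blast
  note Hd = add_subgroupD[OF H]
  have t1: "t1 \<in> H"
  proof -
    consider "0 \<in> T1" | "0 \<in> T2" | "0 \<in> T3" using F by blast
    then show ?thesis
    proof cases
      case 1
      then show ?thesis using d[of T1 t1 0] t by simp
    next
      case 2
      then show ?thesis using Hd(2)[OF d[of T2 t2 0] u(1)] t by simp
    next
      case 3
      then show ?thesis using Hd(2)[OF d[of T3 t3 0] u(2)] t by simp
    qed
  qed
  have "t2 \<in> H" "t3 \<in> H" using Hd(4)[OF u(1) t1] Hd(4)[OF u(2) t1] by simp_all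
  then have "f \<in> H" if "f \<in> F" for f
    using that F(1) Hd(4)[OF d[of T1 f t1] t1] Hd(4)[OF d[of T2 f t2] \<open>t2 \<in> H\<close>]
      Hd(4)[OF d[of T3 f t3] \<open>t3 \<in> H\<close>] t by auto
  then have "grp F \<subseteq> H" by (intro grp_least[OF H]) blast
  then show ?thesis using that x unfolding H_def c_def by blast
qed

text \<open>Without a relation, the two differences are independent modulo the block differences.
  Sending them to \<open>\<omega>\<close> and its square then defines a character with three
  distinct values on the blocks, and \<open>F\<close> would tile periodically.\<close>

lemma three_block_relation:
  fixes F :: "(int ^ 'd::finite) set"
  assumes npt: "\<not> periodic_tile F" and fin: "finite F" and F0: "0 \<in> F" and \<psi>: "\<psi> \<noteq> (\<lambda>_. 0)"
    and F: "F = T1 \<union> T2 \<union> T3" "T1 \<inter> T2 = {}" "T1 \<inter> T3 = {}" "T2 \<inter> T3 = {}"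
    and bl: "block 3 \<psi> T1" "block 3 \<psi> T2" "block 3 \<psi> T3" and t: "t1 \<in> T1" "t2 \<in> T2" "t3 \<in> T3"
  obtains \<alpha> \<beta> :: int where "\<alpha> \<noteq> 0 \<or> \<beta> \<noteq> 0"
    "of_int \<alpha> * (t2 - t1) + of_int \<beta> * (t3 - t1) \<in> part_grp {T1, T2, T3}"
proof (rule ccontr)
  assume no: "\<not> thesis"
  let ?P = "part_grp {T1, T2, T3}"
  define c where "c \<alpha> \<beta> = of_int \<alpha> * (t2 - t1) + of_int \<beta> * (t3 - t1)" for \<alpha> \<beta> :: int
  have c: "c (\<alpha> - \<alpha>') (\<beta> - \<beta>') = c \<alpha> \<beta> - c \<alpha>' \<beta>'"
    "c (\<alpha> + \<alpha>') (\<beta> + \<beta>') = c \<alpha> \<beta> + c \<alpha>' \<beta>'" for \<alpha> \<alpha>' \<beta> \<beta>'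
    by (simp_all add: c_def algebra_simps)
  have P: "add_subgroup ?P" by (rule add_subgroup_part_grp)
  note Pd = add_subgroupD[OF P]
  have indep: "\<alpha> = 0 \<and> \<beta> = 0" if "c \<alpha> \<beta> \<in> ?P" for \<alpha> \<beta>
    using no that[unfolded c_def] \<open>\<And>\<alpha> \<beta>. \<alpha> \<noteq> 0 \<or> \<beta> \<noteq> 0 \<Longrightarrow> _ \<Longrightarrow> thesis\<close> by blast
  obtain \<omega> :: complex where w: "\<omega> ^ 3 = 1" "\<omega> \<noteq> 0" "\<omega> \<noteq> 1" "\<omega>\<^sup>2 \<noteq> 1" "\<omega>\<^sup>2 \<noteq> \<omega>"
    and roots: "\<And>z. z ^ 3 = 1 \<Longrightarrow> z = 1 \<or> z = \<omega> \<or> z = \<omega>\<^sup>2" by (rule cube_roots_of_unity) blast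
  define e where "e x = (THE z. \<exists>\<alpha> \<beta>. x - c \<alpha> \<beta> \<in> ?P \<and> z = \<omega> powi (\<alpha> + 2 * \<beta>))" for x
  have e_eq: "e x = \<omega> powi (\<alpha> + 2 * \<beta>)" if x: "x - c \<alpha> \<beta> \<in> ?P" for x \<alpha> \<beta>
    unfolding e_def
  proof (rule the_equality)
    show "\<exists>\<alpha>' \<beta>'. x - c \<alpha>' \<beta>' \<in> ?P \<and> \<omega> powi (\<alpha> + 2 * \<beta>) = \<omega> powi (\<alpha>' + 2 * \<beta>')" using x by blast
    fix z assume "\<exists>\<alpha> \<beta>. x - c \<alpha> \<beta> \<in> ?P \<and> z = \<omega> powi (\<alpha> + 2 * \<beta>)"
    then obtain \<alpha>' \<beta>' where z: "x - c \<alpha>' \<beta>' \<in> ?P" "z = \<omega> powi (\<alpha>' + 2 * \<beta>')" by blast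
    have "(x - c \<alpha>' \<beta>') - (x - c \<alpha> \<beta>) \<in> ?P" using Pd(2)[OF z(1) x] .
    then have "c (\<alpha> - \<alpha>') (\<beta> - \<beta>') \<in> ?P" by (simp add: c)
    then show "z = \<omega> powi (\<alpha> + 2 * \<beta>)" using indep[of "\<alpha> - \<alpha>'" "\<beta> - \<beta>'"] z(2) by simp
  qed
  have L: "add_subgroup (grp F)" by (rule add_subgroup_grp)
  have rep: "\<exists>\<alpha> \<beta>. x - c \<alpha> \<beta> \<in> ?P" if "x \<in> grp F" for x
    using grp_mod_part_grp[OF F(1) F0 t that] unfolding c_def by blast
  have e_add: "e (x + y) = e x * e y" if "x \<in> grp F" "y \<in> grp F" for x y
  proof -
    obtain \<alpha> \<beta> \<alpha>' \<beta>' where r: "x - c \<alpha> \<beta> \<in> ?P" "y - c \<alpha>' \<beta>' \<in> ?P" using rep[OF \<open>x \<in> grp F\<close>] rep[OF \<open>y \<in> grp F\<close>] by blast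
    have "x + y - c (\<alpha> + \<alpha>') (\<beta> + \<beta>') \<in> ?P" using Pd(4)[OF r] by (simp add: c algebra_simps)
    then show ?thesis using e_eq[OF r(1)] e_eq[OF r(2)] e_eq[of "x + y"] w(2)
      by (simp add: power_int_add[symmetric] algebra_simps)
  qed
  have e3: "e x ^ 3 = 1" if "x \<in> grp F" for x
  proof -
    obtain \<alpha> \<beta> where "x - c \<alpha> \<beta> \<in> ?P" using rep \<open>x \<in> grp F\<close> by blast
    then have "e x = \<omega> powi (\<alpha> + 2 * \<beta>)" by (rule e_eq)
    moreover have "(\<omega> ^ m) ^ 3 = 1" for m by (metis power_mult mult.commute power_one w(1))
    ultimately show ?thesis by (simp add: power_int_def power_inverse)
  qed
  have FL: "F \<subseteq> grp F" by (auto intro: grp_base)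
  have eP: "e x = 1" if "x \<in> ?P" for x using e_eq[of x 0 0] that by (simp add: c_def)
  have eT: "e f = e g" if "T \<in> {T1, T2, T3}" "f \<in> T" "g \<in> T" for T f g
  proof -
    have fg: "f \<in> grp F" "g \<in> grp F" using that F(1) FL by auto
    then have "f - g \<in> grp F" using add_subgroupD(2)[OF L] by blast
    then show ?thesis using e_add[of "f - g" g] fg eP[OF part_grp_base[OF that]] by simp
  qed
  have tL: "t1 \<in> grp F" "t2 \<in> grp F" "t3 \<in> grp F" using t F(1) FL by auto
  have u: "e (t2 - t1) = \<omega>" "e (t3 - t1) = \<omega>\<^sup>2"
    using e_eq[of "t2 - t1" 1 0] e_eq[of "t3 - t1" 0 1] Pd(1) by (simp_all add: c_def)
  have e2: "e t2 = \<omega> * e t1" and e3': "e t3 = \<omega>\<^sup>2 * e t1"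
    using e_add[of "t2 - t1" t1] e_add[of "t3 - t1" t1] u tL add_subgroupD(2)[OF L] by simp_all
  have e0: "e t1 \<noteq> 0" using e3[OF tL(1)] by auto
  have ne: "e t1 \<noteq> e t2" "e t1 \<noteq> e t3" "e t2 \<noteq> e t3" using w e0 e2 e3' by auto
  have classes: "{g \<in> F. e g = e t1} = T1" "{g \<in> F. e g = e t2} = T2" "{g \<in> F. e g = e t3} = T3"
  proof -
    define v1 v2 v3 where "v1 = e t1" and "v2 = e t2" and "v3 = e t3"
    have m: "\<And>f. f \<in> T1 \<Longrightarrow> e f = v1" "\<And>f. f \<in> T2 \<Longrightarrow> e f = v2" "\<And>f. f \<in> T3 \<Longrightarrow> e f = v3"
      unfolding v1_def v2_def v3_def by (rule eT; use t in simp)+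
    show "{g \<in> F. e g = e t1} = T1" "{g \<in> F. e g = e t2} = T2" "{g \<in> F. e g = e t3} = T3"
      using ne unfolding F(1) v1_def[symmetric] v2_def[symmetric] v3_def[symmetric] by (auto simp: m)
  qed
  have "periodic_tile F"
  proof (rule periodic_tile_of_blocks[where L = "grp F" and k = 3 and e = e and p = 3 and \<psi> = \<psi>, OF fin L FL \<psi>])
    show "\<exists>f\<in>F. e x = e f" if "x \<in> grp F" for x
    proof -
      have "(e x / e t1) ^ 3 = 1" using e3[OF that] e3[OF tL(1)] by (simp add: power_divide)
      then have "e x / e t1 = 1 \<or> e x / e t1 = \<omega> \<or> e x / e t1 = \<omega>\<^sup>2" by (rule roots)
      then have "e x = e t1 \<or> e x = e t2 \<or> e x = e t3" using e0 unfolding e2 e3' by (simp add: nonzero_divide_eq_eq)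
      then show ?thesis using t F(1) by auto
    qed
    show "block 3 \<psi> {g \<in> F. e g = e f}" if "f \<in> F" for f
    proof -
      have "e f = e t1 \<or> e f = e t2 \<or> e f = e t3"
        using that eT[of T1 f t1] eT[of T2 f t2] eT[of T3 f t3] t unfolding F(1) by blast
      then show ?thesis using classes bl by auto
    qed
  qed (use e_add e3 in auto)
  then show False using npt by blast
qed

text \<open>The coefficient pairs of the relation and of a kernel element are both orthogonal to the
  nonzero real pair \<open>(x, y)\<close>, hence proportional. Multiplying by a nonzero coefficient
  \<open>k\<close> of the relation turns the kernel element into a multiple of the relation, modulo
  block differences.\<close>

lemma kernel_multiple_in_part_grp:
  fixes F :: "'a::comm_ring_1 set"
  assumes add: "\<And>x y. \<nu> (x + y) = \<nu> x + (\<nu> y :: real)"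
    and \<nu>0: "\<And>x. x \<in> part_grp {T1, T2, T3} \<Longrightarrow> \<nu> x = 0" and ne: "\<exists>x\<in>grp F. \<nu> x \<noteq> 0"
    and F: "F = T1 \<union> T2 \<union> T3" "0 \<in> F" and t: "t1 \<in> T1" "t2 \<in> T2" "t3 \<in> T3"
    and rel: "\<alpha> \<noteq> 0 \<or> \<beta> \<noteq> 0" "of_int \<alpha> * (t2 - t1) + of_int \<beta> * (t3 - t1) \<in> part_grp {T1, T2, T3}"
  obtains m where "m > (0::nat)"
    "\<forall>v\<in>grp F. \<nu> v = 0 \<longrightarrow> of_nat m * v \<in> part_grp {T1, T2, T3}"
proof -
  let ?P = "part_grp {T1, T2, T3}"
  have P: "add_subgroup ?P" by (rule add_subgroup_part_grp)
  note Pd = add_subgroupD[OF P] and Pm = add_subgroup_of_int_mult[OF P] and l = additive_real[OF add]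
  define x y where "x = \<nu> (t2 - t1)" and "y = \<nu> (t3 - t1)"
  have r0: "of_int \<alpha> * x + of_int \<beta> * y = 0" using \<nu>0[OF rel(2)] by (simp add: add l(5) x_def y_def)
  have rep0: "\<nu> v = of_int a * x + of_int b * y"
    if "v - (of_int a * (t2 - t1) + of_int b * (t3 - t1)) \<in> ?P" for v a b
    using \<nu>0[OF that] unfolding l(3) add l(5) x_def y_def by (simp add: l(3))
  have xy: "x \<noteq> 0 \<or> y \<noteq> 0"
  proof (rule ccontr)
    assume "\<not> ?thesis"
    then have "\<nu> v = 0" if "v \<in> grp F" for v
      using grp_mod_part_grp[OF F t that] rep0 by (metis add_0 mult_zero_right)
    then show False using ne by blast
  qed
  define k where "k = (if \<alpha> \<noteq> 0 then \<alpha> else \<beta>)"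
  have k: "k \<noteq> 0" using rel by (simp add: k_def)
  have main: "of_int k * v \<in> ?P" if v: "v \<in> grp F" "\<nu> v = 0" for v
  proof -
    obtain a b where ab: "v - (of_int a * (t2 - t1) + of_int b * (t3 - t1)) \<in> ?P"
      using grp_mod_part_grp[OF F t v(1)] by blast
    have 0: "of_int a * x + of_int b * y = 0" using rep0[OF ab] v(2) by simp
    have "(of_int a * of_int \<beta> - of_int b * of_int \<alpha>) * x = of_int \<beta> * (of_int a * x + of_int b * y)
        - of_int b * (of_int \<alpha> * x + of_int \<beta> * y)"
      "(of_int a * of_int \<beta> - of_int b * of_int \<alpha>) * y = of_int a * (of_int \<alpha> * x + of_int \<beta> * y)
        - of_int \<alpha> * (of_int a * x + of_int b * y)"
      by (simp_all add: algebra_simps)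
    then have "(of_int a * of_int \<beta> - of_int b * of_int \<alpha> :: real) = 0" using 0 r0 xy by auto
    then have det: "a * \<beta> = b * \<alpha>" by (metis eq_iff_diff_eq_0 of_int_eq_iff of_int_mult)
    define n where "n = (if \<alpha> \<noteq> 0 then a else b)"
    have n: "k * a = n * \<alpha>" "k * b = n * \<beta>" using det rel by (auto simp: n_def k_def mult.commute)
    have "of_int k * v = of_int k * (v - (of_int a * (t2 - t1) + of_int b * (t3 - t1)))
        + (of_int (k * a) * (t2 - t1) + of_int (k * b) * (t3 - t1))"
      by (simp add: algebra_simps)
    also have "of_int (k * a) * (t2 - t1) + of_int (k * b) * (t3 - t1) =
        of_int n * (of_int \<alpha> * (t2 - t1) + of_int \<beta> * (t3 - t1))"
      unfolding n by (simp add: algebra_simps)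
    finally show ?thesis using Pd(4)[OF Pm[OF ab, of k] Pm[OF rel(2), of n]] by simp
  qed
  have "of_nat (nat \<bar>k\<bar>) * v \<in> ?P" if "v \<in> grp F" "\<nu> v = 0" for v
  proof (cases "k \<ge> 0")
    case True
    then show ?thesis using main[OF that] by simp
  next
    case False
    then show ?thesis using Pd(3)[OF main[OF that]] by simp
  qed
  then show ?thesis using that[of "nat \<bar>k\<bar>"] k by simp
qed

section \<open>Periodicity along the kernel\<close>

text \<open>If the proposed shift were not a period, the span of the increment would contain an
  eigenfunction with three blocks. These lie in levels of \<open>\<nu>\<close>, and the lack of a
  separating character gives a relation, so \<open>M v\<close> is a combination of block
  differences. Then \<open>3 M v\<close> acts trivially, against boundedness. As the blocks are not
  known in advance, \<open>M\<close> is a product over all families of subsets of \<open>F\<close>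
  that admit a scale.\<close>

lemma kernel_period:
  fixes F :: "(int ^ 'd::finite) set" and \<delta> :: "int ^ 'd \<Rightarrow> complex"
  assumes npt: "\<not> periodic_tile F" and fin: "finite F" and F0: "0 \<in> F" and card: "card F = 9"
    and add: "\<And>x y. \<nu> (x + y) = \<nu> x + (\<nu> y :: real)" and ne: "\<exists>x\<in>grp F. \<nu> x \<noteq> 0"
    and bdd: "bounded (range \<delta>)" and os: "one_sided \<nu> \<delta>"
    and kill: "\<And>r x. r > 0 \<Longrightarrow> coprime r 3 \<Longrightarrow> (\<Sum>f\<in>F. \<delta> (x - of_nat r * f)) = 0"
  obtains M where "M > (0::nat)" "\<And>v x. v \<in> grp F \<Longrightarrow> \<nu> v = 0 \<Longrightarrow> \<delta> (x - of_nat M * v) = \<delta> x"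
proof -
  define scales where "scales P m \<longleftrightarrow> m > 0 \<and> (\<forall>v\<in>grp F. \<nu> v = 0 \<longrightarrow> of_nat m * v \<in> part_grp P)"
    for P and m :: nat
  define scale where "scale P = (SOME m. scales P m)" for P
  define PP where "PP = {P \<in> Pow (Pow F). \<exists>m. scales P m}"
  have finPP: "finite PP" unfolding PP_def using fin by auto
  have scale: "scales P (scale P)" if "P \<in> PP" for P
    using that unfolding PP_def scale_def by (auto intro: someI)
  define M where "M = (\<Prod>P\<in>PP. scale P)"
  have M: "M > 0" unfolding M_def using scale by (auto intro!: prod_pos simp: scales_def)
  have "\<delta> (x - of_nat (M * 3) * v) = \<delta> x" if v: "v \<in> grp F" "\<nu> v = 0" for v x
  proof (rule ccontr)
    assume diff: "\<delta> (x - of_nat (M * 3) * v) \<noteq> \<delta> x"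
    define w where "w = of_nat (M * 3) * v"
    define \<phi> where "\<phi> = (\<lambda>x. \<delta> (x - w) - \<delta> x)"
    have nz: "\<phi> \<noteq> (\<lambda>_. 0)" using diff unfolding \<phi>_def w_def by (metis eq_iff_diff_eq_0)
    have \<phi>: "\<phi> \<in> shift_span \<delta>" unfolding \<phi>_def
      by (intro shift_span_diff shift_span.shift shift_span.base)
    have kill\<phi>: "(\<Sum>f\<in>F. \<phi> (x - of_nat r * f)) = 0" if "r > 0" "coprime r 3" for r x
      using shift_span_annihilated[OF \<phi>, where S = F and g = "\<lambda>f. of_nat r * f"] kill[OF that] by blast
    obtain \<psi> where \<psi>: "\<psi> \<in> shift_span \<phi>" "\<psi> \<noteq> (\<lambda>_. 0)"
      and cv: "\<And>g r. g \<in> F \<Longrightarrow> r > 0 \<Longrightarrow> coprime r 3 \<Longrightarrow>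
        (\<Sum>f | f \<in> F \<and> related 3 \<psi> f g. eig \<psi> (f - g) ^ r) = 0"
      by (rule terminal_vector[OF fin _ nz kill\<phi>]) auto
    have "classes_vanish 3 \<psi> F" unfolding classes_vanish_def using cv by blast
    from three_blocks[OF \<psi>(2) fin this card] obtain T1 T2 T3
      where F: "F = T1 \<union> T2 \<union> T3" "T1 \<inter> T2 = {}" "T1 \<inter> T3 = {}" "T2 \<inter> T3 = {}"
        and bl: "block 3 \<psi> T1" "block 3 \<psi> T2" "block 3 \<psi> T3" by blast
    have "T1 \<noteq> {}" "T2 \<noteq> {}" "T3 \<noteq> {}" using bl by (auto simp: block_def)
    then obtain t1 t2 t3 where t: "t1 \<in> T1" "t2 \<in> T2" "t3 \<in> T3" by blast
    have blP: "block 3 \<psi> T" if "T \<in> {T1, T2, T3}" for T using bl that by blast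
    have os\<psi>: "one_sided \<nu> \<psi>"
      by (rule one_sided_shift_span[OF add shift_span_trans[OF \<psi>(1) \<phi>] os])
    have \<nu>0: "\<nu> u = 0" if "u \<in> part_grp {T1, T2, T3}" for u
      by (rule one_sided_eig[OF add os\<psi> \<psi>(2) part_grp_eig(1)[OF \<psi>(2) blP that]])
    obtain \<alpha> \<beta> :: int where rel: "\<alpha> \<noteq> 0 \<or> \<beta> \<noteq> 0"
      "of_int \<alpha> * (t2 - t1) + of_int \<beta> * (t3 - t1) \<in> part_grp {T1, T2, T3}"
      by (rule three_block_relation[OF npt fin F0 \<psi>(2) F bl t])
    obtain m where "m > (0::nat)" "\<forall>v\<in>grp F. \<nu> v = 0 \<longrightarrow> of_nat m * v \<in> part_grp {T1, T2, T3}"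
      by (rule kernel_multiple_in_part_grp[OF add \<nu>0 ne F(1) F0 t rel])
    then have "scales {T1, T2, T3} m" by (auto simp: scales_def)
    then have P: "{T1, T2, T3} \<in> PP" unfolding PP_def F(1) by blast
    have "scale {T1, T2, T3} dvd M" unfolding M_def by (rule dvd_prodI[OF finPP P])
    then obtain k where k: "M = k * scale {T1, T2, T3}" by (metis dvdE mult.commute)
    have "of_nat (scale {T1, T2, T3}) * v \<in> part_grp {T1, T2, T3}" using scale[OF P] v by (simp add: scales_def)
    from add_subgroup_of_nat_mult[OF add_subgroup_part_grp this, of k]
    have Mv: "of_nat M * v \<in> part_grp {T1, T2, T3}" unfolding k by (simp add: mult.assoc)
    note e = part_grp_eig[OF \<psi>(2) blP Mv]
    have w: "w = of_nat 3 * (of_nat M * v)" by (simp add: w_def mult.commute mult.left_commute)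
    have "eig \<psi> w = 1" "w \<in> eigs \<psi>" unfolding w using eig_of_nat_mult[OF \<psi>(2) e(1), of 3] e(2) by auto
    then have "\<psi> (x - w) = \<psi> x" for x using eigD[OF \<psi>(2), of w x] by simp
    then have "\<psi> = (\<lambda>_. 0)" by (rule periodic_difference_eq_0[OF bdd \<psi>(1)[unfolded \<phi>_def]])
    then show False using \<psi>(2) by blast
  qed
  then show ?thesis using that[of "M * 3"] M by simp
qed

text \<open>Along the level of \<open>g\<close> the multiplier \<open>r\<close> only matters modulo the period. A large multiplier
  pushes the higher levels into the half-space where \<open>\<delta>\<close> vanishes, and the lower levels vanish by
  induction.\<close>

lemma level_sum_eq_0:
  fixes F :: "'a::ring_1 set" and \<delta> :: "'a \<Rightarrow> complex"
  assumes fin: "finite F" and add: "\<And>x y. \<nu> (x + y) = \<nu> x + (\<nu> y :: real)"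
    and neg: "\<And>x. \<nu> x < 0 \<Longrightarrow> \<delta> x = 0"
    and kill: "\<And>r x. r > 0 \<Longrightarrow> coprime r p \<Longrightarrow> (\<Sum>f\<in>F. \<delta> (x - of_nat r * f)) = 0"
    and M: "M > 0" "\<And>v x. v \<in> grp F \<Longrightarrow> \<nu> v = 0 \<Longrightarrow> \<delta> (x - of_nat M * v) = \<delta> x"
    and p: "p > 0" and g: "g \<in> F" and r: "r > 0" "coprime r p"
  shows "(\<Sum>f | f \<in> F \<and> \<nu> f = \<nu> g. \<delta> (y - of_nat r * (f - g))) = 0"
  using g r
proof (induction "card {h \<in> F. \<nu> h < \<nu> g}" arbitrary: g r y rule: less_induct)
  case less
  note l = additive_real[OF add]
  have L: "add_subgroup (grp F)" by (rule add_subgroup_grp)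
  have "\<forall>\<^sub>F k in sequentially. \<nu> y < real (r + p * M * k) * (\<nu> f - \<nu> g)" if "\<nu> f > \<nu> g" for f
  proof (rule eventually_sequentiallyI)
    fix k assume k: "k \<ge> nat \<lceil>\<nu> y / (\<nu> f - \<nu> g)\<rceil>"
    have d: "\<nu> f - \<nu> g > 0" using that by simp
    have "\<nu> y / (\<nu> f - \<nu> g) \<le> real k" using k by linarith
    moreover have "k \<le> p * M * k" using p M(1) by simp
    then have "k < r + p * M * k" using less.prems(2) by linarith
    then have "real k < real (r + p * M * k)" by (simp only: of_nat_less_iff)
    ultimately have "\<nu> y / (\<nu> f - \<nu> g) < real (r + p * M * k)" by linarith
    then show "\<nu> y < real (r + p * M * k) * (\<nu> f - \<nu> g)" using d by (simp only: pos_divide_less_eq)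
  qed
  then have "\<forall>\<^sub>F k in sequentially. \<forall>f\<in>{f \<in> F. \<nu> f > \<nu> g}. \<nu> y < real (r + p * M * k) * (\<nu> f - \<nu> g)"
    using fin by (intro eventually_ball_finite) auto
  then obtain k where k: "\<And>f. f \<in> F \<Longrightarrow> \<nu> f > \<nu> g \<Longrightarrow> \<nu> y < real (r + p * M * k) * (\<nu> f - \<nu> g)"
    using eventually_happens'[OF sequentially_bot] by blast
  \<comment> \<open>Adding a multiple of \<open>p\<close> keeps the factor coprime to
    \<open>p\<close>, and adding a multiple of \<open>M\<close> does not change the terms on the
    level of \<open>g\<close>.\<close>
  define R where "R = r + p * M * k"
  have R: "R > 0" "coprime R p"
  proof -
    show "R > 0" using less.prems(2) by (simp add: R_def)
    have R_eq: "R = (M * k) * p + r" by (simp add: R_def mult_ac)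
    have "gcd p r = 1" using less.prems(3) by (simp only: coprime_iff_gcd_eq_1 gcd.commute)
    then show "coprime R p" unfolding R_eq coprime_iff_gcd_eq_1 gcd.commute[of _ p] gcd_add_mult .
  qed
  define h where "h f = \<delta> (y - of_nat R * (f - g))" for f
  have up: "h f = 0" if "f \<in> F" "\<nu> f > \<nu> g" for f
    unfolding h_def using k[OF that, folded R_def] by (intro neg) (simp add: l)
  have down: "sum h {f \<in> F. \<nu> f < \<nu> g} = 0"
  proof -
    have "sum h {f \<in> F. \<nu> f < \<nu> g} =
        (\<Sum>c\<in>\<nu> ` {f \<in> F. \<nu> f < \<nu> g}. sum h {f \<in> {f \<in> F. \<nu> f < \<nu> g}. \<nu> f = c})"
      using fin by (intro sum.image_gen) auto
    also have "\<dots> = 0"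
    proof (rule sum.neutral, rule ballI, elim imageE)
      fix c f assume c: "c = \<nu> f" and f: "f \<in> {f \<in> F. \<nu> f < \<nu> g}"
      have "{h \<in> F. \<nu> h < \<nu> f} \<subset> {h \<in> F. \<nu> h < \<nu> g}" using f by auto
      then have "card {h \<in> F. \<nu> h < \<nu> f} < card {h \<in> F. \<nu> h < \<nu> g}" using fin by (intro psubset_card_mono) auto
      from less.hyps[OF this _ R, of "y - of_nat R * (f - g)"] f
      have "(\<Sum>f' | f' \<in> F \<and> \<nu> f' = \<nu> f. \<delta> (y - of_nat R * (f - g) - of_nat R * (f' - f))) = 0" by simp
      moreover have "y - of_nat R * (f - g) - of_nat R * (f' - f) = y - of_nat R * (f' - g)" for f'
        by (simp add: algebra_simps)
      moreover have "{f' \<in> {f \<in> F. \<nu> f < \<nu> g}. \<nu> f' = c} = {f'. f' \<in> F \<and> \<nu> f' = \<nu> f}" using c f by auto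
      ultimately show "sum h {f' \<in> {f \<in> F. \<nu> f < \<nu> g}. \<nu> f' = c} = 0" by (simp add: h_def)
    qed
    finally show ?thesis .
  qed
  have "(\<Sum>f\<in>F. \<delta> ((y + of_nat R * g) - of_nat R * f)) = 0" by (rule kill[OF R])
  then have "sum h F = 0" by (simp add: h_def algebra_simps)
  moreover have "sum h F = sum h {f \<in> F. \<nu> f < \<nu> g} + sum h {f \<in> F. \<not> \<nu> f < \<nu> g}"
    using fin by (subst sum.union_disjoint[symmetric]) (auto intro: sum.cong)
  moreover have "sum h {f \<in> F. \<not> \<nu> f < \<nu> g} = sum h {f. f \<in> F \<and> \<nu> f = \<nu> g}"
    using fin up by (intro sum.mono_neutral_right) (auto, metis linorder_less_linear)
  ultimately have "sum h {f. f \<in> F \<and> \<nu> f = \<nu> g} = 0" using down by simp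
  moreover have "h f = \<delta> (y - of_nat r * (f - g))" if f: "f \<in> F" "\<nu> f = \<nu> g" for f
  proof -
    have "f - g \<in> grp F" using f less.prems(1) add_subgroupD(2)[OF L] grp_base by blast
    then have v: "of_nat (p * k) * (f - g) \<in> grp F" "\<nu> (of_nat (p * k) * (f - g)) = 0"
      using add_subgroup_of_nat_mult[OF L] f(2) by (auto simp only: l diff_self mult_zero_right)
    have split: "of_nat R * (f - g) = of_nat r * (f - g) + of_nat M * (of_nat (p * k) * (f - g))"
    proof -
      have R_eq: "R = r + M * (p * k)" by (simp add: R_def mult_ac)
      show ?thesis unfolding R_eq of_nat_add of_nat_mult by (simp only: distrib_right mult.assoc)
    qed
    show ?thesis unfolding h_def split using M(2)[OF v, of "y - of_nat r * (f - g)"] by (simp only: diff_diff_add)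
  qed
  ultimately show ?case by simp
qed

text \<open>Every class lies in one level and has size divisible by 3, so every level has size
  divisible by 3. The level of \<open>0\<close> and a second level have at most nine elements
  together, so one of them has exactly three.\<close>

lemma level_of_card_3:
  fixes F :: "'a::ring_1 set" and \<delta> :: "'a \<Rightarrow> complex"
  assumes fin: "finite F" and F0: "0 \<in> F" and card: "card F = 9"
    and add: "\<And>x y. \<nu> (x + y) = \<nu> x + (\<nu> y :: real)" and ne: "\<exists>x\<in>grp F. \<nu> x \<noteq> 0"
    and os: "one_sided \<nu> \<delta>" and nz: "\<delta> \<noteq> (\<lambda>_. 0)"
    and kill: "\<And>r x. r > 0 \<Longrightarrow> coprime r 3 \<Longrightarrow> (\<Sum>f\<in>F. \<delta> (x - of_nat r * f)) = 0"
  obtains g where "g \<in> F" "card {f \<in> F. \<nu> f = \<nu> g} = 3"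
proof -
  note l = additive_real[OF add]
  obtain \<psi> where \<psi>: "\<psi> \<in> shift_span \<delta>" "\<psi> \<noteq> (\<lambda>_. 0)"
    and cv: "\<And>g r. g \<in> F \<Longrightarrow> r > 0 \<Longrightarrow> coprime r 3 \<Longrightarrow>
      (\<Sum>f | f \<in> F \<and> related 3 \<psi> f g. eig \<psi> (f - g) ^ r) = 0"
    by (rule terminal_vector[OF fin _ nz kill]) auto
  have os\<psi>: "one_sided \<nu> \<psi>" by (rule one_sided_shift_span[OF add \<psi>(1) os])
  have rel\<nu>: "\<nu> f = \<nu> g" if "related 3 \<psi> f g" for f g
    using one_sided_eig[OF add os\<psi> \<psi>(2)] that by (fastforce simp: related_def l)
  define cl where "cl g = {f \<in> F. related 3 \<psi> f g}" for g
  have cl3: "3 dvd card (cl g)" if g: "g \<in> F" for g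
  proof -
    have "3 * card {f \<in> cl g. eig \<psi> (f - g) = 1} = card (cl g)"
    proof (rule card_fibre_of_power_sums)
      fix r :: nat assume "0 < r" "r < 3"
      then have "coprime r 3" by (intro coprime_less_prime) auto
      then show "(\<Sum>f\<in>cl g. eig \<psi> (f - g) ^ r) = 0" using cv[OF g \<open>0 < r\<close>] by (simp add: cl_def)
    qed (use fin in \<open>auto simp: cl_def related_def\<close>)
    then show ?thesis by (metis dvd_triv_left)
  qed
  have lev3: "3 dvd card {f \<in> F. \<nu> f = \<nu> g}" if g: "g \<in> F" for g
  proof -
    define S where "S = {f \<in> F. \<nu> f = \<nu> g}"
    have "3 dvd (\<Sum>c\<in>cl ` S. card {f. f \<in> S \<and> cl f = c})"
    proof (rule dvd_sum, elim imageE)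
      fix c f assume c: "c = cl f" and f: "f \<in> S"
      have eq: "cl h = cl f \<longleftrightarrow> related 3 \<psi> h f" if "h \<in> F" for h
      proof
        assume "cl h = cl f"
        then show "related 3 \<psi> h f" using that related_refl[OF \<psi>(2), of 3 h] by (auto simp: cl_def)
      next
        assume "related 3 \<psi> h f"
        then show "cl h = cl f" unfolding cl_def
          using related_trans[OF \<psi>(2)] related_sym[OF \<psi>(2)] by blast
      qed
      have "{h. h \<in> S \<and> cl h = c} = cl f"
        using f eq rel\<nu> unfolding c by (auto simp: S_def cl_def)
      then show "3 dvd card {h. h \<in> S \<and> cl h = c}" using cl3[of f] f unfolding S_def by simp
    qed
    moreover have "finite S" using fin by (simp add: S_def)
    ultimately have "3 dvd card S"
      using sum.image_gen[of S "\<lambda>_. 1::nat" cl] by (simp only: card_eq_sum[symmetric])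
    then show ?thesis by (simp only: S_def)
  qed
  obtain g where g: "g \<in> F" "\<nu> g \<noteq> 0"
  proof (rule ccontr)
    assume "\<not> thesis"
    then have "F \<subseteq> {x. \<nu> x = 0}" using that by blast
    moreover have "add_subgroup {x. \<nu> x = 0}" by (auto simp: add_subgroup_def l)
    ultimately have "grp F \<subseteq> {x. \<nu> x = 0}" by (intro grp_least)
    then show False using ne by blast
  qed
  let ?A = "{f \<in> F. \<nu> f = \<nu> 0}" and ?B = "{f \<in> F. \<nu> f = \<nu> g}"
  have "card ?A + card ?B = card (?A \<union> ?B)" using fin g(2) l(1) by (intro card_Un_disjoint[symmetric]) auto
  also have "\<dots> \<le> 9" using card card_mono[OF fin, of "?A \<union> ?B"] by auto
  finally have "card ?A + card ?B \<le> 9" .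
  moreover have "card ?A > 0" "card ?B > 0" using fin F0 g(1) by (auto simp: card_gt_0_iff)
  moreover have "3 dvd card ?A" "3 dvd card ?B" using lev3 F0 g(1) by blast+
  ultimately have "card ?A = 3 \<or> card ?B = 3" by presburger
  then show ?thesis using that F0 g(1) by blast
qed

section \<open>Products of periodic vectors\<close>

inductive_set prod_sums :: "(('a \<Rightarrow> complex) \<times> ('a \<Rightarrow> complex)) set \<Rightarrow> ('a \<Rightarrow> complex) set" for S where
  zero: "(\<lambda>_. 0) \<in> prod_sums S"
| add: "(v, g) \<in> S \<Longrightarrow> h \<in> prod_sums S \<Longrightarrow> (\<lambda>x. v x * g x + h x) \<in> prod_sums S"

lemma prod_sums_plus:
  assumes "h \<in> prod_sums S" "h' \<in> prod_sums S"
  shows "(\<lambda>x. h x + h' x) \<in> prod_sums S"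
  using assms(1)
proof induction
  case zero
  then show ?case using assms(2) by simp
next
  case (add v g h)
  then show ?case using prod_sums.add[OF add.hyps(1) add.IH] by (simp add: add.assoc)
qed

lemma prod_sums_sum:
  assumes "finite I" "\<And>i. i \<in> I \<Longrightarrow> (V i, G i) \<in> S"
  shows "(\<lambda>x. \<Sum>i\<in>I. V i x * G i x) \<in> prod_sums S"
  using assms
proof (induction I rule: finite_induct)
  case empty
  show ?case using prod_sums.zero by simp
next
  case (insert i I)
  then show ?case using prod_sums.add[of "V i" "G i" S "\<lambda>x. \<Sum>i\<in>I. V i x * G i x"] by simp
qed

lemma prod_sums_nonzero:
  assumes "h \<in> prod_sums S" "h \<noteq> (\<lambda>_. 0)"
  obtains v g where "(v, g) \<in> S" "v \<noteq> (\<lambda>_. 0)" "g \<noteq> (\<lambda>_. 0)"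
proof (rule ccontr)
  assume no: "\<not> thesis"
  have 0: "v x * g x = 0" if "(v, g) \<in> S" for v g x
    using no \<open>\<And>v g. (v, g) \<in> S \<Longrightarrow> v \<noteq> (\<lambda>_. 0) \<Longrightarrow> g \<noteq> (\<lambda>_. 0) \<Longrightarrow> thesis\<close>[OF \<open>(v, g) \<in> S\<close>] by auto
  have "h = (\<lambda>_. 0)" using assms(1)
  proof induction
    case (add v g h)
    then show ?case using 0[OF add.hyps(1)] by (auto simp: fun_eq_iff)
  qed simp
  then show False using assms(2) by blast
qed

text \<open>Decompose \<open>g\<close> into its eigencomponents along \<open>d\<close> and apply
  \<open>root_proj_mult\<close> to each of them.\<close>

lemma root_proj_product:
  assumes M: "M > 0" and per: "\<And>x. g (x - of_nat M * d) = g x"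
  shows "root_proj M d z (\<lambda>x. v x * g x) =
    (\<lambda>x. \<Sum>b | b ^ M = 1. root_proj M d (z / b) v x * (root_proj M d b g x / of_nat M))"
proof
  fix x
  define R :: "complex set" where "R = {b. b ^ M = 1}"
  define h where "h b x = root_proj M d b g x / of_nat M" for b x
  have g: "g x = (\<Sum>b\<in>R. h b x)" for x
    using sum_root_proj[OF M, of d g x] M by (simp add: h_def R_def sum_divide_distrib[symmetric])
  have h: "h b (x - d) = b * h b x" "b \<noteq> 0" if "b \<in> R" for b x
  proof -
    have b: "b ^ M = 1" using that by (simp add: R_def)
    show "h b (x - d) = b * h b x" using root_proj_eigen[OF M b, of g d x] per by (simp add: h_def)
    show "b \<noteq> 0" using b M by (metis power_0_left zero_neq_one less_irrefl)
  qed
  have "root_proj M d z (\<lambda>x. v x * g x) x = (\<Sum>b\<in>R. root_proj M d z (\<lambda>x. v x * h b x) x)"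
    unfolding root_proj_def g sum_distrib_left by (rule sum.swap)
  also have "\<dots> = (\<Sum>b\<in>R. root_proj M d (z / b) v x * h b x)"
    by (rule sum.cong[OF refl], rule root_proj_mult) (use h in auto)
  finally show "root_proj M d z (\<lambda>x. v x * g x) x =
      (\<Sum>b | b ^ M = 1. root_proj M d (z / b) v x * (root_proj M d b g x / of_nat M))"
    by (simp add: h_def R_def)
qed

text \<open>The last clause ties the product of the two eigenvalues to the eigenvalue of the whole
  sum \<open>u\<close>, so that in the end any nonzero summand can be used.\<close>

definition eigen_pairs where
  "eigen_pairs D v g u = {(v', g'). v' \<in> shift_span v \<and> g' \<in> shift_span g \<and> (\<forall>d\<in>D. \<exists>b c.
    (\<forall>x. v' (x - d) = b * v' x) \<and> (\<forall>x. g' (x - d) = c * g' x) \<and> (\<forall>x. u (x - d) = b * c * u x))}"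

text \<open>Projecting a product onto an eigenspace gives a sum of products of eigenfunctions rather than a
  single product, so the invariant of the induction is membership in \<open>prod_sums\<close>.\<close>

lemma product_eigenvectors:
  fixes v g :: "'a::ring_1 \<Rightarrow> complex"
  assumes M: "M > 0" and D: "finite D"
    and pv: "\<And>d x. d \<in> D \<Longrightarrow> v (x - of_nat M * d) = v x"
    and pg: "\<And>d x. d \<in> D \<Longrightarrow> g (x - of_nat M * d) = g x"
    and nz: "(\<lambda>x. v x * g x) \<noteq> (\<lambda>_. 0)"
  obtains u' v' g' where "u' \<in> shift_span (\<lambda>x. v x * g x)" "v' \<in> shift_span v" "g' \<in> shift_span g"
    "u' \<noteq> (\<lambda>_. 0)" "v' \<noteq> (\<lambda>_. 0)" "g' \<noteq> (\<lambda>_. 0)"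
    "\<And>d. d \<in> D \<Longrightarrow> d \<in> eigs u' \<and> d \<in> eigs v' \<and> d \<in> eigs g' \<and> eig u' d = eig v' d * eig g' d"
proof -
  have "\<exists>u\<in>shift_span (\<lambda>x. v x * g x). u \<noteq> (\<lambda>_. 0) \<and> u \<in> prod_sums (eigen_pairs D v g u)"
    using D pv pg
  proof (induction D rule: finite_induct)
    case empty
    have "(v, g) \<in> eigen_pairs {} v g (\<lambda>x. v x * g x)"
      by (simp add: eigen_pairs_def shift_span.base)
    from prod_sums.add[OF this prod_sums.zero]
    show ?case using nz by (intro bexI[of _ "\<lambda>x. v x * g x"]) (simp_all add: shift_span.base)
  next
    case (insert d D)
    obtain u where u: "u \<in> shift_span (\<lambda>x. v x * g x)" "u \<noteq> (\<lambda>_. 0)" "u \<in> prod_sums (eigen_pairs D v g u)"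
      using insert.IH[OF insert.prems(1) insert.prems(2)] by blast
    obtain z where z: "z ^ M = 1" "root_proj M d z u \<noteq> (\<lambda>_. 0)"
      by (rule root_proj_nonzero[OF u(2) M])
    define u' where "u' = root_proj M d z u"
    have u': "u' \<in> shift_span u" unfolding u'_def by (rule root_proj_in_span)
    have peru: "u (x - of_nat M * d) = u x" for x
      using shift_span_eigen[OF u(1), of "of_nat M * d" 1] insert.prems by simp
    have eu': "u' (x - d) = z * u' x" for x unfolding u'_def by (rule root_proj_eigen[OF M z(1)]) (rule peru)
    \<comment> \<open>The components at \<open>z / b\<close> and at \<open>b\<close> have product
      eigenvalue \<open>z\<close>, that of the projected sum.\<close>
    have pair: "(root_proj M d (z / b) v1, \<lambda>x. root_proj M d b g1 x / of_nat M) \<in> eigen_pairs (insert d D) v g u'"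
      if vg: "(v1, g1) \<in> eigen_pairs D v g u" and b: "b ^ M = 1" for v1 g1 b
    proof -
      have b0: "b \<noteq> 0" using b M by (metis power_0_left zero_neq_one less_irrefl)
      have zb: "(z / b) ^ M = 1" using z(1) b by (simp add: power_divide)
      have s: "v1 \<in> shift_span v" "g1 \<in> shift_span g" using vg by (auto simp: eigen_pairs_def)
      let ?v = "root_proj M d (z / b) v1" and ?g = "\<lambda>x. root_proj M d b g1 x / of_nat M"
      have sv: "?v \<in> shift_span v1" by (rule root_proj_in_span)
      have sg: "?g \<in> shift_span g1"
        using shift_span.scale[OF root_proj_in_span, of "1 / of_nat M" M d b g1] by simp
      have ev: "?v (x - d) = z / b * ?v x" for x
        by (rule root_proj_eigen[OF M zb]) (use shift_span_eigen[OF s(1), of "of_nat M * d" 1] insert.prems in simp)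
      have eg: "root_proj M d b g1 (x - d) = b * root_proj M d b g1 x" for x
        by (rule root_proj_eigen[OF M b]) (use shift_span_eigen[OF s(2), of "of_nat M * d" 1] insert.prems in simp)
      have "\<exists>b c. (\<forall>x. ?v (x - e) = b * ?v x) \<and> (\<forall>x. ?g (x - e) = c * ?g x) \<and> (\<forall>x. u' (x - e) = b * c * u' x)"
        if e: "e \<in> insert d D" for e
      proof (cases "e = d")
        case True
        then show ?thesis using ev eg eu' b0 by (intro exI[of _ "z / b"] exI[of _ b]) simp
      next
        case False
        then obtain \<beta> \<gamma> where r: "\<forall>x. v1 (x - e) = \<beta> * v1 x" "\<forall>x. g1 (x - e) = \<gamma> * g1 x"
          "\<forall>x. u (x - e) = \<beta> * \<gamma> * u x" using e vg unfolding eigen_pairs_def by blast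
        show ?thesis
          using shift_span_eigen[OF sv r(1)[rule_format]] shift_span_eigen[OF sg r(2)[rule_format]]
            shift_span_eigen[OF u' r(3)[rule_format]]
          by (intro exI[of _ \<beta>] exI[of _ \<gamma>] conjI allI) assumption+
      qed
      then show ?thesis using shift_span_trans[OF sv s(1)] shift_span_trans[OF sg s(2)]
        unfolding eigen_pairs_def by blast
    qed
    have proj: "root_proj M d z h \<in> prod_sums (eigen_pairs (insert d D) v g u')"
      if "h \<in> prod_sums (eigen_pairs D v g u)" for h
      using that
    proof induction
      case zero
      have "root_proj M d z (\<lambda>_. 0) = (\<lambda>_. 0)" by (simp add: root_proj_def[abs_def])
      then show ?case using prod_sums.zero by simp
    next
      case (add v1 g1 h)
      have fin: "finite {b :: complex. b ^ M = 1}" using finite_roots_unity[of M] M by simp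
      have "g1 (x - of_nat M * d) = g1 x" for x
        using add.hyps(1) shift_span_eigen[of g1 g "of_nat M * d" 1] insert.prems by (simp add: eigen_pairs_def)
      note eq = root_proj_product[of M g1 d z v1, OF M this]
      have "root_proj M d z (\<lambda>x. v1 x * g1 x) \<in> prod_sums (eigen_pairs (insert d D) v g u')"
        unfolding eq by (rule prod_sums_sum[OF fin]) (use pair[OF add.hyps(1)] in simp)
      from prod_sums_plus[OF this add.IH] show ?case
        by (simp add: root_proj_def[abs_def] distrib_left sum.distrib)
    qed
    show ?case
    proof (intro bexI conjI)
      show "u' \<noteq> (\<lambda>_. 0)" using z(2) by (simp add: u'_def)
      show "u' \<in> shift_span (\<lambda>x. v x * g x)" by (rule shift_span_trans[OF u' u(1)])
      show "u' \<in> prod_sums (eigen_pairs (insert d D) v g u')" using proj[OF u(3)] by (simp only: u'_def)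
    qed
  qed
  then obtain u where u: "u \<in> shift_span (\<lambda>x. v x * g x)" "u \<noteq> (\<lambda>_. 0)" "u \<in> prod_sums (eigen_pairs D v g u)"
    by blast
  obtain v' g' where vg: "(v', g') \<in> eigen_pairs D v g u" "v' \<noteq> (\<lambda>_. 0)" "g' \<noteq> (\<lambda>_. 0)"
    by (rule prod_sums_nonzero[OF u(3,2)])
  have "d \<in> eigs u \<and> d \<in> eigs v' \<and> d \<in> eigs g' \<and> eig u d = eig v' d * eig g' d" if "d \<in> D" for d
  proof -
    obtain b c where r: "\<forall>x. v' (x - d) = b * v' x" "\<forall>x. g' (x - d) = c * g' x" "\<forall>x. u (x - d) = b * c * u x"
      using vg(1) \<open>d \<in> D\<close> unfolding eigen_pairs_def by blast
    show ?thesis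
      using eigI[OF vg(2) r(1)[rule_format]] eigI[OF vg(3) r(2)[rule_format]] eigI[OF u(2) r(3)[rule_format]] by simp
  qed
  moreover have "v' \<in> shift_span v" "g' \<in> shift_span g" using vg(1) by (auto simp: eigen_pairs_def)
  ultimately show ?thesis using that[OF u(1) _ _ u(2) vg(2,3)] by blast
qed

text \<open>Average along each \<open>M d\<close>. The covering identity is given only on the
  support of \<open>\<delta>\<close>, but this support is invariant under \<open>M d\<close>, so the
  identity holds along whole orbits and survives the averaging.\<close>

lemma periodic_cover:
  fixes u \<delta> :: "'a::{ring_1,countable} \<Rightarrow> complex"
  assumes D: "finite D" and bdd: "bounded (range u)"
    and tile: "\<And>r x. r > 0 \<Longrightarrow> coprime r p \<Longrightarrow> (\<Sum>f\<in>F. u (x - of_nat r * f)) = 1"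
    and cover: "\<And>x f. \<delta> x \<noteq> 0 \<Longrightarrow> f \<in> F \<Longrightarrow> (\<Sum>t\<in>T. u (x + f - t)) = \<kappa> f"
    and per: "\<And>d x. d \<in> D \<Longrightarrow> \<delta> (x - of_nat M * d) = \<delta> x"
  obtains w where "bounded (range w)"
    "\<And>r x. r > 0 \<Longrightarrow> coprime r p \<Longrightarrow> (\<Sum>f\<in>F. w (x - of_nat r * f)) = 1"
    "\<And>x f. \<delta> x \<noteq> 0 \<Longrightarrow> f \<in> F \<Longrightarrow> (\<Sum>t\<in>T. w (x + f - t)) = \<kappa> f"
    "\<And>d x. d \<in> D \<Longrightarrow> w (x - of_nat M * d) = w x"
proof -
  have "\<exists>w. bounded (range w) \<and>
    (\<forall>r x. r > 0 \<longrightarrow> coprime r p \<longrightarrow> (\<Sum>f\<in>F. w (x - of_nat r * f)) = 1) \<and>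
    (\<forall>x f. \<delta> x \<noteq> 0 \<longrightarrow> f \<in> F \<longrightarrow> (\<Sum>t\<in>T. w (x + f - t)) = \<kappa> f) \<and>
    (\<forall>d\<in>D. \<forall>x. w (x - of_nat M * d) = w x)"
    using D per
  proof (induction D rule: finite_induct)
    case empty
    show ?case by (rule exI[of _ u]) (use bdd tile cover in auto)
  next
    case (insert d D)
    have per': "\<delta> (x - of_nat M * e) = \<delta> x" if "e \<in> D" for e x using insert.prems that by blast
    obtain w where w: "bounded (range w)"
      and wt: "\<And>r x. r > 0 \<Longrightarrow> coprime r p \<Longrightarrow> (\<Sum>f\<in>F. w (x - of_nat r * f)) = 1"
      and wc: "\<And>x f. \<delta> x \<noteq> 0 \<Longrightarrow> f \<in> F \<Longrightarrow> (\<Sum>t\<in>T. w (x + f - t)) = \<kappa> f"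
      and wp: "\<And>e x. e \<in> D \<Longrightarrow> w (x - of_nat M * e) = w x"
      using insert.IH[OF per'] by blast
    have z: "norm (1::complex) = 1" by simp
    obtain w' where w': "bounded (range w')" "\<And>x. w' (x - of_nat M * d) = 1 * w' x"
      and lin: "\<And>(S :: 'a set) c g x \<kappa>. (\<And>j. (\<Sum>s\<in>S. c s * w (x - of_nat j * (of_nat M * d) - g s)) = 1 ^ j * \<kappa>) \<Longrightarrow>
        (\<Sum>s\<in>S. c s * w' (x - g s)) = \<kappa>"
      and eig: "\<And>e c x. (\<And>y. w (y - e) = c * w y) \<Longrightarrow> w' (x - e) = c * w' x"
      by (rule averaging[OF w z, of "of_nat M * d"]) blast
    have perj: "\<delta> (x - of_nat j * (of_nat M * d)) = \<delta> x" for j x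
    proof (induction j)
      case (Suc j)
      then show ?case using insert.prems[of d "x - of_nat j * (of_nat M * d)"] by (simp add: algebra_simps)
    qed simp
    have t: "(\<Sum>f\<in>F. w' (x - of_nat r * f)) = 1" if "r > 0" "coprime r p" for r x
      using lin[where S = F and c = "\<lambda>_. 1" and x = x and g = "\<lambda>f. of_nat r * f" and \<kappa> = 1] wt[OF that] by simp
    have c: "(\<Sum>t\<in>T. w' (x + f - t)) = \<kappa> f" if "\<delta> x \<noteq> 0" "f \<in> F" for x f
    proof -
      have "(\<Sum>t\<in>T. w (x + f - of_nat j * (of_nat M * d) - t)) = \<kappa> f" for j
        using wc[of "x - of_nat j * (of_nat M * d)" f] perj that by (simp add: algebra_simps)
      then show ?thesis using lin[where S = T and c = "\<lambda>_. 1" and x = "x + f" and g = "\<lambda>t. t" and \<kappa> = "\<kappa> f"] by simp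
    qed
    have pe: "w' (x - of_nat M * e) = w' x" if "e \<in> insert d D" for e x
      using that w'(2) eig[of "of_nat M * e" 1 x] wp by auto
    show ?case by (rule exI[of _ w']) (use w'(1) t c pe in blast)
  qed
  then show ?thesis using that by blast
qed

section \<open>Balanced triples\<close>

text \<open>By Newton's identities the numbers \<open>1, x, y\<close> have vanishing first two
  elementary symmetric functions, so they are the roots of \<open>X^3 - 1\<close>.\<close>

lemma balanced_triple:
  fixes x y :: complex
  assumes "1 + x + y = 0" "1 + x\<^sup>2 + y\<^sup>2 = 0"
  shows "1 + x + x\<^sup>2 = 0" "x ^ 3 = 1" "x \<noteq> 1" "y = x\<^sup>2"
proof -
  have y: "y = - 1 - x" using assms(1) by (metis add.commute add_diff_cancel_left' diff_0 diff_diff_add minus_diff_commute)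
  have "2 * (1 + x + x\<^sup>2) = 1 + x\<^sup>2 + y\<^sup>2" unfolding y by (simp add: power2_eq_square algebra_simps)
  then have "2 * (1 + x + x\<^sup>2) = 0" using assms(2) by (simp only:)
  then show s: "1 + x + x\<^sup>2 = 0" by (simp only: mult_eq_0_iff) simp
  have "x ^ 3 - 1 = (x - 1) * (1 + x + x\<^sup>2)" by (simp add: power2_eq_square power3_eq_cube algebra_simps)
  then show "x ^ 3 = 1" using s by simp
  show "x \<noteq> 1" using s by auto
  have "y - x\<^sup>2 = - (1 + x + x\<^sup>2)" unfolding y by simp
  then show "y = x\<^sup>2" using s by simp
qed

text \<open>The number 1 alone, or with one companion, cannot have both vanishing sum and vanishing
  sum of squares.\<close>

lemma balanced_card_3:
  fixes x :: "'i \<Rightarrow> complex"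
  assumes "card X \<le> 3" "f \<in> X" "finite X" "x f = 1" "(\<Sum>h\<in>X. x h) = 0" "(\<Sum>h\<in>X. (x h)\<^sup>2) = 0"
  obtains g h where "X = {f, g, h}" "g \<noteq> f" "h \<noteq> f" "g \<noteq> h" "1 + x g + x h = 0" "1 + (x g)\<^sup>2 + (x h)\<^sup>2 = 0"
proof -
  define Y where "Y = X - {f}"
  have X: "X = insert f Y" "f \<notin> Y" "finite Y" using assms by (auto simp: Y_def)
  have s: "1 + sum x Y = 0" "1 + (\<Sum>h\<in>Y. (x h)\<^sup>2) = 0" using assms X by simp_all
  have "card Y \<le> 2" using assms(1) X by simp
  then consider "card Y = 0" | "card Y = 1" | "card Y = 2" by linarith
  then show ?thesis
  proof cases
    case 1
    then show ?thesis using s X by simp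
  next
    case 2
    then obtain g where "Y = {g}" by (rule card_1_singletonE)
    then have "1 + x g = 0" "1 + (x g)\<^sup>2 = 0" using s by simp_all
    then have "x g = - 1" "1 + (x g)\<^sup>2 = 0" by (simp_all add: eq_neg_iff_add_eq_0 add.commute)
    then show ?thesis by simp
  next
    case 3
    then obtain g h where "Y = {g, h}" "g \<noteq> h" by (auto simp: card_2_iff)
    then show ?thesis using that[of g h] s X by (auto simp: add.assoc)
  qed
qed

lemma block_of_balanced:
  fixes \<psi> :: "'a::ring_1 \<Rightarrow> complex"
  assumes \<psi>: "\<psi> \<noteq> (\<lambda>_. 0)" and X: "card X \<le> 3" "finite X" "f \<in> X" "\<And>h. h \<in> X \<Longrightarrow> h - f \<in> eigs \<psi>"
    and s: "(\<Sum>h\<in>X. eig \<psi> (h - f) ^ 1) = 0" "(\<Sum>h\<in>X. eig \<psi> (h - f) ^ 2) = 0"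
  shows "block 3 \<psi> X"
proof -
  define x where "x h = eig \<psi> (h - f)" for h
  have xf: "x f = 1" by (simp add: x_def eig_0[OF \<psi>])
  have "sum x X = 0" "(\<Sum>h\<in>X. (x h)\<^sup>2) = 0" using s by (simp_all add: x_def)
  from balanced_card_3[OF X(1,3,2) xf this]
  obtain g h where gh: "X = {f, g, h}" "g \<noteq> f" "h \<noteq> f" "g \<noteq> h" "1 + x g + x h = 0" "1 + (x g)\<^sup>2 + (x h)\<^sup>2 = 0"
    by metis
  have sw: "1 + x h + x g = 0" "1 + (x h)\<^sup>2 + (x g)\<^sup>2 = 0" using gh(5,6) by (simp_all add: add_ac)
  note b = balanced_triple[OF gh(5,6)] and b' = balanced_triple[OF sw]
  have gh_ne: "x g \<noteq> x h"
  proof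
    assume "x g = x h"
    then have "x g = (x g)\<^sup>2" using b(4) by simp
    then have "x g = 0" using b(3) by (simp add: power2_eq_square)
    then show False using b(2) by simp
  qed
  show ?thesis
  proof (rule block_of_class[where g = f and c = 1, OF \<psi>])
    show "card X = 3" using gh by simp
    show "inj_on (\<lambda>h. eig \<psi> (h - f)) X"
      using gh_ne b(3) b'(3) xf unfolding gh(1) x_def[symmetric] by (auto simp: inj_on_def)
    show "eig \<psi> (k - f) ^ 3 = 1" if "k \<in> X" for k
      using that xf b(2) b'(2) unfolding gh(1) x_def[symmetric] by auto
  qed (use X(4) in auto)
qed

lemma third_cube_root:
  fixes s z :: complex
  assumes "s ^ 3 = 1" "s \<noteq> 1" "z ^ 3 = 1" "z \<noteq> 1" "z \<noteq> s"
  shows "z = s\<^sup>2"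
proof -
  obtain \<omega> :: complex where w: "\<omega> ^ 3 = 1" "\<And>z. z ^ 3 = 1 \<Longrightarrow> z = 1 \<or> z = \<omega> \<or> z = \<omega>\<^sup>2"
    by (rule cube_roots_of_unity) blast
  have "(\<omega>\<^sup>2)\<^sup>2 = \<omega> ^ 3 * \<omega>" by (simp add: power2_eq_square power3_eq_cube mult.assoc)
  then have "(\<omega>\<^sup>2)\<^sup>2 = \<omega>" using w(1) by simp
  then show ?thesis using w(2)[OF assms(1)] w(2)[OF assms(3)] assms by auto
qed

text \<open>Choose a preimage of \<open>g\<close> with the same eigenvalues along
  \<open>T - f\<close>, by averaging. Then \<open>g\<close> is the sum of these eigenvalues times a
  translate of the preimage, and a zero sum would force \<open>g = 0\<close>.\<close>

lemma sum_eigenvalues_nonzero: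
  fixes y :: "'a::{ring_1,countable} \<Rightarrow> complex"
  assumes bdd: "bounded (range y)" and g: "g \<in> shift_span (\<lambda>x. \<Sum>t\<in>T. y (x - t))" "g \<noteq> (\<lambda>_. 0)"
    and T: "finite T" "\<And>t. t \<in> T \<Longrightarrow> t - f \<in> eigs g" "\<And>t. t \<in> T \<Longrightarrow> norm (eig g (t - f)) = 1"
  shows "(\<Sum>t\<in>T. eig g (t - f)) \<noteq> 0"
proof
  assume 0: "(\<Sum>t\<in>T. eig g (t - f)) = 0"
  obtain \<xi> where \<xi>: "\<xi> \<in> shift_span y" "g = (\<lambda>x. \<Sum>t\<in>T. \<xi> (x - t))"
    by (rule shift_span_image[OF g(1)])
  have bdd\<xi>: "bounded (range \<xi>)" by (rule shift_span_bounded[OF \<xi>(1) bdd])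
  obtain vs where vs: "set vs = (\<lambda>t. (t - f, eig g (t - f))) ` T" 
    using finite_list[OF finite_imageI[OF T(1)]] by (rule exE)
  have vs': "norm z = 1 \<and> (\<forall>x. g (x - v) = z * g x)" if "(v, z) \<in> set vs" for v z
    using that T(2,3) eigD[OF g(2)] unfolding vs by auto
  obtain u where u: "g = (\<lambda>x. \<Sum>t\<in>T. u (x - t))" "\<And>v z x. (v, z) \<in> set vs \<Longrightarrow> u (x - v) = z * u x"
  proof (rule averaging_list[OF bdd\<xi> \<xi>(2) vs'])
    fix u assume "g = (\<lambda>x. \<Sum>t\<in>T. u (x - t))" "\<And>v z x. (v, z) \<in> set vs \<Longrightarrow> u (x - v) = z * u x"
    then show thesis by (rule that)
  qed
  have "u (x - t) = eig g (t - f) * u (x - f)" if "t \<in> T" for x t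
    using u(2)[of "t - f" "eig g (t - f)" "x - f"] that unfolding vs by simp
  then have "g x = (\<Sum>t\<in>T. eig g (t - f)) * u (x - f)" for x by (subst u(1)) (simp add: sum_distrib_right)
  then show False using 0 g(2) by auto
qed

section \<open>Nine elements\<close>

lemma level_eig_sum_eq_0:
  fixes \<delta> \<psi> :: "'a::ring_1 \<Rightarrow> complex"
  assumes \<psi>: "\<psi> \<in> shift_span \<delta>" "\<psi> \<noteq> (\<lambda>_. 0)" and S: "\<And>f. f \<in> S \<Longrightarrow> f - h \<in> eigs \<psi>"
    and 0: "\<And>y. (\<Sum>f\<in>S. \<delta> (y - of_nat r * (f - h))) = 0"
  shows "(\<Sum>f\<in>S. eig \<psi> (f - h) ^ r) = 0"
proof -
  obtain x where x: "\<psi> x \<noteq> 0" using \<psi>(2) by blast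
  have "(\<Sum>f\<in>S. \<psi> (x - of_nat r * (f - h))) = 0"
    by (rule shift_span_annihilated[OF \<psi>(1) 0])
  moreover have "\<psi> (x - of_nat r * (f - h)) = eig \<psi> (f - h) ^ r * \<psi> x" if "f \<in> S" for f
    using eigD[OF \<psi>(2) eig_of_nat_mult(1)[OF \<psi>(2) S[OF that]]] eig_of_nat_mult(2)[OF \<psi>(2) S[OF that]] by simp
  ultimately have "(\<Sum>f\<in>S. eig \<psi> (f - h) ^ r) * \<psi> x = 0" by (simp add: sum_distrib_right)
  then show ?thesis using x by simp
qed

text \<open>The function \<open>g\<close> below is a sum over \<open>T\<close> of translates, is killed by \<open>F\<close>, and equals \<open>1\<close> on the
  support of \<open>\<delta>\<close>, so \<open>\<delta> = \<delta> g\<close>. The eigenvalues of \<open>g'\<close> are quotients of those of \<open>u'\<close> and \<open>v'\<close>, both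
  in the span of \<open>\<delta>\<close>; that forces them to be \<open>1\<close> on \<open>T\<close>.\<close>

lemma periodic_tile_of_level:
  fixes F :: "(int ^ 'd::finite) set" and \<delta> u :: "int ^ 'd \<Rightarrow> complex"
  assumes fin: "finite F" and F0: "0 \<in> F" and card: "card F = 9"
    and add: "\<And>x y. \<nu> (x + y) = \<nu> x + (\<nu> y :: real)"
    and neg: "\<And>x. \<nu> x < 0 \<Longrightarrow> \<delta> x = 0" and nz: "\<delta> \<noteq> (\<lambda>_. 0)"
    and kill: "\<And>r x. r > 0 \<Longrightarrow> coprime r 3 \<Longrightarrow> (\<Sum>f\<in>F. \<delta> (x - of_nat r * f)) = 0"
    and M: "M > 0" and per: "\<And>v x. v \<in> grp F \<Longrightarrow> \<nu> v = 0 \<Longrightarrow> \<delta> (x - of_nat M * v) = \<delta> x"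
    and f0: "f0 \<in> F" and T: "T = {f \<in> F. \<nu> f = \<nu> f0}" and cardT: "card T = 3"
    and bdd: "bounded (range u)"
    and tile: "\<And>r x. r > 0 \<Longrightarrow> coprime r 3 \<Longrightarrow> (\<Sum>f\<in>F. u (x - of_nat r * f)) = 1"
    and cover: "\<And>x f. \<delta> x \<noteq> 0 \<Longrightarrow> f \<in> F \<Longrightarrow> (\<Sum>t\<in>T. u (x + f - t)) = of_bool (f \<in> T)"
  shows "periodic_tile F"
proof -
  have L: "add_subgroup (grp F)" by (rule add_subgroup_grp)
  have FL: "F \<subseteq> grp F" by (auto intro: grp_base)
  have TF: "T \<subseteq> F" "finite T" "f0 \<in> T" using T fin f0 by auto
  note l = additive_real[OF add]
  define D where "D = {f - g | f g. f \<in> F \<and> g \<in> F \<and> \<nu> f = \<nu> g}"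
  have D: "f - g \<in> D" if "f \<in> F" "g \<in> F" "\<nu> f = \<nu> g" for f g using that by (auto simp: D_def)
  have "D \<subseteq> (\<lambda>(f, g). f - g) ` (F \<times> F)" by (auto simp: D_def)
  then have finD: "finite D" using fin by (meson finite_SigmaI finite_imageI finite_subset)
  have "v \<in> grp F \<and> \<nu> v = 0" if "v \<in> D" for v
  proof -
    obtain f g where fg: "v = f - g" "f \<in> F" "g \<in> F" "\<nu> f = \<nu> g" using \<open>v \<in> D\<close> unfolding D_def by blast
    then have "f \<in> grp F" "g \<in> grp F" using FL by blast+
    then show ?thesis unfolding fg(1) using add_subgroupD(2)[OF L] fg(4) by (simp add: l(3))
  qed
  then have perD: "\<delta> (x - of_nat M * v) = \<delta> x" if "v \<in> D" for v x using per that by blast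
  obtain w :: "int ^ 'd \<Rightarrow> complex" where w: "bounded (range w)"
    and wt: "\<And>r x. r > 0 \<Longrightarrow> coprime r 3 \<Longrightarrow> (\<Sum>f\<in>F. w (x - of_nat r * f)) = 1"
    and wc: "\<And>x f. \<delta> x \<noteq> 0 \<Longrightarrow> f \<in> F \<Longrightarrow> (\<Sum>t\<in>T. w (x + f - t)) = of_bool (f \<in> T)"
    and wp: "\<And>d x. d \<in> D \<Longrightarrow> w (x - of_nat M * d) = w x"
  proof (rule periodic_cover[where \<kappa> = "\<lambda>f. of_bool (f \<in> T)", OF finD bdd tile cover perD])
    fix w :: "int ^ 'd \<Rightarrow> complex" assume "bounded (range w)"
      "\<And>r x. r > 0 \<Longrightarrow> coprime r 3 \<Longrightarrow> (\<Sum>f\<in>F. w (x - of_nat r * f)) = 1"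
      "\<And>x f. \<delta> x \<noteq> 0 \<Longrightarrow> f \<in> F \<Longrightarrow> (\<Sum>t\<in>T. w (x + f - t)) = of_bool (f \<in> T)"
      "\<And>d x. d \<in> D \<Longrightarrow> w (x - of_nat M * d) = w x"
    show thesis by (rule that[of w]; fact)
  qed
  obtain f' where f': "f' \<in> F" "f' \<notin> T"
  proof (rule ccontr)
    assume "\<not> thesis"
    then have "F \<subseteq> T" using that by blast
    then show False using card cardT card_mono[OF TF(2) \<open>F \<subseteq> T\<close>] by simp
  qed
  \<comment> \<open>Subtracting two shifts cancels the right-hand sides 1 of the tiling identities,
    while the covering values 1 at \<open>f0\<close> and 0 at \<open>f'\<close> give
    \<open>g\<close> the value 1 on the support of \<open>\<delta>\<close>.\<close>
  define y where "y = (\<lambda>x. w (x + f0) - w (x + f'))"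
  define g where "g = (\<lambda>x. \<Sum>t\<in>T. y (x - t))"
  have bddy: "bounded (range y)"
  proof -
    obtain C where C: "\<And>x. norm (w x) \<le> C" using w by (auto simp: bounded_iff)
    have "norm (y x) \<le> C + C" for x
      unfolding y_def by (rule order_trans[OF norm_triangle_ineq4 add_mono[OF C C]])
    then show ?thesis by (auto simp: bounded_iff)
  qed
  have g1: "g x = 1" if "\<delta> x \<noteq> 0" for x
  proof -
    have "g x = (\<Sum>t\<in>T. w (x + f0 - t)) - (\<Sum>t\<in>T. w (x + f' - t))"
      by (simp add: g_def y_def sum_subtractf algebra_simps)
    then show ?thesis using wc[OF that f0] wc[OF that f'(1)] TF(3) f'(2) by simp
  qed
  have \<delta>g: "(\<lambda>x. \<delta> x * g x) = \<delta>" using g1 by (auto simp: fun_eq_iff)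
  have perg: "g (x - of_nat M * d) = g x" if "d \<in> D" for d x
  proof -
    have "w (x - of_nat M * d - t + f) = w (x - t + f)" for t f
      using wp[OF that, of "x - t + f"] by (simp add: algebra_simps)
    then show ?thesis by (simp add: g_def y_def)
  qed
  have killg: "(\<Sum>f\<in>F. g (x - of_nat r * f)) = 0" if r: "r > 0" "coprime r 3" for r x
  proof -
    have "(\<Sum>f\<in>F. y (x - of_nat r * f)) = 0" for x
      using wt[OF r, of "x + f0"] wt[OF r, of "x + f'"] by (simp add: y_def sum_subtractf algebra_simps)
    then have "(\<Sum>t\<in>T. \<Sum>f\<in>F. y (x - t - of_nat r * f)) = 0" by simp
    then show ?thesis unfolding g_def by (subst sum.swap) (simp add: algebra_simps)
  qed
  have nz': "(\<lambda>x. \<delta> x * g x) \<noteq> (\<lambda>_. 0)" unfolding \<delta>g by (rule nz)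
  obtain u' v' g' where u': "u' \<in> shift_span \<delta>" "u' \<noteq> (\<lambda>_. 0)" and v': "v' \<in> shift_span \<delta>" "v' \<noteq> (\<lambda>_. 0)"
    and g': "g' \<in> shift_span g" "g' \<noteq> (\<lambda>_. 0)"
    and eD: "\<And>d. d \<in> D \<Longrightarrow> d \<in> eigs u' \<and> d \<in> eigs v' \<and> d \<in> eigs g' \<and> eig u' d = eig v' d * eig g' d"
  proof (rule product_eigenvectors[OF M finD perD perg nz', unfolded \<delta>g])
    fix u' v' g' assume "u' \<in> shift_span \<delta>" "v' \<in> shift_span \<delta>" "g' \<in> shift_span g"
      "u' \<noteq> (\<lambda>_. 0)" "v' \<noteq> (\<lambda>_. 0)" "g' \<noteq> (\<lambda>_. 0)"
      "\<And>d. d \<in> D \<Longrightarrow> d \<in> eigs u' \<and> d \<in> eigs v' \<and> d \<in> eigs g' \<and> eig u' d = eig v' d * eig g' d"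
    show thesis by (rule that[of u' v' g']; fact)
  qed
  define lev where "lev h = {f. f \<in> F \<and> \<nu> f = \<nu> h}" for h
  have levD: "f - h \<in> D" if "h \<in> F" "f \<in> lev h" for f h using that D by (auto simp: lev_def)
  have lev0: "(\<Sum>f\<in>lev h. \<delta> (x - of_nat r * (f - h))) = 0" if "h \<in> F" "r > 0" "coprime r 3" for h r x
    unfolding lev_def by (rule level_sum_eq_0[OF fin add neg kill M per _ that]) auto
  have lu: "(\<Sum>f\<in>lev h. eig u' (f - h) ^ r) = 0" if "h \<in> F" "r > 0" "coprime r 3" for h r
    by (rule level_eig_sum_eq_0[OF u' _ lev0[OF that]]) (use eD levD that in blast)
  have lv: "(\<Sum>f\<in>lev h. eig v' (f - h) ^ r) = 0" if "h \<in> F" "r > 0" "coprime r 3" for h r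
    by (rule level_eig_sum_eq_0[OF v' _ lev0[OF that]]) (use eD levD that in blast)
  have c12: "coprime 1 (3::nat)" "coprime 2 (3::nat)" by (auto intro: coprime_less_prime)
  have levT: "lev f0 = T" by (simp add: lev_def T)
  \<comment> \<open>On \<open>T\<close> both \<open>x\<close> and \<open>z\<close> list the cube
    roots of unity, so their quotient \<open>b\<close> takes the values 1, a cube root of unity and
    its square. A nontrivial cube root would make these sum to zero, impossible for a function that
    is a sum of translates over \<open>T\<close>.\<close>
  have gT: "eig g' (t - f0) = 1" if tT: "t \<in> T" for t
  proof -
    define x where "x h = eig u' (h - f0)" for h
    define z where "z h = eig v' (h - f0)" for h
    define b where "b h = eig g' (h - f0)" for h
    have x0: "x f0 = 1" "z f0 = 1" "b f0 = 1"
      using eig_0(2)[OF u'(2)] eig_0(2)[OF v'(2)] eig_0(2)[OF g'(2)] by (simp_all add: x_def z_def b_def)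
    have sx: "(\<Sum>h\<in>T. x h) = 0" "(\<Sum>h\<in>T. (x h)\<^sup>2) = 0"
      using lu[OF f0, of 1] lu[OF f0, of 2] c12 by (simp_all add: levT x_def)
    have sz: "(\<Sum>h\<in>T. z h) = 0" "(\<Sum>h\<in>T. (z h)\<^sup>2) = 0"
      using lv[OF f0, of 1] lv[OF f0, of 2] c12 by (simp_all add: levT z_def)
    have xzb: "x h = z h * b h" if "h \<in> T" for h
      using eD[OF levD[OF f0]] that unfolding levT x_def z_def b_def by blast
    obtain g1 h1 where gh: "T = {f0, g1, h1}" "g1 \<noteq> f0" "h1 \<noteq> f0" "g1 \<noteq> h1"
      and bx: "1 + x g1 + x h1 = 0" "1 + (x g1)\<^sup>2 + (x h1)\<^sup>2 = 0"
      by (rule balanced_card_3[of T f0 x, OF _ TF(3,2) x0(1) sx]) (use cardT in auto)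
    have bz: "1 + z g1 + z h1 = 0" "1 + (z g1)\<^sup>2 + (z h1)\<^sup>2 = 0"
      using sz gh x0(2) by (simp_all add: add.assoc)
    note tx = balanced_triple[OF bx] and tz = balanced_triple[OF bz]
    have z0: "z g1 \<noteq> 0" using tz(2) by auto
    have xg: "x g1 = z g1 * b g1" and xh: "x h1 = z h1 * b h1" using xzb gh by auto
    have b3: "b g1 ^ 3 = 1" using tx(2) tz(2) unfolding xg power_mult_distrib by simp
    have bh: "b h1 = (b g1)\<^sup>2"
      using tx(4) z0 unfolding xh tz(4) unfolding xg power_mult_distrib by simp
    have b3h: "b h1 ^ 3 = 1" unfolding bh using b3 by (metis mult.commute power_mult power_one)
    have "b g1 = 1"
    proof (rule ccontr)
      assume ne: "b g1 \<noteq> 1"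
      have "(b g1 - 1) * (1 + b g1 + (b g1)\<^sup>2) = b g1 ^ 3 - 1"
        by (simp add: power2_eq_square power3_eq_cube algebra_simps)
      then have 0: "1 + b g1 + (b g1)\<^sup>2 = 0" using ne b3 by simp
      have "t - f0 \<in> eigs g'" if "t \<in> T" for t using eD[OF levD[OF f0]] that unfolding levT by blast
      moreover have "norm (eig g' (t - f0)) = 1" if "t \<in> T" for t
      proof (rule norm_eig[OF g'(2) \<open>t \<in> T \<Longrightarrow> t - f0 \<in> eigs g'\<close>[OF \<open>t \<in> T\<close>], of 3])
        show "eig g' (t - f0) ^ 3 = 1" using that b3 b3h x0(3) unfolding gh(1) b_def by auto
      qed simp
      ultimately have "(\<Sum>t\<in>T. eig g' (t - f0)) \<noteq> 0"
        by (intro sum_eigenvalues_nonzero[OF bddy g'(1)[unfolded g_def] g'(2) TF(2)]) auto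
      moreover have "(\<Sum>t\<in>T. eig g' (t - f0)) = 1 + b g1 + b h1"
        using gh x0(3) by (simp add: b_def[symmetric] add.assoc)
      ultimately show False using 0 bh by simp
    qed
    then have "b t = 1" using tT bh x0(3) unfolding gh(1) by auto
    then show ?thesis by (simp add: b_def)
  qed
  have killg': "(\<Sum>f\<in>F. g' (x - of_nat r * f)) = 0" if "r > 0" "coprime r 3" for r x
    by (rule shift_span_annihilated[OF g'(1)]) (rule killg[OF that])
  \<comment> \<open>A terminal vector keeps the eigenvalue 1 on \<open>T\<close>. Thus the fibre
    over 1 in the class of \<open>f0\<close> has at least three elements; the three fibres are
    equally large, so the class is all of \<open>F\<close> and \<open>T\<close> is exactly that
    fibre.\<close>
  obtain \<omega> where \<omega>: "\<omega> \<in> shift_span g'" "\<omega> \<noteq> (\<lambda>_. 0)"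
    and cv: "\<And>h r. h \<in> F \<Longrightarrow> r > 0 \<Longrightarrow> coprime r 3 \<Longrightarrow>
      (\<Sum>f | f \<in> F \<and> related 3 \<omega> f h. eig \<omega> (f - h) ^ r) = 0"
    by (rule terminal_vector[OF fin _ g'(2) killg']) auto
  have \<omega>D: "eig \<omega> d = eig g' d" if "d \<in> D" for d
    using shift_span_eig(2)[OF \<omega>] eD that by blast
  define K where "K = {f. f \<in> F \<and> related 3 \<omega> f f0}"
  have Kcard: "3 * card {f \<in> K. eig \<omega> (f - f0) = z} = card K" if "z ^ 3 = 1" for z
  proof (rule card_fibre_of_power_sums[OF _ _ _ _ that])
    fix r :: nat assume "0 < r" "r < 3"
    then show "(\<Sum>f\<in>K. eig \<omega> (f - f0) ^ r) = 0"
      unfolding K_def by (intro cv[OF f0] coprime_less_prime) auto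
  qed (use fin in \<open>auto simp: K_def related_def\<close>)
  have T1: "T \<subseteq> {f \<in> K. eig \<omega> (f - f0) = 1}"
  proof
    fix t assume t: "t \<in> T"
    have d: "t - f0 \<in> D" using levD[OF f0] t levT by blast
    have "eig \<omega> (t - f0) = 1" using \<omega>D[OF d] gT[OF t] by simp
    moreover have "t - f0 \<in> eigs \<omega>" using shift_span_eig(1)[OF \<omega>] eD[OF d] by blast
    ultimately show "t \<in> {f \<in> K. eig \<omega> (f - f0) = 1}" using t TF(1) by (auto simp: K_def related_def)
  qed
  have KF: "K \<subseteq> F" "finite K" using fin by (auto simp: K_def)
  have "card T \<le> card {f \<in> K. eig \<omega> (f - f0) = 1}" using T1 KF(2) by (intro card_mono) auto
  then have "9 \<le> card K" using Kcard[of 1] cardT by simp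
  then have K: "K = F" using card_seteq[OF fin KF(1)] card by simp
  have fib: "card {f \<in> F. eig \<omega> (f - f0) = z} = 3" if "z ^ 3 = 1" for z
    using Kcard[OF that] card unfolding K by simp
  have Tfib: "T = {f \<in> F. eig \<omega> (f - f0) = 1}"
    by (rule card_subset_eq) (use T1 fib[of 1] cardT fin in \<open>auto simp: K\<close>)
  define e where "e = eig \<omega>"
  have H: "f - f0 \<in> eigs \<omega> \<and> e (f - f0) ^ 3 = 1" if "f \<in> F" for f
  proof -
    have "f \<in> K" using that by (simp only: K)
    then show ?thesis by (simp add: K_def related_def e_def)
  qed
  have subH: "add_subgroup {v \<in> eigs \<omega>. e v ^ 3 = 1}"
    unfolding add_subgroup_def e_def using eig_0[OF \<omega>(2)] eig_diff[OF \<omega>(2)] by (auto simp: power_divide)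
  have "f \<in> {v \<in> eigs \<omega>. e v ^ 3 = 1}" if "f \<in> F" for f
    using add_subgroupD(2)[OF subH, of "f - f0" "0 - f0"] H[OF that] H[OF F0] by simp
  then have "grp F \<subseteq> {v \<in> eigs \<omega>. e v ^ 3 = 1}" by (intro grp_least[OF subH]) blast
  then have eL: "v \<in> eigs \<omega>" "e v ^ 3 = 1" if "v \<in> grp F" for v using that by auto
  have e0: "e v \<noteq> 0" if "v \<in> grp F" for v using eL(2)[OF that] by auto
  have ediff: "e (v - w) = e v / e w" if "v \<in> grp F" "w \<in> grp F" for v w
    unfolding e_def by (rule eig_diff(2)[OF \<omega>(2) eL(1)[OF that(1)] eL(1)[OF that(2)]])
  have f0L: "f0 \<in> grp F" using f0 FL by blast
  show ?thesis
  proof (rule periodic_tile_of_blocks[where L = "grp F" and e = e and k = 3 and p = 3 and \<psi> = u',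
        OF fin L FL u'(2)])
    show "e (v + w) = e v * e w" if "v \<in> grp F" "w \<in> grp F" for v w
      unfolding e_def by (rule eig_add(2)[OF \<omega>(2) eL(1)[OF that(1)] eL(1)[OF that(2)]])
    show "\<exists>f\<in>F. e x = e f" if x: "x \<in> grp F" for x
    proof -
      have "(e x / e f0) ^ 3 = 1" using eL(2)[OF x] eL(2)[OF f0L] by (simp add: power_divide)
      from fib[OF this] have "{f \<in> F. eig \<omega> (f - f0) = e x / e f0} \<noteq> {}" by (metis card.empty zero_neq_numeral)
      then obtain f where f: "f \<in> F" "e (f - f0) = e x / e f0" by (auto simp: e_def)
      have "e f = e x" using f ediff[of f f0] FL f0L e0[OF f0L] by auto
      show ?thesis using \<open>e f = e x\<close>[symmetric] f(1) by (rule bexI[where x = f])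
    qed
    show "block 3 u' {h \<in> F. e h = e f}" if f: "f \<in> F" for f
    proof -
      define B where "B = {h \<in> F. e h = e f}"
      have fL: "f \<in> grp F" using f FL by blast
      have Beq: "B = {h \<in> F. eig \<omega> (h - f0) = e (f - f0)}"
      proof -
        have d: "e (h - f0) = e h / e f0" if "h \<in> F" for h using ediff[OF _ f0L] FL that by blast
        show ?thesis unfolding B_def e_def[symmetric] using e0[OF f0L] by (auto simp: d f)
      qed
      have cardB: "card B = 3" unfolding Beq using fib H[OF f] by blast
      define X Y where "X = lev f \<inter> B" and "Y = lev f - B"
      have finl: "finite (lev f)" using fin by (simp add: lev_def)
      have XB: "X \<subseteq> B" "finite B" "finite X" "f \<in> X"
        using fin f finl by (auto simp: X_def B_def lev_def)
      have levXY: "(\<Sum>h\<in>lev f. k h) = (\<Sum>h\<in>X. k h) + (\<Sum>h\<in>Y. k h)" for k :: "_ \<Rightarrow> complex"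
        unfolding X_def Y_def using finl
        by (subst sum.union_disjoint[symmetric]) (auto intro: sum.cong)
      \<comment> \<open>For \<open>f\<close> in \<open>T\<close>, \<open>X\<close> is the whole
        level. Otherwise \<open>u'\<close> and \<open>v'\<close> have the same eigenvalues on
        \<open>X\<close>, and eigenvalues differing by the factor \<open>s\<close> on
        \<open>Y\<close>. Both level sums vanish and \<open>s ^ r\<close> is not 1, so the parts
        over \<open>X\<close> and \<open>Y\<close> vanish separately.\<close>
      have X0: "(\<Sum>h\<in>X. eig u' (h - f) ^ r) = 0" if r: "r = 1 \<or> r = 2" for r
      proof -
        have r': "r > 0" "coprime r 3" using r c12 by auto
        define s where "s = e (f - f0)"
        have s3: "s ^ 3 = 1" using H[OF f] by (simp add: s_def)
        show ?thesis
        proof (cases "f \<in> T")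
          case True
          then have "s = 1" using Tfib by (simp add: s_def e_def)
          then have "B = T" unfolding Beq Tfib s_def by simp
          moreover have "lev f = T" using True by (auto simp: T lev_def)
          ultimately have "X = lev f" by (auto simp: X_def)
          then show ?thesis using lu[OF f r'] by simp
        next
          case False
          then have s1: "s \<noteq> 1" using f Tfib by (simp add: s_def e_def)
          have "s ^ r \<noteq> 1"
          proof
            assume "s ^ r = 1"
            then have "s\<^sup>2 = 1" using r s1 by auto
            then show False using s3 s1 by (simp add: power3_eq_cube power2_eq_square)
          qed
          have "eig u' (h - f) = eig v' (h - f)" if "h \<in> X" for h
          proof -
            have "h - f \<in> D" "h \<in> F" "e h = e f" using that levD[OF f] by (auto simp: X_def B_def)
            moreover have "e (h - f) = 1" using ediff[of h f] FL fL e0[OF fL] \<open>h \<in> F\<close> \<open>e h = e f\<close> by auto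
            ultimately show ?thesis using eD[of "h - f"] \<omega>D[of "h - f"] by (simp add: e_def)
          qed
          then have sX: "(\<Sum>h\<in>X. eig u' (h - f) ^ r) = (\<Sum>h\<in>X. eig v' (h - f) ^ r)" by simp
          have "eig u' (h - f) = s * eig v' (h - f)" if "h \<in> Y" for h
          proof -
            have h: "h - f \<in> D" "h \<in> F" "\<nu> h = \<nu> f" "h \<notin> B"
              using that levD[OF f] by (auto simp: Y_def lev_def)
            have hL: "h \<in> grp F" using h(2) FL by blast
            have "h \<notin> T" using h(3) False f by (auto simp: T)
            then have "e (h - f0) \<noteq> 1" using h(2) Tfib by (simp add: e_def)
            moreover have "e (h - f0) \<noteq> s" using h(2,4) unfolding Beq by (simp add: e_def s_def)
            \<comment> \<open>Off \<open>T\<close> and off the fibre of \<open>f\<close>, only the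
              third cube root of unity is left.\<close>
            ultimately have "e (h - f0) = s\<^sup>2" using third_cube_root[OF s3 s1, of "e (h - f0)"] H[OF h(2)] by blast
            then have "e h / e f0 = s\<^sup>2" "e f / e f0 = s"
              using ediff[OF hL f0L] ediff[OF fL f0L] by (simp_all only: s_def)
            then have "e h = s\<^sup>2 * e f0" "e f = s * e f0"
              using e0[OF f0L] by (simp_all only: nonzero_divide_eq_eq not_False_eq_True)
            then have "e (h - f) = s"
              using ediff[OF hL fL] e0[OF fL] e0[OF f0L] by (auto simp: power2_eq_square)
            then show ?thesis using eD[OF h(1)] \<omega>D[OF h(1)] by (simp add: e_def)
          qed
          then have sY: "(\<Sum>h\<in>Y. eig u' (h - f) ^ r) = s ^ r * (\<Sum>h\<in>Y. eig v' (h - f) ^ r)"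
            by (simp add: power_mult_distrib sum_distrib_left)
          have "(\<Sum>h\<in>X. eig v' (h - f) ^ r) + (\<Sum>h\<in>Y. eig v' (h - f) ^ r) = 0"
            "(\<Sum>h\<in>X. eig v' (h - f) ^ r) + s ^ r * (\<Sum>h\<in>Y. eig v' (h - f) ^ r) = 0"
            using lv[OF f r'] lu[OF f r'] unfolding levXY sX sY by simp_all
          then have "(s ^ r - 1) * (\<Sum>h\<in>Y. eig v' (h - f) ^ r) = 0" by (simp add: algebra_simps add_eq_0_iff)
          then show ?thesis using \<open>s ^ r \<noteq> 1\<close> \<open>_ + (\<Sum>h\<in>Y. eig v' (h - f) ^ r) = 0\<close> sX by simp
        qed
      qed
      have "block 3 u' X"
      proof (rule block_of_balanced[OF u'(2) _ XB(3,4)])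
        show "card X \<le> 3" using card_mono[OF XB(2,1)] cardB by simp
        show "h - f \<in> eigs u'" if "h \<in> X" for h using that eD levD[OF f] by (auto simp: X_def)
      qed (rule X0, simp)+
      \<comment> \<open>Being a block, \<open>X\<close> has as many elements as the fibre
        \<open>B\<close>, so the fibre lies in a single level.\<close>
      moreover have "X = B" using \<open>block 3 u' X\<close> XB(1,2) cardB by (intro card_subset_eq) (auto simp: block_def)
      ultimately show ?thesis by (simp add: B_def)
    qed
  qed (use eL in auto)
qed

lemma sum_of_bool_eq_1_iff:
  assumes "finite F"
  shows "(\<Sum>f\<in>F. of_bool (P f) :: int) = 1 \<longleftrightarrow> (\<exists>!f. f \<in> F \<and> P f)"
proof -
  have "(\<Sum>f\<in>F. of_bool (P f) :: int) = int (card {f \<in> F. P f})"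
    using assms by (simp add: of_bool_def sum.If_cases Int_def)
  moreover have "card {f \<in> F. P f} = 1 \<longleftrightarrow> (\<exists>f. {f \<in> F. P f} = {f})" by (simp add: card_1_singleton_iff)
  moreover have "(\<exists>f. {f \<in> F. P f} = {f}) \<longleftrightarrow> (\<exists>!f. f \<in> F \<and> P f)"
    unfolding set_eq_iff Ex1_def by (simp, metis)
  ultimately show ?thesis by simp
qed

lemma periodic_tile_9:
  fixes F :: "(int ^ 'd::finite) set" and a :: "int ^ 'd \<Rightarrow> int"
  assumes fin: "finite F" and F0: "0 \<in> F" and card: "card F = 9"
    and a01: "\<And>x. a x = 0 \<or> a x = 1" and tile: "\<And>x. (\<Sum>f\<in>F. a (x - f)) = 1"
  shows "periodic_tile F"
proof (rule ccontr)
  assume npt: "\<not> periodic_tile F"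
  have L: "add_subgroup (grp F)" by (rule add_subgroup_grp)
  have FL: "F \<subseteq> grp F" by (auto intro: grp_base)
  have unique: "\<exists>!f. f \<in> F \<and> b (x - f) = 1"
    if b: "\<And>x. b x = 0 \<or> b x = (1::int)" "(\<Sum>f\<in>F. b (x - f)) = 1" for b and x :: "int ^ 'd"
  proof -
    have "b y = of_bool (b y = 1)" for y using b(1)[of y] by auto
    then have "(\<Sum>f\<in>F. b (x - f)) = (\<Sum>f\<in>F. of_bool (b (x - f) = 1))" by (intro sum.cong) auto
    then show ?thesis using sum_of_bool_eq_1_iff[OF fin, of "\<lambda>f. b (x - f) = 1"] b(2) by simp
  qed
  have nonper: "\<exists>x\<in>grp F. \<exists>g\<in>grp F. a (x + of_nat N * g) \<noteq> a x" if N: "N > 0" for N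
  proof (rule ccontr)
    assume "\<not> ?thesis"
    then have "periodic_tile F"
      by (intro periodic_tile_of_subgroup[OF L FL N, of "{x. a x = 1}"]) (use unique[OF a01 tile] in auto)
    then show False using npt by blast
  qed
  obtain \<nu> :: "int ^ 'd \<Rightarrow> real" and a0 a1 :: "int ^ 'd \<Rightarrow> int"
    where add: "\<And>x y. \<nu> (x + y) = \<nu> x + \<nu> y" and ne: "\<exists>x\<in>grp F. \<nu> x \<noteq> 0"
      and loc0: "\<And>W. finite W \<Longrightarrow> \<exists>v. \<forall>x\<in>W. a0 x = a (x + v)"
      and loc1: "\<And>W. finite W \<Longrightarrow> \<exists>v. \<forall>x\<in>W. a1 x = a (x + v)"
      and half: "\<And>x. x \<in> grp F \<Longrightarrow> \<nu> x < 0 \<Longrightarrow> a0 x = a1 x" and diff: "a0 0 \<noteq> a1 0"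
    by (rule asymptotic_pair[OF L a01 nonper]) auto
  have b01: "b x = 0 \<or> b x = 1" if b: "\<And>W. finite W \<Longrightarrow> \<exists>v. \<forall>x\<in>W. b x = a (x + v)" for b x
  proof -
    obtain v where "b x = a (x + v)" using b[of "{x}"] by auto
    then show ?thesis using a01[of "x + v"] by simp
  qed
  note a0_01 = b01[OF loc0] and a1_01 = b01[OF loc1]
  have dilate: "(\<Sum>f\<in>F. complex_of_int (b (x - of_nat r * f))) = 1"
    if b: "\<And>W. finite W \<Longrightarrow> \<exists>v. \<forall>x\<in>W. b x = a (x + v)" and r: "r > 0" "coprime r 3" for b r x
  proof -
    have "card F = 3 * 3" using card by simp
    then have cop: "coprime r (card F)" using r(2) by (metis coprime_mult_right_iff)
    obtain v where v: "\<forall>y\<in>(\<lambda>f. x - of_nat r * f) ` F. b y = a (y + v)" using b fin by blast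
    have "(\<Sum>f\<in>F. complex_of_int (b (x - of_nat r * f))) = (\<Sum>f\<in>F. complex_of_int (a (x + v - of_nat r * f)))"
      using v by (intro sum.cong) (auto simp: algebra_simps)
    then show ?thesis using tile_dilate_complex[OF fin cop r(1) a01 tile] by simp
  qed
  \<comment> \<open>Cut off outside \<open>grp F\<close>, because agreement on the half-space is
    known only inside this group.\<close>
  define di where "di x = (if x \<in> grp F then a1 x - a0 x else 0)" for x
  define \<delta> where "\<delta> x = complex_of_int (di x)" for x
  have "norm (\<delta> x) \<le> 1" for x using a0_01[of x] a1_01[of x] by (auto simp: \<delta>_def di_def)
  then have bdd: "bounded (range \<delta>)" by (auto simp: bounded_iff)
  have neg: "\<delta> x = 0" if "\<nu> x < 0" for x using half[OF _ that] by (simp add: \<delta>_def di_def)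
  have nz: "\<delta> \<noteq> (\<lambda>_. 0)"
  proof
    assume "\<delta> = (\<lambda>_. 0)"
    then have "\<delta> 0 = 0" by simp
    then show False using diff add_subgroupD(1)[OF L] by (simp add: \<delta>_def di_def)
  qed
  have kill: "(\<Sum>f\<in>F. \<delta> (x - of_nat r * f)) = 0" if r: "r > 0" "coprime r 3" for r x
  proof (cases "x \<in> grp F")
    case True
    then have "x - of_nat r * f \<in> grp F" if "f \<in> F" for f
      using that FL add_subgroupD(2)[OF L] add_subgroup_of_nat_mult[OF L] by blast
    then have "(\<Sum>f\<in>F. \<delta> (x - of_nat r * f)) =
        (\<Sum>f\<in>F. complex_of_int (a1 (x - of_nat r * f)) - complex_of_int (a0 (x - of_nat r * f)))"
      by (intro sum.cong) (auto simp: \<delta>_def di_def)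
    also have "\<dots> = 0" using dilate[OF loc1 r] dilate[OF loc0 r] by (simp add: sum_subtractf)
    finally show ?thesis .
  next
    case False
    have "x - of_nat r * f \<notin> grp F" if f: "f \<in> F" for f
    proof
      assume "x - of_nat r * f \<in> grp F"
      moreover have "of_nat r * f \<in> grp F" using f FL add_subgroup_of_nat_mult[OF L] by blast
      ultimately have "x - of_nat r * f + of_nat r * f \<in> grp F" by (rule add_subgroupD(4)[OF L])
      then show False using False by simp
    qed
    then show ?thesis by (intro sum.neutral) (auto simp: \<delta>_def di_def)
  qed
  have os: "one_sided \<nu> \<delta>" unfolding one_sided_def using neg by blast
  obtain M where M: "M > 0" and per: "\<And>v x. v \<in> grp F \<Longrightarrow> \<nu> v = 0 \<Longrightarrow> \<delta> (x - of_nat M * v) = \<delta> x"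
    using kernel_period[OF npt fin F0 card add ne bdd os kill] by blast
  obtain f0 where f0: "f0 \<in> F" "card {f \<in> F. \<nu> f = \<nu> f0} = 3"
    by (rule level_of_card_3[OF fin F0 card add ne os nz kill])
  define T where "T = {f \<in> F. \<nu> f = \<nu> f0}"
  define u where "u x = complex_of_int (a1 x)" for x
  have "norm (u x) \<le> 1" for x using a1_01[of x] by (auto simp: u_def)
  then have bddu: "bounded (range u)" by (auto simp: bounded_iff)
  \<comment> \<open>The element of \<open>F\<close> that covers \<open>x + f\<close> in the tiling
    \<open>a1\<close> lies on the level of \<open>f\<close>. If \<open>a1 x = 1\<close> it is
    \<open>f\<close>. Otherwise \<open>\<delta> x = -1\<close>, and the vanishing level sum must
    contain a compensating positive term, which is a point of \<open>a1\<close> reached from the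
    same level.\<close>
  have cover: "(\<Sum>t\<in>T. u (x + f - t)) = of_bool (f \<in> T)" if x: "\<delta> x \<noteq> 0" and f: "f \<in> F" for x f
  proof -
    have xL: "x \<in> grp F" and x10: "a1 x \<noteq> a0 x" using x by (auto simp: \<delta>_def di_def split: if_splits)
    have "\<exists>h. h \<in> F \<and> \<nu> h = \<nu> f \<and> a1 (x + f - h) = 1"
    proof (cases "a1 x = 1")
      case True
      then show ?thesis using f by (intro exI[of _ f]) simp
    next
      case False
      then have dx: "di x = - 1" using x10 xL a0_01[of x] a1_01[of x] by (auto simp: di_def)
      define S where "S = {h. h \<in> F \<and> \<nu> h = \<nu> f}"
      have S: "finite S" "f \<in> S" using fin f by (auto simp: S_def)
      show ?thesis
      proof (rule ccontr)
        assume no: "\<not> ?thesis"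
        have "di (x - (h - f)) \<le> 0" if "h \<in> S" for h
        proof -
          have "a1 (x - (h - f)) = 0" using no that a1_01[of "x - (h - f)"] by (auto simp: S_def algebra_simps)
          then show ?thesis using a0_01[of "x - (h - f)"] by (auto simp: di_def)
        qed
        then have "(\<Sum>h\<in>S - {f}. di (x - (h - f))) \<le> 0" by (intro sum_nonpos) auto
        then have "(\<Sum>h\<in>S. di (x - (h - f))) < 0"
          using sum.remove[OF S, of "\<lambda>h. di (x - (h - f))"] dx by simp
        moreover have "(\<Sum>h\<in>S. \<delta> (x - of_nat 1 * (h - f))) = 0"
          unfolding S_def by (rule level_sum_eq_0[OF fin add neg kill M per _ f]) auto
        then have "complex_of_int (\<Sum>h\<in>S. di (x - (h - f))) = 0" by (simp add: \<delta>_def)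
        ultimately show False by (simp only: of_int_eq_0_iff)
      qed
    qed
    then obtain h where h: "h \<in> F" "\<nu> h = \<nu> f" "a1 (x + f - h) = 1" by blast
    have "(\<Sum>k\<in>F. complex_of_int (a1 (x + f - of_nat 1 * k))) = 1" by (rule dilate[OF loc1]) auto
    then have "complex_of_int (\<Sum>k\<in>F. a1 (x + f - k)) = 1" by simp
    then have "(\<Sum>k\<in>F. a1 (x + f - k)) = 1" by (simp only: of_int_eq_1_iff)
    from unique[OF a1_01 this] have "a1 (x + f - k) = of_bool (k = h)" if "k \<in> F" for k
      using h that a1_01[of "x + f - k"] by auto
    then have "(\<Sum>t\<in>T. u (x + f - t)) = (\<Sum>t\<in>T. of_bool (t = h))"
      by (intro sum.cong) (auto simp: u_def T_def)
    also have "\<dots> = of_bool (h \<in> T)" using fin by (simp add: T_def of_bool_def)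
    also have "h \<in> T \<longleftrightarrow> f \<in> T" using h f by (simp add: T_def)
    finally show ?thesis .
  qed
  have "periodic_tile F"
    by (rule periodic_tile_of_level[OF fin F0 card add neg nz kill M per f0(1) T_def _ bddu _ cover])
      (use f0(2) dilate[OF loc1] in \<open>auto simp: T_def u_def\<close>)
  then show False using npt by blast
qed

section \<open>Tiling complements\<close>

lemma tiling_complement_iff:
  "tiling_complement F A \<longleftrightarrow> (\<forall>x. \<exists>!f. f \<in> F \<and> x - f \<in> A)"
proof -
  have "(\<exists>!p. p \<in> F \<times> A \<and> x = fst p + snd p) \<longleftrightarrow> (\<exists>!f. f \<in> F \<and> x - f \<in> A)" for x
  proof
    assume "\<exists>!p. p \<in> F \<times> A \<and> x = fst p + snd p"
    then obtain p where p: "p \<in> F \<times> A" "x = fst p + snd p"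
      and u: "\<And>p'. p' \<in> F \<times> A \<Longrightarrow> x = fst p' + snd p' \<Longrightarrow> p' = p" by (elim ex1E) blast
    show "\<exists>!f. f \<in> F \<and> x - f \<in> A"
    proof (rule ex1I[of _ "fst p"])
      fix f assume "f \<in> F \<and> x - f \<in> A"
      then have "(f, x - f) = p" by (intro u) auto
      then show "f = fst p" by auto
    qed (use p in auto)
  next
    assume "\<exists>!f. f \<in> F \<and> x - f \<in> A"
    then obtain f where f: "f \<in> F" "x - f \<in> A"
      and u: "\<And>f'. f' \<in> F \<Longrightarrow> x - f' \<in> A \<Longrightarrow> f' = f" by (elim ex1E) blast
    show "\<exists>!p. p \<in> F \<times> A \<and> x = fst p + snd p"
    proof (rule ex1I[of _ "(f, x - f)"])
      fix p assume p: "p \<in> F \<times> A \<and> x = fst p + snd p"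
      then have "snd p = x - fst p" by simp
      moreover have "fst p = f" using p calculation by (intro u) (auto simp: mem_Times_iff)
      ultimately show "p = (f, x - f)" by (simp add: prod_eq_iff)
    qed (use f in auto)
  qed
  then show ?thesis by (simp add: tiling_complement_def)
qed

lemma tiling_complement_translate:
  assumes "tiling_complement F A"
  shows "tiling_complement ((\<lambda>f. f - c) ` F) A"
  unfolding tiling_complement_iff
proof
  fix x
  obtain f where f: "f \<in> F" "x + c - f \<in> A"
    and u: "\<And>f'. f' \<in> F \<Longrightarrow> x + c - f' \<in> A \<Longrightarrow> f' = f"
    using assms unfolding tiling_complement_iff by (metis (no_types))
  show "\<exists>!f. f \<in> (\<lambda>f. f - c) ` F \<and> x - f \<in> A"
  proof (rule ex1I[of _ "f - c"])
    show "f - c \<in> (\<lambda>f. f - c) ` F \<and> x - (f - c) \<in> A" using f by (simp add: algebra_simps)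
    fix g assume "g \<in> (\<lambda>f. f - c) ` F \<and> x - g \<in> A"
    then obtain f' where f': "g = f' - c" "f' \<in> F" "x + c - f' \<in> A" by (auto simp: algebra_simps)
    then show "g = f - c" using u[of f'] by simp
  qed
qed

lemma finite_index_subgroup_multiples:
  assumes "M > 0"
  shows "finite_index_subgroup (range (\<lambda>z :: int ^ 'd::finite. M *s z))"
proof -
  let ?G = "add_group :: (int ^ 'd) monoid" and ?H = "range (\<lambda>z :: int ^ 'd. M *s z)"
  have "subgroup ?H ?G"
  proof (rule subgroup.intro)
    show "?H \<subseteq> carrier ?G" by (simp add: add_group_def)
    show "x \<otimes>\<^bsub>?G\<^esub> y \<in> ?H" if "x \<in> ?H" "y \<in> ?H" for x y
    proof -
      obtain u v where "x = M *s u" "y = M *s v" using \<open>x \<in> ?H\<close> \<open>y \<in> ?H\<close> by auto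
      then have "x \<otimes>\<^bsub>?G\<^esub> y = M *s (u + v)" by (simp add: add_group_def vector_add_ldistrib)
      then show ?thesis by (rule range_eqI)
    qed
    have "0 = M *s (0 :: int ^ 'd)" by simp
    then have "(0 :: int ^ 'd) \<in> ?H" by (rule range_eqI)
    then show "\<one>\<^bsub>?G\<^esub> \<in> ?H" by (simp add: add_group_def)
    show "inv\<^bsub>?G\<^esub> x \<in> ?H" if "x \<in> ?H" for x
    proof -
      obtain u where u: "x = M *s u" using \<open>x \<in> ?H\<close> by auto
      have "inv\<^bsub>?G\<^esub> x = - x"
        by (rule group.inv_equality[OF group_add_group]) (auto simp: add_group_def)
      also have "\<dots> = M *s (- u)" unfolding u by (simp add: vec_eq_iff)
      finally show ?thesis by (rule range_eqI)
    qed
  qed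
  moreover have "finite (rcosets\<^bsub>?G\<^esub> ?H)"
  proof (rule finite_subset)
    define R where "R = (\<lambda>g. (\<chi> i. g i) :: int ^ 'd) ` (UNIV \<rightarrow>\<^sub>E {0..<M})"
    show "finite ((\<lambda>a. ?H #>\<^bsub>?G\<^esub> a) ` R)" unfolding R_def by (intro finite_imageI finite_PiE) auto
    show "rcosets\<^bsub>?G\<^esub> ?H \<subseteq> (\<lambda>a. ?H #>\<^bsub>?G\<^esub> a) ` R"
    proof
      fix C assume "C \<in> rcosets\<^bsub>?G\<^esub> ?H"
      then obtain a where C: "C = ?H #>\<^bsub>?G\<^esub> a" unfolding RCOSETS_def by blast
      define r where "r = (\<chi> i. a $ i mod M)"
      define q where "q = (\<chi> i. a $ i div M)"
      have r: "r \<in> R" unfolding R_def r_def using assms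
        by (intro image_eqI[where x = "\<lambda>i. a $ i mod M"]) auto
      have a: "a = M *s q + r" by (simp add: vec_eq_iff q_def r_def)
      have e: "M *s z + a = M *s (z + q) + r" "M *s z + r = M *s (z - q) + a" for z
        unfolding a by (simp_all add: vec_eq_iff algebra_simps)
      have coset: "?H #>\<^bsub>?G\<^esub> b = range (\<lambda>z. M *s z + b)" for b
        by (auto simp: r_coset_def add_group_def)
      have "range (\<lambda>z. M *s z + a) = range (\<lambda>z. M *s z + r)"
        by (intro equalityI image_subsetI) (rule range_eqI, rule e)+
      then have "C = ?H #>\<^bsub>?G\<^esub> r" unfolding C coset .
      then show "C \<in> (\<lambda>a. ?H #>\<^bsub>?G\<^esub> a) ` R" using r by blast
    qed
  qed
  ultimately show ?thesis by (simp add: finite_index_subgroup_def)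
qed

theorem theorem1p1:
  fixes F :: "(int ^ 'd::finite) set"
  assumes "finite F"
    and "(\<exists>q::nat. prime q \<and> odd q \<and> card F = 2 * q) \<or> card F = 9"
    and "tiles F"
  shows "(\<exists>A. tiling_complement F A \<and> fully_periodic A) \<and>
    (\<exists>(M::int) B. M \<ge> 1 \<and> tiling_complement F B \<and> B + range (\<lambda>z. M *s z) = B)"
proof -
  obtain A where A: "tiling_complement F A" using assms(3) unfolding tiles_def by blast
  have "F \<noteq> {}" using assms(2) prime_gt_0_nat by auto
  then obtain c where c: "c \<in> F" by blast
  \<comment> \<open>Translating \<open>F\<close> does not change its complements, so the tile may be
    assumed to contain 0.\<close>
  define F' where "F' = (\<lambda>f. f - c) ` F"
  have fin: "finite F'" and F0: "0 \<in> F'" using assms(1) c by (auto simp: F'_def image_iff)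
  have card: "card F' = card F" unfolding F'_def by (intro card_image inj_onI) simp
  define a where "a x = (of_bool (x \<in> A) :: int)" for x
  have a01: "a x = 0 \<or> a x = 1" for x by (simp add: a_def)
  have "tiling_complement F' A" unfolding F'_def by (rule tiling_complement_translate[OF A])
  then have tile: "(\<Sum>f\<in>F'. a (x - f)) = 1" for x
    unfolding a_def sum_of_bool_eq_1_iff[OF fin] tiling_complement_iff by blast
  have "periodic_tile F'"
  proof (cases "card F = 9")
    case True
    then show ?thesis using periodic_tile_9[OF fin F0 _ a01 tile] card by simp
  next
    case False
    then obtain q where "prime q" "odd q" "card F' = 2 * q" using assms(2) card by auto
    then show ?thesis by (rule periodic_tile_2q[OF fin F0 _ _ _ a01 tile])
  qed
  then obtain N B where N: "N > (0::nat)" and B: "tiling_complement F' B"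
    and per: "\<And>x w. x \<in> B \<Longrightarrow> x + of_nat N * w \<in> B"
    unfolding periodic_tile_def tiling_complement_iff by blast
  define M where "M = int N"
  have M: "M \<ge> 1" using N by (simp add: M_def)
  \<comment> \<open>In the componentwise ring, \<open>of_nat N\<close> is the constant vector, so
    multiplying by it is scalar multiplication.\<close>
  have smult: "M *s z = of_nat N * z" for z :: "int ^ 'd"
    using of_int_index[where 'a = int and 'n = 'd, of M] by (simp add: vec_eq_iff M_def)
  have "(\<lambda>f. f - (- c)) ` F' = F" by (auto simp: F'_def image_image)
  then have FB: "tiling_complement F B" using tiling_complement_translate[OF B, of "- c"] by simp
  have "B \<subseteq> B + range (\<lambda>z. M *s z)"
  proof
    fix x assume "x \<in> B"
    then have "x + M *s 0 \<in> B + range (\<lambda>z. M *s z)" by (intro set_plus_intro rangeI)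
    then show "x \<in> B + range (\<lambda>z. M *s z)" by simp
  qed
  moreover have "B + range (\<lambda>z. M *s z) \<subseteq> B"
    using per by (auto simp: set_plus_def smult)
  ultimately have BM: "B + range (\<lambda>z. M *s z) = B" by blast
  have "fully_periodic B"
    unfolding fully_periodic_def using finite_index_subgroup_multiples[of M] M BM by auto
  then show ?thesis using M FB BM by blast
qed

end
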